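(* Let $1<p<\infty$, let $X$ be a complex Banach space with the symmetric approximation property, and let $E = l^p(\mathbb{Z},X)$. Let $A \in I + \mathcal{C}_E^{\$}$ be a Fredholm operator on $E$. Then, for arbitrary operators $B_+\in\sigma_+(A)$ and $B_-\in\sigma_-(A)$, $$\mathrm{ind}_+ B_+ = \mathrm{ind}_+ A \quad\text{and}\quad \mathrm{ind}_- B_- = \mathrm{ind}_- A,$$ and, consequently, $$\mathrm{ind}\,A = \mathrm{ind}_+ B_+ + \mathrm{ind}_- B_-.$$
   Context: A Banach space $X$ has the symmetric approximation property if there is a sequence $(\Pi_N)_{N\ge1}$ of finite-rank projections (idempotents) in $L(X)$ with $\Pi_N\to I$ strongly on $X$ and $\Pi_N^*\to I^*$ strongly on $X^*$. $l^p(\mathbb{Z},X)$ is the Banach space of sequences $x:\mathbb{Z}\to X$ with $\|x\|^p := \sum_n\|x_n\|_X^p<\infty$. Every $A\in L(E)$ has a two-sided infinite matrix representation $(A_{ij})_{i,j\in\mathbb{Z}}$ with entries in $L(X)$. $A$ is a band operator if there is $k$ with $A_{ij}=0$ for $|i-j|\ge k$. $\mathcal{A}_E$ is the norm closure in $L(E)$ of the set of band operators; its elements are called band-dominated. $\mathcal{C}_E$ is the closed ideal of $\mathcal{A}_E$ of those band-dominated operators all of whose matrix entries are compact. For $k\in\mathbb{Z}$, $(V_kx)_n := x_{n-k}$; for $n \ge 0$, $(P_nx)_k := x_k$ if $|k|\le n$ and $0$ otherwise. For $h:\mathbb{N}\to\mathbb{Z}$ with $|h(n)|\to\infty$, an operator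 $A_h\in L(E)$ is the limit operator of $A\in L(E)$ with respect to $h$ if $\lim_n\|P_k(V_{-h(n)}AV_{h(n)}-A_h)\| = \lim_n\|(V_{-h(n)}AV_{h(n)}-A_h)P_k\|=0$ for every $k\in\mathbb{N}$. $\sigma_+(A)$ (resp. $\sigma_-(A)$) is the set of limit operators of $A$ with respect to sequences tending to $+\infty$ (resp. $-\infty$). $A$ is rich if every sequence $h$ tending to infinity has a subsequence $g$ for which $A_g$ exists. $\mathcal{C}_E^{\$}$ is the set of rich operators in $\mathcal{C}_E$. Let $(Px)_k := x_k$ if $k\ge0$ and $0$ if $k<0$, and $Q:=I-P$. For $A\in I+\mathcal{C}_E$ the operators $PAQ$ and $QAP$ are compact, so $A$ is Fredholm if and only if $PAP+Q$ and $P+QAQ$ are Fredholm; in this case $\mathrm{ind}_+A := \mathrm{ind}(PAP+Q)$ and $\mathrm{ind}_-A := \mathrm{ind}(P+QAQ)$. The Fredholm index is $\mathrm{ind}\,A := \dim\ker A-\dim\mathrm{coker}\,A$. *)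

theory Defs
  imports "HOL-Analysis.Analysis" "HOL-Library.Function_Algebras"
begin

section \<open>Complex Banach spaces\<close>

class complex_vector = ab_group_add +
  fixes scaleC :: "complex \<Rightarrow> 'a \<Rightarrow> 'a"  (infixr "*\<^sub>C" 75)
  assumes scaleC_add_right: "c *\<^sub>C (x + y) = c *\<^sub>C x + c *\<^sub>C y"
    and scaleC_add_left: "(c + d) *\<^sub>C x = c *\<^sub>C x + d *\<^sub>C x"
    and scaleC_scaleC: "c *\<^sub>C (d *\<^sub>C x) = (c * d) *\<^sub>C x"
    and scaleC_one: "1 *\<^sub>C x = x"

class complex_banach = complex_vector + banach +
  assumes scaleR_scaleC: "r *\<^sub>R x = complex_of_real r *\<^sub>C x"
    and norm_scaleC: "norm (c *\<^sub>C x) = cmod c * norm x"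

instantiation complex :: complex_banach
begin
definition scaleC_complex_def: "c *\<^sub>C (x::complex) = c * x"
instance
  by standard (simp_all add: scaleC_complex_def algebra_simps scaleR_conv_of_real norm_mult)
end

instantiation "fun" :: (type, complex_vector) complex_vector
begin
definition scaleC_fun_def: "c *\<^sub>C f = (\<lambda>i. c *\<^sub>C f i)"
instance
  by standard
    (simp_all add: scaleC_fun_def fun_eq_iff scaleC_add_right scaleC_add_left scaleC_scaleC scaleC_one)
end

global_interpretation complex_vector:
    vector_space "scaleC :: complex \<Rightarrow> 'a \<Rightarrow> 'a::complex_vector"
  by standard (simp_all add: scaleC_add_right scaleC_add_left scaleC_scaleC scaleC_one)

definition bounded_clinear :: "('a::complex_banach \<Rightarrow> 'b::complex_banach) \<Rightarrow> bool" where
  "bounded_clinear T \<longleftrightarrow> bounded_linear T \<and> (\<forall>c x. T (c *\<^sub>C x) = c *\<^sub>C T x)"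

definition compact_operator :: "('a::complex_banach \<Rightarrow> 'b::complex_banach) \<Rightarrow> bool" where
  "compact_operator T \<longleftrightarrow> bounded_clinear T \<and> compact (closure (T ` cball 0 1))"

definition finite_dimensional :: "'v::complex_vector set \<Rightarrow> bool" where
  "finite_dimensional V \<longleftrightarrow> (\<exists>S. finite S \<and> V \<subseteq> complex_vector.span S)"

text \<open>The last condition is strong convergence of the adjoints on the dual space, since the
  adjoint of a projection \<open>Pr N\<close> maps a functional \<open>f\<close> to \<open>f \<circ> Pr N\<close>.\<close>

definition symmetric_approximation_property :: "'a::complex_banach itself \<Rightarrow> bool" where
  "symmetric_approximation_property _ \<longleftrightarrow>
    (\<exists>Pr :: nat \<Rightarrow> 'a \<Rightarrow> 'a.
      (\<forall>N. bounded_clinear (Pr N) \<and> Pr N \<circ> Pr N = Pr N \<and> finite_dimensional (range (Pr N))) \<and>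
      (\<forall>x. (\<lambda>N. Pr N x) \<longlonglongrightarrow> x) \<and>
      (\<forall>f :: 'a \<Rightarrow> complex. bounded_clinear f \<longrightarrow>
         (\<lambda>N. onorm (\<lambda>x. (f \<circ> Pr N) x - f x)) \<longlonglongrightarrow> 0))"

section \<open>The sequence space and its bounded operators\<close>

text \<open>The exponent is a term, so the sequence space is a set rather than a type. Operators on it
  are functions on all sequences, of which only the restriction to that set is relevant.\<close>

definition lp :: "real \<Rightarrow> (int \<Rightarrow> 'a::complex_banach) set" where
  "lp p = {x. (\<lambda>n. norm (x n) powr p) summable_on UNIV}"

definition lp_norm :: "real \<Rightarrow> (int \<Rightarrow> 'a::complex_banach) \<Rightarrow> real" where
  "lp_norm p x = (\<Sum>\<^sub>\<infinity>n. norm (x n) powr p) powr (1 / p)"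

type_synonym 'a seq_op = "(int \<Rightarrow> 'a) \<Rightarrow> (int \<Rightarrow> 'a)"

definition lp_op :: "real \<Rightarrow> 'a::complex_banach seq_op set" where
  "lp_op p = {T. T ` lp p \<subseteq> lp p \<and>
     (\<forall>x\<in>lp p. \<forall>y\<in>lp p. T (x + y) = T x + T y) \<and>
     (\<forall>c. \<forall>x\<in>lp p. T (c *\<^sub>C x) = c *\<^sub>C T x) \<and>
     (\<exists>C. \<forall>x\<in>lp p. lp_norm p (T x) \<le> C * lp_norm p x)}"

definition op_norm :: "real \<Rightarrow> 'a::complex_banach seq_op \<Rightarrow> real" where
  "op_norm p T = (SUP x\<in>{x \<in> lp p. lp_norm p x \<le> 1}. lp_norm p (T x))"

section \<open>Fredholm operators\<close>

definition op_kernel :: "real \<Rightarrow> 'a::complex_banach seq_op \<Rightarrow> (int \<Rightarrow> 'a) set" where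
  "op_kernel p T = {x \<in> lp p. T x = 0}"

text \<open>The cosets of the elements of the finite set \<open>B\<close> modulo the subspace \<open>W\<close> are pairwise
  distinct and form a basis of the quotient space \<open>V / W\<close>.\<close>

definition quotient_basis :: "'v::complex_vector set \<Rightarrow> 'v set \<Rightarrow> 'v set \<Rightarrow> bool" where
  "quotient_basis V W B \<longleftrightarrow> finite B \<and> B \<subseteq> V \<and>
     (\<forall>u. (\<Sum>b\<in>B. u b *\<^sub>C b) \<in> W \<longrightarrow> (\<forall>b\<in>B. u b = 0)) \<and>
     (\<forall>x\<in>V. \<exists>u. x - (\<Sum>b\<in>B. u b *\<^sub>C b) \<in> W)"

definition quotient_dim :: "'v::complex_vector set \<Rightarrow> 'v set \<Rightarrow> nat" where
  "quotient_dim V W = card (SOME B. quotient_basis V W B)"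

definition fredholm :: "real \<Rightarrow> 'a::complex_banach seq_op \<Rightarrow> bool" where
  "fredholm p T \<longleftrightarrow> T \<in> lp_op p \<and> finite_dimensional (op_kernel p T) \<and>
     (\<exists>B. quotient_basis (lp p) (T ` lp p) B)"

text \<open>Only meaningful for Fredholm operators.\<close>

definition ind :: "real \<Rightarrow> 'a::complex_banach seq_op \<Rightarrow> int" where
  "ind p T = int (complex_vector.dim (op_kernel p T)) - int (quotient_dim (lp p) (T ` lp p))"

section \<open>Band-dominated operators\<close>

definition single :: "int \<Rightarrow> 'a::complex_banach \<Rightarrow> int \<Rightarrow> 'a" where
  "single j a = (\<lambda>n. if n = j then a else 0)"

definition mat_entry :: "'a::complex_banach seq_op \<Rightarrow> int \<Rightarrow> int \<Rightarrow> 'a \<Rightarrow> 'a" where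
  "mat_entry A i j a = A (single j a) i"

definition band_op :: "real \<Rightarrow> 'a::complex_banach seq_op set" where
  "band_op p = {A \<in> lp_op p. \<exists>k. \<forall>i j. \<bar>i - j\<bar> \<ge> k \<longrightarrow> mat_entry A i j = (\<lambda>a. 0)}"

definition band_dominated :: "real \<Rightarrow> 'a::complex_banach seq_op set" where
  "band_dominated p = {A \<in> lp_op p. \<forall>\<epsilon>>0. \<exists>B\<in>band_op p. op_norm p (A - B) < \<epsilon>}"

definition band_dominated_compact :: "real \<Rightarrow> 'a::complex_banach seq_op set" where
  "band_dominated_compact p =
     {A \<in> band_dominated p. \<forall>i j. compact_operator (mat_entry A i j)}"

section \<open>Limit operators\<close>

definition shift :: "int \<Rightarrow> 'a::complex_banach seq_op" where
  "shift k x = (\<lambda>n. x (n - k))"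

definition trunc :: "nat \<Rightarrow> 'a::complex_banach seq_op" where
  "trunc n x = (\<lambda>k. if \<bar>k\<bar> \<le> int n then x k else 0)"

definition tends_to_infinity :: "(nat \<Rightarrow> int) \<Rightarrow> bool" where
  "tends_to_infinity h \<longleftrightarrow> filterlim (\<lambda>n. \<bar>h n\<bar>) at_top sequentially"

definition limit_operator ::
  "real \<Rightarrow> 'a::complex_banach seq_op \<Rightarrow> (nat \<Rightarrow> int) \<Rightarrow> 'a seq_op \<Rightarrow> bool" where
  "limit_operator p A h Ah \<longleftrightarrow> tends_to_infinity h \<and> Ah \<in> lp_op p \<and>
     (\<forall>k. (\<lambda>n. op_norm p (trunc k \<circ> ((shift (- h n) \<circ> A \<circ> shift (h n)) - Ah))) \<longlonglongrightarrow> 0 \<and>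
          (\<lambda>n. op_norm p (((shift (- h n) \<circ> A \<circ> shift (h n)) - Ah) \<circ> trunc k)) \<longlonglongrightarrow> 0)"

definition sigma_plus :: "real \<Rightarrow> 'a::complex_banach seq_op \<Rightarrow> 'a seq_op set" where
  "sigma_plus p A = {B. \<exists>h. filterlim h at_top sequentially \<and> limit_operator p A h B}"

definition sigma_minus :: "real \<Rightarrow> 'a::complex_banach seq_op \<Rightarrow> 'a seq_op set" where
  "sigma_minus p A = {B. \<exists>h. filterlim h at_bot sequentially \<and> limit_operator p A h B}"

definition rich :: "real \<Rightarrow> 'a::complex_banach seq_op \<Rightarrow> bool" where
  "rich p A \<longleftrightarrow> (\<forall>h. tends_to_infinity h \<longrightarrow>
     (\<exists>r. strict_mono r \<and> (\<exists>B. limit_operator p A (h \<circ> r) B)))"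

definition rich_band_dominated_compact :: "real \<Rightarrow> 'a::complex_banach seq_op set" where
  "rich_band_dominated_compact p = {A \<in> band_dominated_compact p. rich p A}"

section \<open>The indices at plus and minus infinity\<close>

definition proj_P :: "'a::complex_banach seq_op" where
  "proj_P x = (\<lambda>k. if 0 \<le> k then x k else 0)"

definition proj_Q :: "'a::complex_banach seq_op" where
  "proj_Q = id - proj_P"

definition half_plus :: "'a::complex_banach seq_op \<Rightarrow> 'a seq_op" where
  "half_plus A = (proj_P \<circ> A \<circ> proj_P) + proj_Q"

definition half_minus :: "'a::complex_banach seq_op \<Rightarrow> 'a seq_op" where
  "half_minus A = proj_P + (proj_Q \<circ> A \<circ> proj_Q)"

text \<open>Only meaningful if the respective half of \<open>A\<close> is a Fredholm operator.\<close>

definition ind_plus :: "real \<Rightarrow> 'a::complex_banach seq_op \<Rightarrow> int" where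
  "ind_plus p A = ind p (half_plus A)"

definition ind_minus :: "real \<Rightarrow> 'a::complex_banach seq_op \<Rightarrow> int" where
  "ind_minus p A = ind p (half_minus A)"

end

theory Submission
  imports Defs
begin

text \<open>Let \<open>S\<close> be one of the two half lines of the integers, \<open>P\<close> and \<open>Q\<close> the projections onto the
sequences supported on \<open>S\<close> and on its complement, and let \<open>B\<close> be the limit of the operators \<open>T\<^sub>n\<close>
obtained from \<open>A\<close> by conjugation with the shift by \<open>h n\<close>, where \<open>h\<close> tends to the end of \<open>S\<close>. The
index of \<open>A\<close> at that end is the index of \<open>P A P + Q\<close>.

It coincides with the index of \<open>P T\<^sub>n P + Q\<close>: after shifting back, the two operators differ only in
finitely many rows and columns of \<open>A - I\<close>, and these form a compact operator (\<open>index_half_T\<close>). It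
remains to pass from \<open>T\<^sub>n\<close> to \<open>B\<close>. The convergence of \<open>T\<^sub>n\<close> to \<open>B\<close> holds on bounded windows only,
so the index cannot be compared by continuity. Instead it is computed by gluing.

Let \<open>R\<close> be a regularizer of \<open>A\<close>, with finite-rank defects \<open>I - R A\<close> and \<open>I - A R\<close>. Shifting by
\<open>h n\<close> moves these defects away from every bounded window and from \<open>S\<close>, so that the shifted
regularizers \<open>R\<^sub>n\<close> act there as inverses of \<open>T\<^sub>n\<close>. This makes \<open>B\<close> invertible (\<open>B_bij\<close>), and since
an operator in the class considered here is the product of its two halves up to a compact operator
(\<open>fredholm_half\<close>), the indices of the two halves of \<open>B\<close> add up to zero. Now let \<open>Z\<close> be the operator
\<open>Q B + P T\<^sub>n\<close>, which acts like \<open>B\<close> on one side of the cut and like \<open>T\<^sub>n\<close> on the other. Near the cut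
\<open>B\<close> and \<open>T\<^sub>n\<close> agree up to a small error, therefore \<open>B\<inverse> Q + R\<^sub>n P\<close> is nearly a right inverse of \<open>Z\<close>,
and \<open>Z\<close> is surjective for large \<open>n\<close>. Likewise \<open>B Q + T\<^sub>n P\<close> is injective. The two differ by
a compact operator and so have the same index, which must be zero. Hence the index of the \<open>S\<close>-half
of \<open>T\<^sub>n\<close> and the index of the other half of \<open>B\<close> add up to zero as well (\<open>index_glued\<close>), and comparison
with \<open>B\<close> alone gives the first two claims. The last one is \<open>fredholm_half\<close> for \<open>A\<close> itself.

The estimates near the cut rest on one property of band-dominated operators: the commutator with
multiplication by a slowly varying function is small in norm (\<open>slow\<close>). Finite-rank operators have
this property because \<open>p > 1\<close>, it is uniform along shifts, and it is inherited by limit operators,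
regularizers and inverses, about whose matrices little is known.

The Fredholm theory behind this has an algebraic and a topological part. The index calculus is
purely algebraic. Compact operators appear as norm limits of finite-rank operators; this is what the
symmetric approximation property provides, and it reduces the invariance of the index under compact
perturbations to linear algebra and the Neumann series. The boundedness of regularizers comes from
the closed graph theorem.\<close>

section \<open>Codimension and index of linear maps\<close>

interpretation cvp: vector_space_pair
  "scaleC :: complex \<Rightarrow> 'v::complex_vector \<Rightarrow> 'v" "scaleC :: complex \<Rightarrow> 'w::complex_vector \<Rightarrow> 'w"
  by standard

abbreviation csubspace :: "'v::complex_vector set \<Rightarrow> bool" where
  "csubspace \<equiv> complex_vector.subspace"

abbreviation cspan :: "'v::complex_vector set \<Rightarrow> 'v set" where
  "cspan \<equiv> complex_vector.span"

text \<open>All spaces and operators live on subsets: the exponent of the sequence space is a term, so that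
the space itself cannot be a type.\<close>

definition linear_on :: "'v::complex_vector set \<Rightarrow> ('v \<Rightarrow> 'w::complex_vector) \<Rightarrow> bool" where
  "linear_on V f \<longleftrightarrow> (\<forall>x\<in>V. \<forall>y\<in>V. f (x + y) = f x + f y) \<and> (\<forall>c. \<forall>x\<in>V. f (c *\<^sub>C x) = c *\<^sub>C f x)"

lemma csubspace_sum_scale:
  "csubspace V \<Longrightarrow> (\<And>b. b \<in> B \<Longrightarrow> g b \<in> V) \<Longrightarrow> (\<Sum>b\<in>B. u b *\<^sub>C g b) \<in> V"
  by (simp add: complex_vector.subspace_sum complex_vector.subspace_scale)

lemma linear_on_mono: "linear_on V f \<Longrightarrow> U \<subseteq> V \<Longrightarrow> linear_on U f"
  unfolding linear_on_def by blast

lemma linear_on_zero: "linear_on V f \<Longrightarrow> csubspace V \<Longrightarrow> f 0 = 0"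
  unfolding linear_on_def
  using complex_vector.subspace_0 complex_vector.scale_zero_left by metis

lemma linear_on_diff:
  assumes "linear_on V f" "csubspace V" "x \<in> V" "y \<in> V"
  shows "f (x - y) = f x - f y"
proof -
  have "f ((x - y) + y) = f (x - y) + f y"
    using assms complex_vector.subspace_diff unfolding linear_on_def by blast
  then show ?thesis by (simp add: algebra_simps)
qed

lemma linear_on_sum:
  assumes "linear_on V f" "csubspace V" "\<And>b. b \<in> B \<Longrightarrow> g b \<in> V"
  shows "f (\<Sum>b\<in>B. u b *\<^sub>C g b) = (\<Sum>b\<in>B. u b *\<^sub>C f (g b))"
  using assms(3)
proof (induction B rule: infinite_finite_induct)
  case (insert b B)
  then show ?case
    using assms(1,2) csubspace_sum_scale[OF assms(2), of B g u]
      complex_vector.subspace_scale[OF assms(2)]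
    unfolding linear_on_def by simp
qed (use assms linear_on_zero in auto)

lemma csubspace_image:
  assumes "linear_on V f" "csubspace V" "csubspace U" "U \<subseteq> V"
  shows "csubspace (f ` U)"
proof (rule complex_vector.subspaceI)
  show "0 \<in> f ` U"
    using linear_on_zero[OF assms(1,2)] complex_vector.subspace_0[OF assms(3)] by (metis imageI)
  fix x y assume "x \<in> f ` U" "y \<in> f ` U"
  then obtain a b where "a \<in> U" "x = f a" "b \<in> U" "y = f b" by auto
  then have "x + y = f (a + b)" "a + b \<in> U"
    using assms unfolding linear_on_def by (auto simp: complex_vector.subspace_add subset_iff)
  then show "x + y \<in> f ` U" by blast
next
  fix c x assume "x \<in> f ` U"
  then obtain a where "a \<in> U" "x = f a" by auto
  then have "c *\<^sub>C x = f (c *\<^sub>C a)" "c *\<^sub>C a \<in> U"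
    using assms unfolding linear_on_def by (auto simp: complex_vector.subspace_scale subset_iff)
  then show "c *\<^sub>C x \<in> f ` U" by blast
qed

lemma csubspace_kernel:
  assumes "linear_on V f" "csubspace V"
  shows "csubspace {x \<in> V. f x = 0}"
  using assms linear_on_zero[OF assms] unfolding linear_on_def complex_vector.subspace_def by auto

lemma linear_on_UNIV:
  fixes f :: "'v::complex_vector \<Rightarrow> 'w::complex_vector"
  shows "Vector_Spaces.linear scaleC scaleC f \<longleftrightarrow> linear_on UNIV f"
proof -
  have "vector_space (scaleC :: complex \<Rightarrow> 'v \<Rightarrow> 'v)" "vector_space (scaleC :: complex \<Rightarrow> 'w \<Rightarrow> 'w)"
    by (rule complex_vector.vector_space_axioms)+
  then show ?thesis unfolding linear_on_def Vector_Spaces.linear_iff by blast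
qed

text \<open>Extend a basis of \<open>W\<close> to a basis of the whole space and let \<open>\<pi>\<close> kill the former and fix the
added vectors. Such a map plays the role of the quotient map modulo \<open>W\<close>, so that statements on
quotients become statements on spans.\<close>

lemma exists_linear_map_with_kernel:
  fixes W :: "'v::complex_vector set"
  assumes W: "csubspace W"
  shows "\<exists>\<pi>::'v \<Rightarrow> 'v. linear_on UNIV \<pi> \<and> (\<forall>x. \<pi> x = 0 \<longleftrightarrow> x \<in> W)"
proof -
  obtain C where C: "C \<subseteq> W" "complex_vector.independent C" "W \<subseteq> cspan C"
    by (rule complex_vector.basis_exists[of W])
  obtain D where D: "C \<subseteq> D" "complex_vector.independent D" "UNIV \<subseteq> cspan D"
    by (rule complex_vector.maximal_independent_subset_extend[OF subset_UNIV C(2)])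
  obtain \<pi> :: "'v \<Rightarrow> 'v" where \<pi>: "Vector_Spaces.linear scaleC scaleC \<pi>"
    "\<And>b. b \<in> D \<Longrightarrow> \<pi> b = (if b \<in> C then 0 else b)"
    using cvp.linear_independent_extend[OF D(2), of "\<lambda>b. if b \<in> C then 0 else b"] by blast
  then have lin: "linear_on UNIV \<pi>" by (simp add: linear_on_UNIV)
  have spanC: "cspan C = W"
    using C W by (simp add: complex_vector.span_minimal subset_antisym)
  have "\<pi> x = 0" if "x \<in> W" for x
  proof -
    have "\<And>a. a \<in> C \<Longrightarrow> \<pi> a = 0" using \<pi>(2) D(1) by auto
    then show ?thesis
      using cvp.linear_eq_0_on_span[OF \<pi>(1)] that spanC by blast
  qed
  moreover have "x - \<pi> x \<in> W" for x
  proof -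
    have "x \<in> cspan D" using D(3) by blast
    then show ?thesis
    proof (induction rule: complex_vector.span_induct)
      case base
      show ?case
      proof (rule complex_vector.subspaceI)
        show "0 \<in> {x. x - \<pi> x \<in> W}"
          using linear_on_zero[OF lin] complex_vector.subspace_0[OF W] by simp
      next
        fix x y assume "x \<in> {x. x - \<pi> x \<in> W}" "y \<in> {x. x - \<pi> x \<in> W}"
        then have "(x - \<pi> x) + (y - \<pi> y) \<in> W" using complex_vector.subspace_add[OF W] by simp
        moreover have "\<pi> (x + y) = \<pi> x + \<pi> y" using lin by (simp add: linear_on_def)
        ultimately show "x + y \<in> {x. x - \<pi> x \<in> W}" by (simp add: algebra_simps)
      next
        fix c x assume "x \<in> {x. x - \<pi> x \<in> W}"
        then have "c *\<^sub>C (x - \<pi> x) \<in> W" using complex_vector.subspace_scale[OF W] by simp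
        moreover have "\<pi> (c *\<^sub>C x) = c *\<^sub>C \<pi> x" using lin by (simp add: linear_on_def)
        ultimately show "c *\<^sub>C x \<in> {x. x - \<pi> x \<in> W}"
          by (simp add: complex_vector.scale_right_diff_distrib)
      qed
    next
      case (step x)
      then show ?case using \<pi>(2)[OF step] C(1) complex_vector.subspace_0[OF W] by (cases "x \<in> C") auto
    qed
  qed
  ultimately have "\<pi> x = 0 \<longleftrightarrow> x \<in> W" for x
    by (cases "x \<in> W") (auto, metis diff_zero)
  then show ?thesis using lin by blast
qed

text \<open>Finite dimension of \<open>V / W\<close>, also when \<open>W\<close> is not contained in \<open>V\<close>; the spanning set need not lie
in \<open>V\<close>, which makes monotonicity in both arguments immediate.\<close>

definition qfin :: "'v::complex_vector set \<Rightarrow> 'v set \<Rightarrow> bool" where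
  "qfin V W \<longleftrightarrow> (\<exists>S. finite S \<and> V \<subseteq> cspan (S \<union> W))"

lemma qfin_mono: "qfin V W \<Longrightarrow> V' \<subseteq> V \<Longrightarrow> W \<subseteq> W' \<Longrightarrow> qfin V' W'"
  unfolding qfin_def
  by (meson complex_vector.span_mono subset_trans Un_mono subset_refl)

lemma finite_dimensional_iff_qfin: "finite_dimensional V \<longleftrightarrow> qfin V {0}"
  unfolding finite_dimensional_def qfin_def by (simp add: complex_vector.span_insert_0)

lemma quotient_basis_iff_image:
  fixes W :: "'v::complex_vector set"
  assumes lin: "linear_on UNIV \<pi>" and ker: "\<And>x. \<pi> x = 0 \<longleftrightarrow> x \<in> W"
  shows "quotient_basis V W B \<longleftrightarrow> finite B \<and> B \<subseteq> V \<and> inj_on \<pi> B \<and>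
    complex_vector.independent (\<pi> ` B) \<and> \<pi> ` V \<subseteq> cspan (\<pi> ` B)"
proof -
  have sm: "\<pi> (\<Sum>b\<in>B. u b *\<^sub>C b) = (\<Sum>b\<in>B. u b *\<^sub>C \<pi> b)" for u
    using linear_on_sum[OF lin, of B "\<lambda>b. b"] by simp
  have df: "\<pi> (x - y) = \<pi> x - \<pi> y" for x y using linear_on_diff[OF lin] by simp
  have mem: "(\<Sum>b\<in>B. u b *\<^sub>C b) \<in> W \<longleftrightarrow> (\<Sum>b\<in>B. u b *\<^sub>C \<pi> b) = 0" for u
    by (simp add: ker[symmetric] sm)
  have mem2: "x - (\<Sum>b\<in>B. u b *\<^sub>C b) \<in> W \<longleftrightarrow> \<pi> x = (\<Sum>b\<in>B. u b *\<^sub>C \<pi> b)" for u x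
    by (simp add: ker[symmetric] sm df)
  have re: "(\<Sum>b\<in>B. u (\<pi> b) *\<^sub>C \<pi> b) = (\<Sum>c\<in>\<pi> ` B. u c *\<^sub>C c)" if "inj_on \<pi> B" for u
    using that by (simp add: sum.reindex)
  have re2: "\<exists>v. \<forall>b\<in>B. u b = v (\<pi> b)" if "inj_on \<pi> B" for u :: "'v \<Rightarrow> complex"
    using that by (intro exI[of _ "\<lambda>c. u (inv_into B \<pi> c)"]) simp
  have inj: "inj_on \<pi> B" if "finite B" and "\<And>u. (\<Sum>b\<in>B. u b *\<^sub>C b) \<in> W \<Longrightarrow> \<forall>b\<in>B. u b = 0"
  proof (rule inj_onI, rule ccontr)
    fix a b assume ab: "a \<in> B" "b \<in> B" "\<pi> a = \<pi> b" "a \<noteq> b"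
    let ?u = "\<lambda>c. (if c = a then 1 else 0) - (if c = b then 1 else 0 :: complex)"
    have "(\<Sum>c\<in>B. ?u c *\<^sub>C c) = a - b"
      using ab that(1)
      by (simp add: complex_vector.scale_left_diff_distrib sum_subtractf if_distrib[of "\<lambda>z. z *\<^sub>C _"]
          scaleC_one cong: if_cong)
    then have "(\<Sum>c\<in>B. ?u c *\<^sub>C c) \<in> W" using df[of a b] ab(3) by (simp add: ker[symmetric])
    from that(2)[OF this] have "?u a = 0" using ab(1) by blast
    then show False using ab by simp
  qed
  show ?thesis
  proof (cases "finite B \<and> B \<subseteq> V \<and> inj_on \<pi> B")
    case True
    have "complex_vector.independent (\<pi> ` B) \<longleftrightarrow>
       (\<forall>u. (\<Sum>c\<in>\<pi> ` B. u c *\<^sub>C c) = 0 \<longrightarrow> (\<forall>c\<in>\<pi> ` B. u c = 0))"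
      unfolding complex_vector.dependent_finite[OF finite_imageI[OF conjunct1[OF True]]] by (simp, meson)
    also have "\<dots> \<longleftrightarrow> (\<forall>u. (\<Sum>b\<in>B. u b *\<^sub>C b) \<in> W \<longrightarrow> (\<forall>b\<in>B. u b = 0))"
    proof (intro iffI allI impI ballI)
      fix u b assume L: "\<forall>u. (\<Sum>c\<in>\<pi> ` B. u c *\<^sub>C c) = 0 \<longrightarrow> (\<forall>c\<in>\<pi> ` B. u c = 0)"
        and u: "(\<Sum>b\<in>B. u b *\<^sub>C b) \<in> W" and b: "b \<in> B"
      obtain v where v: "\<forall>b\<in>B. u b = v (\<pi> b)" using re2 True by blast
      have "(\<Sum>c\<in>\<pi> ` B. v c *\<^sub>C c) = (\<Sum>b\<in>B. u b *\<^sub>C \<pi> b)"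
        using True v by (simp add: re[symmetric])
      then have "(\<Sum>c\<in>\<pi> ` B. v c *\<^sub>C c) = 0" using u unfolding mem by simp
      from L[rule_format, OF this] have "v (\<pi> b) = 0" using b by blast
      then show "u b = 0" using v b by simp
    next
      fix u c assume R: "\<forall>u. (\<Sum>b\<in>B. u b *\<^sub>C b) \<in> W \<longrightarrow> (\<forall>b\<in>B. u b = 0)"
        and u: "(\<Sum>c\<in>\<pi> ` B. u c *\<^sub>C c) = 0" and c: "c \<in> \<pi> ` B"
      have "(\<Sum>b\<in>B. u (\<pi> b) *\<^sub>C b) \<in> W" unfolding mem using u re[of u] True by argo
      from R[rule_format, OF this] have "\<forall>b\<in>B. u (\<pi> b) = 0" by blast
      then show "u c = 0" using c by auto
    qed
    finally have "complex_vector.independent (\<pi> ` B) \<longleftrightarrow>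
       (\<forall>u. (\<Sum>b\<in>B. u b *\<^sub>C b) \<in> W \<longrightarrow> (\<forall>b\<in>B. u b = 0))" .
    moreover have "\<pi> ` V \<subseteq> cspan (\<pi> ` B) \<longleftrightarrow> (\<forall>x\<in>V. \<exists>u. x - (\<Sum>b\<in>B. u b *\<^sub>C b) \<in> W)"
    proof
      assume L: "\<pi> ` V \<subseteq> cspan (\<pi> ` B)"
      show "\<forall>x\<in>V. \<exists>u. x - (\<Sum>b\<in>B. u b *\<^sub>C b) \<in> W"
      proof
        fix x assume "x \<in> V"
        then have "\<pi> x \<in> cspan (\<pi> ` B)" using L by auto
        then obtain u where "\<pi> x = (\<Sum>c\<in>\<pi> ` B. u c *\<^sub>C c)"
          unfolding complex_vector.span_finite[OF finite_imageI[OF conjunct1[OF True]]] by auto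
        then have "\<pi> x = (\<Sum>b\<in>B. u (\<pi> b) *\<^sub>C \<pi> b)" using re[of u] True by argo
        then show "\<exists>u. x - (\<Sum>b\<in>B. u b *\<^sub>C b) \<in> W"
          unfolding mem2 by (rule exI[of _ "\<lambda>b. u (\<pi> b)"])
      qed
    next
      assume R: "\<forall>x\<in>V. \<exists>u. x - (\<Sum>b\<in>B. u b *\<^sub>C b) \<in> W"
      show "\<pi> ` V \<subseteq> cspan (\<pi> ` B)"
      proof
        fix y assume "y \<in> \<pi> ` V"
        then obtain u where "y = (\<Sum>b\<in>B. u b *\<^sub>C \<pi> b)" using R unfolding mem2 by auto
        then show "y \<in> cspan (\<pi> ` B)"
          by (auto intro!: complex_vector.span_base complex_vector.span_scale complex_vector.span_sum)
      qed
    qed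
    ultimately show ?thesis using True by (simp add: quotient_basis_def)
  next
    case False
    have "\<not> quotient_basis V W B"
    proof
      assume B: "quotient_basis V W B"
      have "inj_on \<pi> B" by (rule inj) (use B in \<open>simp_all add: quotient_basis_def\<close>)
      then show False using False B by (simp add: quotient_basis_def)
    qed
    then show ?thesis using False by blast
  qed
qed

lemma quotient_basis_exists:
  assumes V: "csubspace V" and W: "csubspace W" and q: "qfin V W"
  shows "\<exists>B. quotient_basis V W B"
proof -
  obtain \<pi> :: "'a \<Rightarrow> 'a" where lin: "linear_on UNIV \<pi>" and ker: "\<And>x. \<pi> x = 0 \<longleftrightarrow> x \<in> W"
    using exists_linear_map_with_kernel[OF W] by blast
  obtain S where S: "finite S" "V \<subseteq> cspan (S \<union> W)" using q unfolding qfin_def by blast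
  have "\<pi> ` V \<subseteq> cspan (\<pi> ` (S \<union> W))"
    using cvp.linear_span_image[OF linear_on_UNIV[THEN iffD2, OF lin], of "S \<union> W"] S(2) by (metis image_mono)
  also have "\<dots> \<subseteq> cspan (insert 0 (\<pi> ` S))"
    by (rule complex_vector.span_mono) (use ker in auto)
  finally have sp: "\<pi> ` V \<subseteq> cspan (\<pi> ` S)" by (simp add: complex_vector.span_insert_0)
  obtain C where C: "C \<subseteq> \<pi> ` V" "complex_vector.independent C" "\<pi> ` V \<subseteq> cspan C"
    by (rule complex_vector.basis_exists[of "\<pi> ` V"])
  have fC: "finite C"
    using complex_vector.independent_span_bound[OF finite_imageI[OF S(1)] C(2)] C(1) sp by blast
  let ?B = "inv_into V \<pi> ` C"
  have im: "\<pi> ` ?B = C"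
    using C(1) by (force simp: image_image f_inv_into_f subset_iff)
  have inj: "inj_on \<pi> ?B"
    by (rule inj_onI) (use C(1) in \<open>auto simp: f_inv_into_f subset_iff\<close>)
  have "?B \<subseteq> V" using C(1) by (auto simp: inv_into_into subset_iff)
  then have "quotient_basis V W ?B"
    unfolding quotient_basis_iff_image[OF lin ker] using im inj C fC by auto
  then show ?thesis by blast
qed

text \<open>The value of \<open>quotient_dim\<close> does not depend on the basis picked by the choice operator: under a
map with kernel \<open>W\<close> every basis of the quotient becomes a basis of the image of \<open>V\<close>.\<close>

lemma quotient_dim_eq:
  assumes W: "csubspace W" and B: "quotient_basis V W B"
  shows "quotient_dim V W = card B"
proof -
  obtain \<pi> :: "'a \<Rightarrow> 'a" where lin: "linear_on UNIV \<pi>" and ker: "\<And>x. \<pi> x = 0 \<longleftrightarrow> x \<in> W"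
    using exists_linear_map_with_kernel[OF W] by blast
  have "card B = complex_vector.dim (\<pi> ` V)" if "quotient_basis V W B" for B
    using that complex_vector.basis_card_eq_dim[of "\<pi> ` B" "\<pi> ` V"]
    unfolding quotient_basis_iff_image[OF lin ker] by (auto simp: card_image)
  then show ?thesis unfolding quotient_dim_def using B by (metis someI)
qed

lemma quotient_basis_qfin: 
  assumes "quotient_basis V W B" shows "qfin V W"
  unfolding qfin_def
proof (intro exI conjI subsetI)
  show "finite B" using assms quotient_basis_def by blast
  fix x assume "x \<in> V"
  then obtain u where u: "x - (\<Sum>b\<in>B. u b *\<^sub>C b) \<in> W"
    using assms unfolding quotient_basis_def by blast
  have "(x - (\<Sum>b\<in>B. u b *\<^sub>C b)) + (\<Sum>b\<in>B. u b *\<^sub>C b) \<in> cspan (B \<union> W)"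
    by (intro complex_vector.span_add complex_vector.span_sum complex_vector.span_scale
        complex_vector.span_base) (use u in auto)
  then show "x \<in> cspan (B \<union> W)" by simp
qed

lemma quotient_dim_add:
  assumes sub: "csubspace V" "csubspace U" "csubspace W" "W \<subseteq> U" "U \<subseteq> V"
    and q: "qfin V U" "qfin U W"
  shows "qfin V W" and "quotient_dim V W = quotient_dim V U + quotient_dim U W"
proof -
  obtain B1 B2 where B1: "quotient_basis V U B1" and B2: "quotient_basis U W B2"
    using quotient_basis_exists sub q by meson
  note d1 = B1[unfolded quotient_basis_def] and d2 = B2[unfolded quotient_basis_def]
  have ind1: "\<forall>b\<in>B1. u b = 0" if "(\<Sum>b\<in>B1. u b *\<^sub>C b) \<in> U" for u using d1 that by simp
  have ind2: "\<forall>b\<in>B2. u b = 0" if "(\<Sum>b\<in>B2. u b *\<^sub>C b) \<in> W" for u using d2 that by simp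
  have disj: "B1 \<inter> B2 = {}"
  proof (rule ccontr)
    assume "B1 \<inter> B2 \<noteq> {}"
    then obtain b where b: "b \<in> B1" "b \<in> U" using d2 by auto
    let ?u = "\<lambda>c. if c = b then 1 else 0 :: complex"
    have "(\<Sum>c\<in>B1. ?u c *\<^sub>C c) = b"
      using d1 b(1) by (simp add: if_distrib[of "\<lambda>z. z *\<^sub>C _"] scaleC_one cong: if_cong)
    then have "?u b = 0" using ind1[of ?u] b by auto
    then show False by simp
  qed
  have split: "(\<Sum>b\<in>B1 \<union> B2. u b *\<^sub>C b) = (\<Sum>b\<in>B1. u b *\<^sub>C b) + (\<Sum>b\<in>B2. u b *\<^sub>C b)" for u
    using disj d1 d2 by (simp add: sum.union_disjoint)
  have inU: "(\<Sum>b\<in>B2. u b *\<^sub>C b) \<in> U" for u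
    using d2 sub by (intro csubspace_sum_scale) auto
  have "quotient_basis V W (B1 \<union> B2)"
    unfolding quotient_basis_def
  proof (intro conjI allI impI ballI)
    show "finite (B1 \<union> B2)" "B1 \<union> B2 \<subseteq> V" using d1 d2 sub by auto
  next
    fix u b assume W: "(\<Sum>b\<in>B1 \<union> B2. u b *\<^sub>C b) \<in> W" and b: "b \<in> B1 \<union> B2"
    then have "(\<Sum>b\<in>B1. u b *\<^sub>C b) + (\<Sum>b\<in>B2. u b *\<^sub>C b) \<in> U" using split sub by auto
    then have "(\<Sum>b\<in>B1. u b *\<^sub>C b) \<in> U"
      using complex_vector.subspace_diff[OF sub(2) _ inU, of _ u] by fastforce
    then have u1: "\<forall>b\<in>B1. u b = 0" by (rule ind1)
    then have "(\<Sum>b\<in>B2. u b *\<^sub>C b) \<in> W" using W split by simp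
    then have "\<forall>b\<in>B2. u b = 0" by (rule ind2)
    then show "u b = 0" using u1 b by auto
  next
    fix x assume "x \<in> V"
    then obtain u where u: "x - (\<Sum>b\<in>B1. u b *\<^sub>C b) \<in> U" using d1 by blast
    then obtain v where v: "x - (\<Sum>b\<in>B1. u b *\<^sub>C b) - (\<Sum>b\<in>B2. v b *\<^sub>C b) \<in> W" using d2 by blast
    let ?w = "\<lambda>b. if b \<in> B1 then u b else v b"
    have "(\<Sum>b\<in>B1. ?w b *\<^sub>C b) = (\<Sum>b\<in>B1. u b *\<^sub>C b)" by simp
    moreover have "(\<Sum>b\<in>B2. ?w b *\<^sub>C b) = (\<Sum>b\<in>B2. v b *\<^sub>C b)"
      using disj by (intro sum.cong) auto
    ultimately show "\<exists>u. x - (\<Sum>b\<in>B1 \<union> B2. u b *\<^sub>C b) \<in> W"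
      using v split[of ?w] by (intro exI[of _ ?w]) (simp add: algebra_simps)
  qed
  then show "qfin V W" "quotient_dim V W = quotient_dim V U + quotient_dim U W"
    using quotient_dim_eq[OF sub(3)] quotient_dim_eq[OF sub(2) B1] quotient_dim_eq[OF sub(3) B2]
      card_Un_disjoint[OF conjunct1[OF d1] conjunct1[OF d2] disj] quotient_basis_qfin by metis+
qed

lemma quotient_basis_image:
  assumes lin: "linear_on V f" and V: "csubspace V" and ker: "{x \<in> V. f x = 0} \<subseteq> W"
    and W: "csubspace W" "W \<subseteq> V" and B: "quotient_basis V W B"
  shows "quotient_basis (f ` V) (f ` W) (f ` B)" and "inj_on f B"
proof -
  note d = B[unfolded quotient_basis_def]
  have indB: "\<forall>b\<in>B. u b = 0" if "(\<Sum>b\<in>B. u b *\<^sub>C b) \<in> W" for u using d that by simp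
  have inW: "x \<in> W" if "x \<in> V" "f x \<in> f ` W" for x
  proof -
    obtain w where w: "w \<in> W" "f x = f w" using \<open>f x \<in> f ` W\<close> by auto
    have "w \<in> V" using w W by blast
    then have "f (x - w) = 0" "x - w \<in> V"
      using linear_on_diff[OF lin V that(1)] complex_vector.subspace_diff[OF V that(1)] w(2) by auto
    then have "x - w \<in> W" using ker by blast
    then show ?thesis using complex_vector.subspace_add[OF W(1) _ w(1)] by fastforce
  qed
  have inV: "(\<Sum>b\<in>B. u b *\<^sub>C b) \<in> V" for u using d by (intro csubspace_sum_scale[OF V]) auto
  have fsum: "f (\<Sum>b\<in>B. u b *\<^sub>C b) = (\<Sum>b\<in>B. u b *\<^sub>C f b)" for u
    using d by (intro linear_on_sum[OF lin V]) auto
  show inj: "inj_on f B"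
  proof (rule inj_onI, rule ccontr)
    fix a b assume ab: "a \<in> B" "b \<in> B" "f a = f b" "a \<noteq> b"
    let ?u = "\<lambda>c. (if c = a then 1 else 0) - (if c = b then 1 else 0 :: complex)"
    have "(\<Sum>c\<in>B. ?u c *\<^sub>C c) = a - b"
      using ab d
      by (simp add: complex_vector.scale_left_diff_distrib sum_subtractf if_distrib[of "\<lambda>z. z *\<^sub>C _"]
          scaleC_one cong: if_cong)
    moreover have "a - b \<in> W"
    proof -
      have "a \<in> V" "b \<in> V" using ab d by auto
      then have "a - b \<in> V" "f (a - b) = 0"
        using ab(3) linear_on_diff[OF lin V, of a b] complex_vector.subspace_diff[OF V] by auto
      then show ?thesis using ker by blast
    qed
    ultimately have "?u a = 0" using indB[of ?u] ab(1) by auto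
    then show False using ab by simp
  qed
  have re: "(\<Sum>c\<in>f ` B. u c *\<^sub>C c) = (\<Sum>b\<in>B. u (f b) *\<^sub>C f b)" for u
    using inj by (simp add: sum.reindex)
  show "quotient_basis (f ` V) (f ` W) (f ` B)"
    unfolding quotient_basis_def
  proof (intro conjI allI impI ballI)
    show "finite (f ` B)" "f ` B \<subseteq> f ` V" using d by auto
  next
    fix u c assume "(\<Sum>c\<in>f ` B. u c *\<^sub>C c) \<in> f ` W" and c: "c \<in> f ` B"
    then have "(\<Sum>b\<in>B. u (f b) *\<^sub>C b) \<in> W"
      using inW[OF inV, of "\<lambda>b. u (f b)"] by (simp only: re fsum)
    then have "\<forall>b\<in>B. u (f b) = 0" by (rule indB)
    then show "u c = 0" using c by auto
  next
    fix y assume "y \<in> f ` V"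
    then obtain x where x: "x \<in> V" "y = f x" by auto
    then obtain u where u: "x - (\<Sum>b\<in>B. u b *\<^sub>C b) \<in> W" using d by blast
    let ?v = "\<lambda>c. u (inv_into B f c)"
    have "(\<Sum>c\<in>f ` B. ?v c *\<^sub>C c) = (\<Sum>b\<in>B. u b *\<^sub>C f b)"
      using inj by (simp add: re)
    then have "y - (\<Sum>c\<in>f ` B. ?v c *\<^sub>C c) = f (x - (\<Sum>b\<in>B. u b *\<^sub>C b))"
      using x fsum[of u] linear_on_diff[OF lin V x(1) inV] by simp
    then have "y - (\<Sum>c\<in>f ` B. ?v c *\<^sub>C c) \<in> f ` W" using imageI[OF u, of f] by (simp only:)
    then show "\<exists>u. y - (\<Sum>c\<in>f ` B. u c *\<^sub>C c) \<in> f ` W" by (rule exI[of _ ?v])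
  qed
qed

text \<open>If \<open>W\<close> contains the kernel of \<open>f\<close>, then \<open>f\<close> induces an isomorphism of \<open>V / W\<close> onto the quotient
of the images.\<close>

lemma qfin_image:
  assumes lin: "linear_on V f" and V: "csubspace V" and ker: "{x \<in> V. f x = 0} \<subseteq> W"
    and W: "csubspace W" "W \<subseteq> V"
  shows "qfin (f ` V) (f ` W) \<longleftrightarrow> qfin V W"
proof
  assume "qfin V W"
  then show "qfin (f ` V) (f ` W)"
    using quotient_basis_exists[OF V W(1)] quotient_basis_image(1)[OF assms] quotient_basis_qfin by blast
next
  assume "qfin (f ` V) (f ` W)"
  then obtain B where B: "quotient_basis (f ` V) (f ` W) B"
    using quotient_basis_exists csubspace_image[OF lin V] V W by blast
  note d = B[unfolded quotient_basis_def]
  define g where "g = inv_into V f"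
  have g: "g b \<in> V" "f (g b) = b" if "b \<in> B" for b
    using that d by (auto simp: g_def inv_into_into f_inv_into_f subset_iff)
  show "qfin V W"
    unfolding qfin_def
  proof (intro exI conjI subsetI)
    show "finite (g ` B)" using d by auto
    fix x assume x: "x \<in> V"
    then obtain u where "f x - (\<Sum>b\<in>B. u b *\<^sub>C b) \<in> f ` W" using d by blast
    then obtain w where w: "w \<in> W" "f x - (\<Sum>b\<in>B. u b *\<^sub>C b) = f w" by auto
    let ?s = "\<Sum>b\<in>B. u b *\<^sub>C g b"
    have s: "?s \<in> V" "f ?s = (\<Sum>b\<in>B. u b *\<^sub>C b)"
      using csubspace_sum_scale[OF V, of B g u] linear_on_sum[OF lin V, of B g u] g by auto
    have wV: "w \<in> V" and xs: "x - ?s \<in> V"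
      using w W x s complex_vector.subspace_diff[OF V] by auto
    have "f (x - ?s - w) = 0"
      using linear_on_diff[OF lin V x s(1)] linear_on_diff[OF lin V xs wV] s(2) w(2) by simp
    then have "x - ?s - w \<in> W"
      using ker complex_vector.subspace_diff[OF V xs wV] by blast
    then have "x - ?s \<in> W" using complex_vector.subspace_add[OF W(1) _ w(1)] by fastforce
    then have "(x - ?s) + ?s \<in> cspan (g ` B \<union> W)"
      by (intro complex_vector.span_add complex_vector.span_sum complex_vector.span_scale
        complex_vector.span_base) auto
    then show "x \<in> cspan (g ` B \<union> W)" by simp
  qed
qed

lemma quotient_dim_image:
  assumes lin: "linear_on V f" and V: "csubspace V" and ker: "{x \<in> V. f x = 0} \<subseteq> W"
    and W: "csubspace W" "W \<subseteq> V" and q: "qfin V W"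
  shows "quotient_dim (f ` V) (f ` W) = quotient_dim V W"
proof -
  obtain B where B: "quotient_basis V W B" using quotient_basis_exists[OF V W(1) q] by blast
  have "csubspace (f ` W)" using csubspace_image[OF lin V] W by blast
  then show ?thesis
    using quotient_dim_eq quotient_basis_image[OF lin V ker W B] B W(1) by (metis card_image)
qed

definition subspace_sum :: "'v::complex_vector set \<Rightarrow> 'v set \<Rightarrow> 'v set" where
  "subspace_sum U W = {x + y | x y. x \<in> U \<and> y \<in> W}"

text \<open>The second isomorphism theorem: a basis of \<open>U\<close> modulo \<open>U \<inter> W\<close> is also one of \<open>U + W\<close> modulo \<open>W\<close>.\<close>

lemma quotient_dim_second_iso:
  assumes U: "csubspace U" and W: "csubspace W" and q: "qfin U (U \<inter> W)"
  shows "quotient_dim (subspace_sum U W) W = quotient_dim U (U \<inter> W)"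
proof -
  have UW: "csubspace (U \<inter> W)" using U W by (simp add: complex_vector.subspace_inter)
  obtain B where B: "quotient_basis U (U \<inter> W) B" using quotient_basis_exists[OF U UW q] by blast
  note d = B[unfolded quotient_basis_def]
  have inU: "(\<Sum>b\<in>B. u b *\<^sub>C b) \<in> U" for u using d by (intro csubspace_sum_scale[OF U]) auto
  have "quotient_basis (subspace_sum U W) W B"
    unfolding quotient_basis_def
  proof (intro conjI allI impI ballI)
    show "finite B" using d by blast
    have "b + 0 \<in> subspace_sum U W" if "b \<in> B" for b
      unfolding subspace_sum_def using that d complex_vector.subspace_0[OF W] by blast
    then show "B \<subseteq> subspace_sum U W" by auto
  next
    fix u b assume "(\<Sum>b\<in>B. u b *\<^sub>C b) \<in> W" "b \<in> B"
    then show "u b = 0" using inU d by blast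
  next
    fix x assume "x \<in> subspace_sum U W"
    then obtain y z where x: "x = y + z" "y \<in> U" "z \<in> W" unfolding subspace_sum_def by blast
    then obtain u where "y - (\<Sum>b\<in>B. u b *\<^sub>C b) \<in> W" using d by blast
    then have "y - (\<Sum>b\<in>B. u b *\<^sub>C b) + z \<in> W" using x complex_vector.subspace_add[OF W] by blast
    then show "\<exists>u. x - (\<Sum>b\<in>B. u b *\<^sub>C b) \<in> W" using x by (metis add_diff_eq add.commute)
  qed
  then show ?thesis using quotient_dim_eq B W UW by metis
qed

lemma dim_eq_quotient_dim:
  assumes "csubspace V" "finite_dimensional V"
  shows "complex_vector.dim V = quotient_dim V {0}"
proof -
  obtain B where B: "quotient_basis V {0} B"
    using quotient_basis_exists[OF assms(1)] assms(2) complex_vector.subspace_single_0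
    unfolding finite_dimensional_iff_qfin by blast
  have "linear_on UNIV (\<lambda>x::'a. x)" by (simp add: linear_on_def)
  from quotient_basis_iff_image[OF this, of "{0}" V B] B
  have "card B = complex_vector.dim V"
    using complex_vector.basis_card_eq_dim[of B V] by auto
  then show ?thesis using quotient_dim_eq[OF _ B] complex_vector.subspace_single_0 by metis
qed


definition endo :: "'v::complex_vector set \<Rightarrow> ('v \<Rightarrow> 'v) \<Rightarrow> bool" where
  "endo V T \<longleftrightarrow> T ` V \<subseteq> V \<and> linear_on V T"

definition kern :: "'v::complex_vector set \<Rightarrow> ('v \<Rightarrow> 'v) \<Rightarrow> 'v set" where
  "kern V T = {x \<in> V. T x = 0}"

definition alg_fredholm :: "'v::complex_vector set \<Rightarrow> ('v \<Rightarrow> 'v) \<Rightarrow> bool" where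
  "alg_fredholm V T \<longleftrightarrow> endo V T \<and> qfin (kern V T) {0} \<and> qfin V (T ` V)"

definition index :: "'v::complex_vector set \<Rightarrow> ('v \<Rightarrow> 'v) \<Rightarrow> int" where
  "index V T = int (quotient_dim (kern V T) {0}) - int (quotient_dim V (T ` V))"

lemma endo_in: "endo V T \<Longrightarrow> x \<in> V \<Longrightarrow> T x \<in> V"
  unfolding endo_def by blast

lemma endo_add: "endo V T \<Longrightarrow> x \<in> V \<Longrightarrow> y \<in> V \<Longrightarrow> T (x + y) = T x + T y"
  unfolding endo_def linear_on_def by blast

lemma endo_scale: "endo V T \<Longrightarrow> x \<in> V \<Longrightarrow> T (c *\<^sub>C x) = c *\<^sub>C T x"
  unfolding endo_def linear_on_def by blast

lemma endoI:
  "(\<And>x. x \<in> V \<Longrightarrow> T x \<in> V) \<Longrightarrow> (\<And>x y. x \<in> V \<Longrightarrow> y \<in> V \<Longrightarrow> T (x + y) = T x + T y) \<Longrightarrow>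
   (\<And>c x. x \<in> V \<Longrightarrow> T (c *\<^sub>C x) = c *\<^sub>C T x) \<Longrightarrow> endo V T"
  unfolding endo_def linear_on_def by blast

lemma endo_comp: "endo V S \<Longrightarrow> endo V T \<Longrightarrow> endo V (S \<circ> T)"
  by (rule endoI) (simp_all add: endo_in endo_add endo_scale)

lemma endo_comp': "endo V S \<Longrightarrow> endo V T \<Longrightarrow> endo V (\<lambda>x. S (T x))"
  by (rule endoI) (simp_all add: endo_in endo_add endo_scale)

lemma endo_plus:
  assumes "csubspace V" "endo V S" "endo V T" shows "endo V (\<lambda>x. S x + T x)"
  by (rule endoI)
    (simp_all add: assms endo_in endo_add[OF assms(2)] endo_add[OF assms(3)] endo_scale[OF assms(2)]
      endo_scale[OF assms(3)] complex_vector.subspace_add scaleC_add_right)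

lemma endo_minus:
  assumes "csubspace V" "endo V S" "endo V T" shows "endo V (\<lambda>x. S x - T x)"
  by (rule endoI)
    (simp_all add: assms endo_in endo_add[OF assms(2)] endo_add[OF assms(3)] endo_scale[OF assms(2)]
      endo_scale[OF assms(3)] complex_vector.subspace_diff complex_vector.scale_right_diff_distrib)

lemma endo_ident: "endo V (\<lambda>x. x)" by (rule endoI) simp_all

lemma kern_subspace: "csubspace V \<Longrightarrow> endo V T \<Longrightarrow> csubspace (kern V T)"
  unfolding kern_def endo_def by (simp add: csubspace_kernel)

lemma range_subspace: "csubspace V \<Longrightarrow> endo V T \<Longrightarrow> csubspace (T ` V)"
  unfolding endo_def using csubspace_image by blast

lemma alg_fredholm_cong:
  assumes "csubspace V" "\<And>x. x \<in> V \<Longrightarrow> T x = T' x"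
  shows "alg_fredholm V T \<longleftrightarrow> alg_fredholm V T'" "index V T = index V T'"
proof -
  have 1: "kern V T = kern V T'" "T ` V = T' ` V" using assms by (auto simp: kern_def)
  have "endo V T \<longleftrightarrow> endo V T'"
    unfolding endo_def linear_on_def using assms
      complex_vector.subspace_add[OF assms(1)] complex_vector.subspace_scale[OF assms(1)]
    by (simp add: image_subset_iff)
  then show "alg_fredholm V T \<longleftrightarrow> alg_fredholm V T'" "index V T = index V T'"
    using 1 by (simp_all add: alg_fredholm_def index_def)
qed

lemma csubspace_subspace_sum:
  "csubspace U \<Longrightarrow> csubspace W \<Longrightarrow> csubspace (subspace_sum U W)"
  unfolding subspace_sum_def by (rule complex_vector.subspace_sums)

lemma subspace_sum_upper:
  assumes "csubspace U" "csubspace W" shows "U \<subseteq> subspace_sum U W" "W \<subseteq> subspace_sum U W"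
proof -
  have "x + 0 \<in> subspace_sum U W" if "x \<in> U" for x
    unfolding subspace_sum_def using that complex_vector.subspace_0[OF assms(2)] by blast
  then show "U \<subseteq> subspace_sum U W" by auto
  have "0 + x \<in> subspace_sum U W" if "x \<in> W" for x
    unfolding subspace_sum_def using that complex_vector.subspace_0[OF assms(1)] by blast
  then show "W \<subseteq> subspace_sum U W" by auto
qed

text \<open>With \<open>k = ker S \<inter> im T\<close> and \<open>M = ker S + im T\<close>, the kernel of \<open>S \<circ> T\<close> is an extension of \<open>k\<close> by
\<open>ker T\<close>, and its range has in the range of \<open>S\<close> the codimension that \<open>M\<close> has in \<open>V\<close>. Since \<open>M / im T\<close>
is isomorphic to \<open>ker S / k\<close>, all additional terms cancel in the index.\<close>

lemma alg_fredholm_comp: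
  assumes V: "csubspace V" and S: "alg_fredholm V S" and T: "alg_fredholm V T"
  shows "alg_fredholm V (S \<circ> T)" and "index V (S \<circ> T) = index V S + index V T"
proof -
  have eS: "endo V S" and eT: "endo V T" using S T by (auto simp: alg_fredholm_def)
  then have eST: "endo V (S \<circ> T)" by (rule endo_comp)
  let ?kS = "kern V S" and ?kT = "kern V T" and ?kST = "kern V (S \<circ> T)"
  let ?k = "?kS \<inter> T ` V" and ?M = "subspace_sum ?kS (T ` V)"
  have sub: "csubspace ?kS" "csubspace ?kT" "csubspace ?kST" "csubspace (T ` V)"
      "csubspace (S ` V)" "csubspace ((S \<circ> T) ` V)"
    using V eS eT eST kern_subspace range_subspace by blast+
  then have sub2: "csubspace ?k" "csubspace ?M"
    by (simp_all add: complex_vector.subspace_inter csubspace_subspace_sum)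
  have s0: "csubspace {0::'a}" by (rule complex_vector.subspace_single_0)
  have z: "0 \<in> V" "T 0 = 0" "S 0 = 0"
    using complex_vector.subspace_0[OF V] linear_on_zero V eS eT unfolding endo_def by blast+
  have inc: "?kT \<subseteq> ?kST" "?kST \<subseteq> V" "T ` V \<subseteq> V" "?kS \<subseteq> V"
    using z eT by (auto simp: kern_def endo_def)
  have MV: "?M \<subseteq> V"
    unfolding subspace_sum_def using inc complex_vector.subspace_add[OF V] by blast
  note up = subspace_sum_upper[OF sub(1) sub(4)]
  have imk: "T ` ?kST = ?k" using eT by (auto simp: kern_def endo_in)
  have imk0: "T ` ?kT = {0}" using z by (auto simp: kern_def)
  have fin: "qfin ?kS {0}" "qfin ?kT {0}" "qfin V (T ` V)" "qfin V (S ` V)"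
    using S T by (auto simp: alg_fredholm_def)
  have fink: "qfin ?k {0}" by (rule qfin_mono[OF fin(1)]) auto
  have linT: "linear_on ?kST T" and linS: "linear_on V S"
    using eT eS inc(2) linear_on_mono unfolding endo_def by blast+
  have kerT: "{x \<in> ?kST. T x = 0} \<subseteq> ?kT" using inc by (auto simp: kern_def)
  have q1: "qfin ?kST ?kT"
    using qfin_image[OF linT sub(3) kerT sub(2) inc(1)] imk imk0 fink by simp
  have d1: "quotient_dim ?k {0} = quotient_dim ?kST ?kT"
    using quotient_dim_image[OF linT sub(3) kerT sub(2) inc(1) q1] imk imk0 by simp
  have z0: "{0} \<subseteq> ?kT" "{0} \<subseteq> ?k" using z by (auto simp: kern_def)
  note a1 = quotient_dim_add[OF sub(3) sub(2) s0 z0(1) inc(1) q1 fin(2)]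
  have q2: "qfin V ?M" by (rule qfin_mono[OF fin(3) _ up(2)]) simp
  have q3: "qfin ?M (T ` V)" by (rule qfin_mono[OF fin(3) MV]) simp
  note a2 = quotient_dim_add[OF V sub2(2) sub(4) up(2) MV q2 q3]
  have q4: "qfin ?kS ?k" by (rule qfin_mono[OF fin(1)]) (use z0 in auto)
  have d2: "quotient_dim ?M (T ` V) = quotient_dim ?kS ?k"
    by (rule quotient_dim_second_iso[OF sub(1) sub(4) q4])
  have ksub: "?k \<subseteq> ?kS" by blast
  note a3 = quotient_dim_add[OF sub(1) sub2(1) s0 z0(2) ksub q4 fink]
  have imM: "S ` ?M = (S \<circ> T) ` V"
  proof
    show "S ` ?M \<subseteq> (S \<circ> T) ` V"
    proof
      fix y assume "y \<in> S ` ?M"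
      then obtain a b where ab: "a \<in> ?kS" "b \<in> V" "y = S (a + T b)"
        unfolding subspace_sum_def by blast
      then have "y = S (T b)" using endo_add[OF eS, of a "T b"] inc by (auto simp: kern_def)
      then show "y \<in> (S \<circ> T) ` V" using ab by auto
    qed
    show "(S \<circ> T) ` V \<subseteq> S ` ?M" using up by auto
  qed
  have kM: "{x \<in> V. S x = 0} \<subseteq> ?M" using up by (auto simp: kern_def)
  have q5: "qfin (S ` V) ((S \<circ> T) ` V)"
    using qfin_image[OF linS V kM sub2(2) MV] q2 imM by simp
  have d3: "quotient_dim (S ` V) ((S \<circ> T) ` V) = quotient_dim V ?M"
    using quotient_dim_image[OF linS V kM sub2(2) MV q2] imM by simp
  have i1: "(S \<circ> T) ` V \<subseteq> S ` V" using eT by (auto simp: endo_in)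
  have i2: "S ` V \<subseteq> V" using eS by (auto simp: endo_in)
  note a4 = quotient_dim_add[OF V sub(5) sub(6) i1 i2 fin(4) q5]
  show "alg_fredholm V (S \<circ> T)" using eST a1(1) a4(1) by (simp add: alg_fredholm_def)
  show "index V (S \<circ> T) = index V S + index V T"
    using a1(2) a2(2) a3(2) a4(2) d1 d2 d3 by (simp add: index_def)
qed

text \<open>The kernel of \<open>T\<close> is contained in that of \<open>R \<circ> T\<close>, its range contains that of \<open>T \<circ> S\<close>.\<close>

lemma alg_fredholm_factor:
  assumes V: "csubspace V" and e: "endo V R" "endo V T" "endo V S"
    and RT: "alg_fredholm V (R \<circ> T)" and TS: "alg_fredholm V (T \<circ> S)"
  shows "alg_fredholm V T"
proof -
  have "R 0 = 0" using linear_on_zero V e(1) unfolding endo_def by blast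
  then have "kern V T \<subseteq> kern V (R \<circ> T)" by (auto simp: kern_def)
  moreover have "(T \<circ> S) ` V \<subseteq> T ` V" using e by (auto simp: endo_in)
  ultimately show ?thesis
    using e RT TS qfin_mono unfolding alg_fredholm_def by (meson subset_refl)
qed

lemma quotient_dim_self: "csubspace V \<Longrightarrow> quotient_dim V V = 0"
  using quotient_dim_eq[of V V "{}"] complex_vector.subspace_diff[of V]
  by (simp add: quotient_basis_def)

lemma qfin_self: "qfin V V"
  unfolding qfin_def using complex_vector.span_superset[of V] by (intro exI[of _ "{}"]) simp

lemma index_bij:
  assumes V: "csubspace V" and J: "endo V J" "inj_on J V" "J ` V = V"
  shows "alg_fredholm V J" "index V J = 0"
proof -
  have "J 0 = 0" using linear_on_zero V J(1) unfolding endo_def by blast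
  then have "kern V J = {0}"
    using J(2) complex_vector.subspace_0[OF V] by (auto simp: kern_def inj_on_def)
  then show "alg_fredholm V J" "index V J = 0"
    using J V by (simp_all add: alg_fredholm_def index_def qfin_self quotient_dim_self
        complex_vector.subspace_single_0)
qed

text \<open>Everything happens inside the finite-dimensional range \<open>U\<close> of \<open>F\<close>: it contains the kernel of
\<open>G = I - F\<close>, is mapped into itself by \<open>G\<close>, and spans the whole space together with the range of
\<open>G\<close>. On \<open>U\<close> the claim is the rank-nullity theorem.\<close>

lemma index_ident_minus_finite_rank:
  assumes V: "csubspace V" and F: "endo V F" "qfin (F ` V) {0}"
  shows "alg_fredholm V (\<lambda>x. x - F x)" "index V (\<lambda>x. x - F x) = 0"
proof -
  define G where "G = (\<lambda>x. x - F x)"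
  have eG: "endo V G" unfolding G_def by (rule endo_minus[OF V endo_ident F(1)])
  let ?U = "F ` V" and ?k = "kern V G"
  have sub: "csubspace ?U" "csubspace ?k" "csubspace (G ` V)"
    using V F eG kern_subspace range_subspace by blast+
  have s0: "csubspace {0::'a}" by (rule complex_vector.subspace_single_0)
  have UV: "?U \<subseteq> V" using F by (auto simp: endo_in)
  have GV: "G ` V \<subseteq> V" using eG by (auto simp: endo_in)
  have kU: "?k \<subseteq> ?U" by (auto simp: kern_def G_def)
  have G0: "G 0 = 0" using linear_on_zero V eG unfolding endo_def by blast
  have GU: "G ` ?U \<subseteq> ?U"
    using complex_vector.subspace_diff[OF sub(1)] UV by (auto simp: G_def)
  have linG: "linear_on ?U G" using eG UV linear_on_mono unfolding endo_def by blast
  have sGU: "csubspace (G ` ?U)" using csubspace_image[OF linG sub(1) sub(1)] by simp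
  have cap: "?U \<inter> G ` V = G ` ?U"
  proof
    show "?U \<inter> G ` V \<subseteq> G ` ?U"
    proof
      fix y assume y: "y \<in> ?U \<inter> G ` V"
      then obtain x where x: "x \<in> V" "y = G x" by blast
      then have "y + F x = x" by (simp add: G_def)
      moreover have "y + F x \<in> ?U" using y x complex_vector.subspace_add[OF sub(1)] by blast
      ultimately have "x \<in> ?U" by metis
      then show "y \<in> G ` ?U" using x by blast
    qed
    show "G ` ?U \<subseteq> ?U \<inter> G ` V" using GU UV by blast
  qed
  have sum: "subspace_sum ?U (G ` V) = V"
  proof
    show "subspace_sum ?U (G ` V) \<subseteq> V"
      unfolding subspace_sum_def using UV GV complex_vector.subspace_add[OF V] by blast
    show "V \<subseteq> subspace_sum ?U (G ` V)"
    proof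
      fix x assume x: "x \<in> V"
      have "x = F x + G x" by (simp add: G_def)
      then show "x \<in> subspace_sum ?U (G ` V)" unfolding subspace_sum_def using x by blast
    qed
  qed
  have z: "{0} \<subseteq> ?k" "{0} \<subseteq> G ` ?U"
    using complex_vector.subspace_0 sub(2) sGU by auto
  have qk: "qfin ?k {0}" by (rule qfin_mono[OF F(2) kU]) simp
  have q1: "qfin ?U ?k" by (rule qfin_mono[OF F(2) _ z(1)]) simp
  have q2: "qfin (G ` ?U) {0}" by (rule qfin_mono[OF F(2) GU]) simp
  have q3: "qfin ?U (G ` ?U)" by (rule qfin_mono[OF F(2) _ z(2)]) simp
  have kerG: "{x \<in> ?U. G x = 0} \<subseteq> ?k" using UV by (auto simp: kern_def)
  have "G ` ?k = {0}" using z G0 by (auto simp: kern_def)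
  then have d1: "quotient_dim (G ` ?U) {0} = quotient_dim ?U ?k"
    using quotient_dim_image[OF linG sub(1) kerG sub(2) kU q1] by simp
  have d2: "quotient_dim V (G ` V) = quotient_dim ?U (G ` ?U)"
    using quotient_dim_second_iso[OF sub(1) sub(3)] cap sum q3 by simp
  have "qfin V (G ` V)"
  proof -
    obtain S where S: "finite S" "?U \<subseteq> cspan (S \<union> {0})" using F(2) unfolding qfin_def by blast
    have "V \<subseteq> cspan (S \<union> G ` V)"
    proof
      fix x assume x: "x \<in> V"
      have "F x \<in> cspan (S \<union> {0})" using S x by blast
      also have "\<dots> \<subseteq> cspan (S \<union> G ` V)"
        using complex_vector.span_mono[of S "S \<union> G ` V"] by (simp add: complex_vector.span_insert_0)
      finally have "F x + G x \<in> cspan (S \<union> G ` V)"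
        using x by (intro complex_vector.span_add) (auto intro: complex_vector.span_base)
      then show "x \<in> cspan (S \<union> G ` V)" by (simp add: G_def)
    qed
    then show ?thesis using S qfin_def by blast
  qed
  then have fred: "alg_fredholm V G" using eG qk by (simp add: alg_fredholm_def)
  have ind: "index V G = 0"
    using quotient_dim_add(2)[OF sub(1) sub(2) s0 z(1) kU q1 qk]
      quotient_dim_add(2)[OF sub(1) sGU s0 z(2) GU q3 q2] d1 d2
    by (simp add: index_def)
  show "alg_fredholm V (\<lambda>x. x - F x)" "index V (\<lambda>x. x - F x) = 0"
    using fred ind by (simp_all add: G_def)
qed

lemma index_bij_minus_finite_rank:
  assumes V: "csubspace V" and J: "endo V J" "inj_on J V" "J ` V = V"
    and F: "endo V F" "qfin (F ` V) {0}"
  shows "alg_fredholm V (\<lambda>x. J x - F x)" "index V (\<lambda>x. J x - F x) = 0"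
proof -
  define L where "L = inv_into V J"
  have L: "L y \<in> V" "J (L y) = y" if "y \<in> V" for y
    using that J(3) by (auto simp: L_def inv_into_into f_inv_into_f)
  have LJ: "L y = x" if "x \<in> V" "J x = y" for x y
    using that J(2) by (auto simp: L_def inv_into_f_eq)
  have eL: "endo V L"
  proof (rule endoI)
    show "L x \<in> V" if "x \<in> V" for x using L that by blast
    show "L (x + y) = L x + L y" if "x \<in> V" "y \<in> V" for x y
      using that L J(1) by (intro LJ) (simp_all add: endo_add complex_vector.subspace_add[OF V])
    show "L (c *\<^sub>C x) = c *\<^sub>C L x" if "x \<in> V" for x c
      using that L J(1) by (intro LJ) (simp_all add: endo_scale complex_vector.subspace_scale[OF V])
  qed
  have eLF: "endo V (L \<circ> F)" by (rule endo_comp[OF eL F(1)])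
  have "qfin (L ` F ` V) (L ` {0})"
  proof -
    have U: "csubspace (F ` V)" "F ` V \<subseteq> V"
      using range_subspace[OF V F(1)] F(1) by (auto simp: endo_in)
    have lin: "linear_on (F ` V) L" using eL U(2) linear_on_mono unfolding endo_def by blast
    have "{x \<in> F ` V. L x = 0} \<subseteq> {0}"
    proof
      fix x assume "x \<in> {x \<in> F ` V. L x = 0}"
      then have "x = J 0" using L U by force
      also have "J 0 = 0" using linear_on_zero V J(1) unfolding endo_def by blast
      finally show "x \<in> {0}" by simp
    qed
    moreover have "{0} \<subseteq> F ` V" using complex_vector.subspace_0[OF U(1)] by simp
    ultimately show ?thesis
      using qfin_image[OF lin U(1) _ complex_vector.subspace_single_0] F(2) by blast
  qed
  moreover have "L 0 = 0" using linear_on_zero V eL unfolding endo_def by blast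
  ultimately have qLF: "qfin ((L \<circ> F) ` V) {0}" by (simp add: image_comp)
  note G = index_ident_minus_finite_rank[OF V eLF qLF]
  note JG = alg_fredholm_comp[OF V index_bij(1)[OF V J] G(1)]
  have eq: "(J \<circ> (\<lambda>x. x - (L \<circ> F) x)) x = J x - F x" if "x \<in> V" for x
  proof -
    have "linear_on V J" using J(1) by (simp add: endo_def)
    from linear_on_diff[OF this V that] show ?thesis
      using that L F(1) eLF by (simp add: endo_in)
  qed
  show "alg_fredholm V (\<lambda>x. J x - F x)" "index V (\<lambda>x. J x - F x) = 0"
    using alg_fredholm_cong[of V "J \<circ> (\<lambda>x. x - (L \<circ> F) x)", OF V eq] JG G(2) index_bij(2)[OF V J]
    by simp_all
qed

section \<open>Bounded operators on a Banach space given as a set\<close>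

text \<open>A complex Banach space whose carrier and norm are terms, as required for the sequence spaces.\<close>

locale banach_carrier =
  fixes V :: "'v::complex_vector set" and N :: "'v \<Rightarrow> real"
  assumes V: "csubspace V"
    and N_nonneg: "x \<in> V \<Longrightarrow> 0 \<le> N x"
    and N_eq_0: "x \<in> V \<Longrightarrow> N x = 0 \<Longrightarrow> x = 0"
    and N_add: "x \<in> V \<Longrightarrow> y \<in> V \<Longrightarrow> N (x + y) \<le> N x + N y"
    and N_scale: "x \<in> V \<Longrightarrow> N (c *\<^sub>C x) = cmod c * N x"
    and N_complete: "(\<And>n::nat. s n \<in> V) \<Longrightarrow>
      (\<And>e. e > 0 \<Longrightarrow> \<exists>M. \<forall>m\<ge>M. \<forall>n\<ge>M. N (s m - s n) < e) \<Longrightarrow>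
      \<exists>l\<in>V. (\<lambda>n. N (s n - l)) \<longlonglongrightarrow> 0"
begin

lemma V_0: "0 \<in> V" and V_add: "x \<in> V \<Longrightarrow> y \<in> V \<Longrightarrow> x + y \<in> V"
  and V_diff: "x \<in> V \<Longrightarrow> y \<in> V \<Longrightarrow> x - y \<in> V" and V_minus: "x \<in> V \<Longrightarrow> - x \<in> V"
  and V_scale: "x \<in> V \<Longrightarrow> c *\<^sub>C x \<in> V"
  and V_sum: "(\<And>i. i \<in> I \<Longrightarrow> f i \<in> V) \<Longrightarrow> sum f I \<in> V"
  using complex_vector.subspace_0[OF V] complex_vector.subspace_add[OF V] complex_vector.subspace_diff[OF V]
    complex_vector.subspace_neg[OF V] complex_vector.subspace_scale[OF V] complex_vector.subspace_sum[OF V, of I f]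
  by auto

lemma N_0: "N 0 = 0"
  using N_scale[OF V_0, of 0] by (simp add: complex_vector.scale_zero_left)

lemma N_minus: "x \<in> V \<Longrightarrow> N (- x) = N x"
  using N_scale[of x "-1"] by (simp add: complex_vector.scale_minus_left scaleC_one)

lemma N_minus_commute: "x \<in> V \<Longrightarrow> y \<in> V \<Longrightarrow> N (x - y) = N (y - x)"
  using N_minus[OF V_diff[of x y]] by simp

lemma N_diff: "x \<in> V \<Longrightarrow> y \<in> V \<Longrightarrow> N (x - y) \<le> N x + N y"
  using N_add[of x "- y"] N_minus[of y] V_minus[of y] by simp

lemma N_diff_triangle: "x \<in> V \<Longrightarrow> y \<in> V \<Longrightarrow> z \<in> V \<Longrightarrow> N (x - z) \<le> N (x - y) + N (y - z)"
  using N_add[of "x - y" "y - z"] V_diff by simp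

lemma N_le_diff: "x \<in> V \<Longrightarrow> y \<in> V \<Longrightarrow> N x \<le> N y + N (x - y)"
  using N_add[of y "x - y"] V_diff by simp

lemma N_sum: "(\<And>i. i \<in> I \<Longrightarrow> f i \<in> V) \<Longrightarrow> N (sum f I) \<le> (\<Sum>i\<in>I. N (f i))"
proof (induction I rule: infinite_finite_induct)
  case (insert i I)
  have "N (f i + sum f I) \<le> N (f i) + N (sum f I)"
    using insert by (intro N_add V_sum) auto
  then show ?case using insert by simp
qed (simp_all add: N_0)

lemma lim_unique:
  assumes "\<And>n::nat. s n \<in> V" "a \<in> V" "b \<in> V"
    and "(\<lambda>n. N (s n - a)) \<longlonglongrightarrow> 0" "(\<lambda>n. N (s n - b)) \<longlonglongrightarrow> 0"
  shows "a = b"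
proof -
  have "(\<lambda>n. N (s n - a) + N (s n - b)) \<longlonglongrightarrow> 0 + 0" using assms(4,5) by (rule tendsto_add)
  moreover have "N (a - b) \<le> N (s n - a) + N (s n - b)" for n
    using N_diff_triangle[of a "s n" b] N_minus_commute[of a "s n"] assms by simp
  ultimately have "N (a - b) \<le> 0 + 0" by (intro LIMSEQ_le_const) auto
  then have "N (a - b) = 0" using N_nonneg[OF V_diff[of a b]] assms by simp
  then show ?thesis using N_eq_0[OF V_diff[of a b]] assms by simp
qed

text \<open>Operator norms are handled through bounds. An operator is a function on the whole type of which
only the restriction to \<open>V\<close> matters.\<close>

definition opb :: "('v \<Rightarrow> 'v) \<Rightarrow> real \<Rightarrow> bool" where
  "opb T C \<longleftrightarrow> (\<forall>x\<in>V. N (T x) \<le> C * N x)"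

definition bop :: "('v \<Rightarrow> 'v) \<Rightarrow> bool" where
  "bop T \<longleftrightarrow> endo V T \<and> (\<exists>C. opb T C)"

lemma opbD: "opb T C \<Longrightarrow> x \<in> V \<Longrightarrow> N (T x) \<le> C * N x"
  by (simp add: opb_def)

lemma opb_mono: "opb T C \<Longrightarrow> C \<le> D \<Longrightarrow> opb T D"
  unfolding opb_def by (meson N_nonneg mult_right_mono order_trans)

lemma bop_endo: "bop T \<Longrightarrow> endo V T" by (simp add: bop_def)
lemma bop_in: "bop T \<Longrightarrow> x \<in> V \<Longrightarrow> T x \<in> V" by (simp add: bop_def endo_in)
lemma bop_add: "bop T \<Longrightarrow> x \<in> V \<Longrightarrow> y \<in> V \<Longrightarrow> T (x + y) = T x + T y"
  using endo_add[OF bop_endo] .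
lemma bop_scale: "bop T \<Longrightarrow> x \<in> V \<Longrightarrow> T (c *\<^sub>C x) = c *\<^sub>C T x"
  using endo_scale[OF bop_endo] .
lemma bop_lin: "bop T \<Longrightarrow> linear_on V T" by (simp add: bop_def endo_def)
lemma bop_diff: "bop T \<Longrightarrow> x \<in> V \<Longrightarrow> y \<in> V \<Longrightarrow> T (x - y) = T x - T y"
  using linear_on_diff[OF bop_lin V] .
lemma bop_zero: "bop T \<Longrightarrow> T 0 = 0" using linear_on_zero[OF bop_lin V] .
lemma bop_minus: "bop T \<Longrightarrow> x \<in> V \<Longrightarrow> T (- x) = - T x"
  using bop_diff[of T 0 x] bop_zero V_0 by simp

lemma bop_bound:
  assumes "bop T" obtains C where "C > 0" "opb T C"
  using assms opb_mono unfolding bop_def by (metis gt_ex less_eq_real_def max.cobounded1 max_less_iff_conj not_le)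

lemma opb_comp: "opb S C \<Longrightarrow> opb T D \<Longrightarrow> bop T \<Longrightarrow> 0 \<le> C \<Longrightarrow> opb (\<lambda>x. S (T x)) (C * D)"
  unfolding opb_def
proof
  fix x assume *: "\<forall>x\<in>V. N (S x) \<le> C * N x" "\<forall>x\<in>V. N (T x) \<le> D * N x" "bop T" "0 \<le> C" "x \<in> V"
  then have "N (S (T x)) \<le> C * N (T x)" using bop_in by blast
  also have "\<dots> \<le> C * (D * N x)" using * by (simp add: mult_left_mono)
  finally show "N (S (T x)) \<le> C * D * N x" by (simp add: mult.assoc)
qed

lemma opb_add: "opb S C \<Longrightarrow> opb T D \<Longrightarrow> bop S \<Longrightarrow> bop T \<Longrightarrow> opb (\<lambda>x. S x + T x) (C + D)"
  unfolding opb_def by (smt (verit) N_add bop_in distrib_right)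

lemma opb_diff: "opb S C \<Longrightarrow> opb T D \<Longrightarrow> bop S \<Longrightarrow> bop T \<Longrightarrow> opb (\<lambda>x. S x - T x) (C + D)"
  unfolding opb_def by (smt (verit) N_diff bop_in distrib_right)

lemma bop_ident: "bop (\<lambda>x. x)"
  unfolding bop_def opb_def by (auto simp: endo_ident intro: exI[of _ 1])

lemma bop_comp: "bop S \<Longrightarrow> bop T \<Longrightarrow> bop (\<lambda>x. S (T x))"
proof -
  assume *: "bop S" "bop T"
  obtain C where "C > 0" "opb S C" by (rule bop_bound[OF *(1)])
  moreover obtain D where "D > 0" "opb T D" by (rule bop_bound[OF *(2)])
  ultimately have "opb (\<lambda>x. S (T x)) (C * D)" using * by (intro opb_comp) auto
  then show ?thesis using * endo_comp' unfolding bop_def by blast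
qed

lemma bop_plus: "bop S \<Longrightarrow> bop T \<Longrightarrow> bop (\<lambda>x. S x + T x)"
  using opb_add endo_plus[OF V] unfolding bop_def by blast

lemma bop_subtract: "bop S \<Longrightarrow> bop T \<Longrightarrow> bop (\<lambda>x. S x - T x)"
  using opb_diff endo_minus[OF V] unfolding bop_def by blast

lemma bop_const_0: "bop (\<lambda>x. 0)"
  using bop_subtract[OF bop_ident bop_ident] by simp

lemma bop_cong:
  assumes "bop T" "\<And>x. x \<in> V \<Longrightarrow> T x = T' x" shows "bop T'"
proof -
  have "endo V T'"
    using assms bop_in[OF assms(1)] bop_add[OF assms(1)] bop_scale[OF assms(1)] V_add V_scale
    by (intro endoI) metis+
  then show ?thesis using assms unfolding bop_def opb_def by auto
qed

lemma bop_lim: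
  assumes T: "bop T" and s: "\<And>n::nat. s n \<in> V" "l \<in> V" "(\<lambda>n. N (s n - l)) \<longlonglongrightarrow> 0"
  shows "(\<lambda>n. N (T (s n) - T l)) \<longlonglongrightarrow> 0"
proof -
  obtain C where C: "C > 0" "opb T C" by (rule bop_bound[OF T])
  have "(\<lambda>n. C * N (s n - l)) \<longlonglongrightarrow> C * 0" using s(3) by (intro tendsto_intros)
  then have "(\<lambda>n. C * N (s n - l)) \<longlonglongrightarrow> 0" by simp
  moreover have "N (T (s n) - T l) \<le> C * N (s n - l)" "0 \<le> N (T (s n) - T l)" for n
    using opbD[OF C(2) V_diff[OF s(1) s(2)], of n] bop_diff[OF T s(1) s(2), of n]
      N_nonneg[OF V_diff[OF bop_in[OF T s(1)] bop_in[OF T s(2)]]] by auto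
  ultimately show ?thesis
    by (intro Lim_null_comparison[of "\<lambda>n. N (T (s n) - T l)" "\<lambda>n. C * N (s n - l)"] always_eventually) auto
qed

text \<open>An operator that is bounded below has a complete, hence closed range; if dense, it is the whole
space.\<close>

lemma surj_of_dense_range:
  assumes J: "bop J" and c: "c > 0" "\<And>x. x \<in> V \<Longrightarrow> c * N x \<le> N (J x)"
    and dense: "\<And>y e. y \<in> V \<Longrightarrow> e > 0 \<Longrightarrow> \<exists>x\<in>V. N (J x - y) < e"
  shows "J ` V = V"
proof
  show "J ` V \<subseteq> V" using bop_in[OF J] by blast
  show "V \<subseteq> J ` V"
  proof
    fix y assume y: "y \<in> V"
    have "\<forall>n. \<exists>x. x \<in> V \<and> N (J x - y) < 1 / Suc n" using dense[OF y] by (metis zero_less_divide_1_iff of_nat_0_less_iff zero_less_Suc)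
    then obtain s where s: "\<And>n. s n \<in> V" "\<And>n. N (J (s n) - y) < 1 / Suc n" by metis
    have "\<exists>M. \<forall>m\<ge>M. \<forall>n\<ge>M. N (s m - s n) < e" if "e > 0" for e
    proof -
      obtain M where M: "1 / Suc M < c * e / 2"
        using reals_Archimedean[of "c * e / 2"] c \<open>e > 0\<close> by (auto simp: inverse_eq_divide)
      have "N (s m - s n) < e" if "m \<ge> M" "n \<ge> M" for m n
      proof -
        have le: "N (J (s k) - y) < c * e / 2" if "k \<ge> M" for k
        proof -
          have "1 / real (Suc k) \<le> 1 / Suc M" using that by (intro divide_left_mono) auto
          then show ?thesis using s(2)[of k] M by linarith
        qed
        have "c * N (s m - s n) \<le> N (J (s m) - J (s n))"
          using c(2)[OF V_diff[OF s(1) s(1)]] bop_diff[OF J s(1) s(1)] by simp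
        also have "\<dots> \<le> N (J (s m) - y) + N (y - J (s n))"
          using N_diff_triangle bop_in[OF J] s y by blast
        also have "\<dots> < c * e / 2 + c * e / 2"
          using le[OF that(1)] le[OF that(2)] N_minus_commute[OF y bop_in[OF J s(1)], of n] by linarith
        finally have "c * N (s m - s n) < c * e" by simp
        then show ?thesis using c(1) by simp
      qed
      then show ?thesis by blast
    qed
    then obtain l where l: "l \<in> V" "(\<lambda>n. N (s n - l)) \<longlonglongrightarrow> 0" using N_complete[of s] s(1) by blast
    have "(\<lambda>n. N (J (s n) - y)) \<longlonglongrightarrow> 0"
      by (rule tendsto_sandwich[OF _ _ tendsto_const LIMSEQ_Suc[OF lim_1_over_n]])
        (use s y bop_in[OF J] N_nonneg V_diff less_imp_le[OF s(2)] in auto)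
    then have "J l = y"
      using lim_unique[of "\<lambda>n. J (s n)"] bop_lim[OF J s(1) l] bop_in[OF J] s(1) l(1) y by blast
    then show "y \<in> J ` V" using l by blast
  qed
qed

lemma inj_of_bounded_below:
  assumes J: "bop J" and c: "c > 0" "\<And>x. x \<in> V \<Longrightarrow> c * N x \<le> N (J x)"
  shows "inj_on J V"
proof (rule inj_onI)
  fix x y assume *: "x \<in> V" "y \<in> V" "J x = J y"
  then have "c * N (x - y) \<le> N 0" using c(2)[OF V_diff] bop_diff[OF J] by fastforce
  then have "N (x - y) \<le> 0" using c(1) by (simp add: N_0 mult_le_0_iff)
  then show "x = y" using N_eq_0[OF V_diff] N_nonneg[OF V_diff] * by (metis antisym eq_iff_diff_eq_0)
qed

text \<open>The partial sums of the Neumann series solve the equation up to an arbitrarily small error, so the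
range is dense.\<close>

lemma ident_minus_small_bij:
  assumes S: "bop S" "opb S c" "0 \<le> c" "c < 1"
  shows "inj_on (\<lambda>x. x - S x) V" "(\<lambda>x. x - S x) ` V = V"
proof -
  have J: "bop (\<lambda>x. x - S x)" by (rule bop_subtract[OF bop_ident S(1)])
  have below: "(1 - c) * N x \<le> N (x - S x)" if "x \<in> V" for x
    using N_le_diff[OF that bop_in[OF S(1) that]] opbD[OF S(2) that] by (simp add: algebra_simps)
  show "inj_on (\<lambda>x. x - S x) V" by (rule inj_of_bounded_below[OF J _ below]) (use S in auto)
  show "(\<lambda>x. x - S x) ` V = V"
  proof (rule surj_of_dense_range[OF J _ below])
    show "0 < 1 - c" using S by simp
    fix y e assume y: "y \<in> V" and e: "(e::real) > 0"
    have pow: "(S ^^ n) y \<in> V" "N ((S ^^ n) y) \<le> c ^ n * N y" for n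
    proof (induction n)
      case 0
      { case 1 show ?case using y by simp next case 2 show ?case by simp }
    next
      case (Suc n)
      { case 1 show ?case using Suc bop_in[OF S(1)] by simp
      next
        case 2
        have "N (S ((S ^^ n) y)) \<le> c * N ((S ^^ n) y)" using opbD[OF S(2)] Suc by simp
        also have "\<dots> \<le> c * (c ^ n * N y)" using Suc S(3) by (simp add: mult_left_mono)
        finally show ?case by (simp add: mult.assoc) }
    qed
    have sum: "(\<Sum>i<n. (S ^^ i) y) \<in> V \<and> (\<Sum>i<n. (S ^^ i) y) - S (\<Sum>i<n. (S ^^ i) y) = y - (S ^^ n) y" for n
    proof (induction n)
      case 0 then show ?case using V_0 bop_zero[OF S(1)] by simp
    next
      case (Suc n)
      let ?u = "\<Sum>i<n. (S ^^ i) y" and ?v = "(S ^^ n) y"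
      have "?u \<in> V" "?u - S ?u = y - ?v" "?v \<in> V" using Suc pow(1)[of n] by auto
      moreover from this have "S (?u + ?v) = S ?u + S ?v" "?u + ?v \<in> V"
        using bop_add[OF S(1)] V_add by blast+
      ultimately show ?case by (simp add: algebra_simps)
    qed
    have "(\<lambda>n. c ^ n * N y) \<longlonglongrightarrow> 0 * N y"
      using S by (intro tendsto_mult LIMSEQ_realpow_zero) auto
    then have "\<forall>\<^sub>F n in sequentially. c ^ n * N y < e" using e by (simp add: order_tendstoD)
    then obtain n where n: "c ^ n * N y < e" by (auto simp: eventually_sequentially)
    let ?x = "\<Sum>i<n. (S ^^ i) y"
    have "?x - S ?x - y = - (S ^^ n) y" using sum[of n] by simp
    then have "N (?x - S ?x - y) < e" using N_minus[OF pow(1), of n] pow(2)[of n] n by simp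
    then show "\<exists>x\<in>V. N (x - S x - y) < e" using sum by blast
  qed
qed


section \<open>The closed graph theorem\<close>

text \<open>By the category theorem the sublevel sets of \<open>N \<circ> R\<close> are dense in some ball, and by linearity every
vector \<open>z\<close> is approximated, with relative error one half, by a vector \<open>a\<close> such that \<open>N (R a)\<close> is at
most a multiple of \<open>N z\<close>. Iterating this on the error writes \<open>z\<close> as a series whose image under \<open>R\<close>
converges as well; by closedness of the graph its sum is \<open>R z\<close>.\<close>

lemma closed_graph:
  assumes R: "endo V R"
    and closed: "\<And>s x y. (\<And>n::nat. s n \<in> V) \<Longrightarrow> x \<in> V \<Longrightarrow> y \<in> V \<Longrightarrow>
      (\<lambda>n. N (s n - x)) \<longlonglongrightarrow> 0 \<Longrightarrow> (\<lambda>n. N (R (s n) - y)) \<longlonglongrightarrow> 0 \<Longrightarrow> R x = y"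
  shows "bop R"
proof -
  define d where "d x y = (if x \<in> V \<and> y \<in> V then N (x - y) else 0)" for x y
  interpret M: Metric_space V d
  proof
    show "0 \<le> d x y" for x y by (simp add: d_def N_nonneg V_diff)
    show "d x y = d y x" for x y by (simp add: d_def N_minus_commute)
    show "d x y = 0 \<longleftrightarrow> x = y" if "x \<in> V" "y \<in> V" for x y
      using that N_eq_0[OF V_diff[OF that]] by (auto simp: d_def N_0)
    show "d x z \<le> d x y + d y z" if "x \<in> V" "y \<in> V" "z \<in> V" for x y z
      using that by (simp add: d_def N_diff_triangle)
  qed
  have complete: "M.mcomplete"
    unfolding M.mcomplete_def
  proof (intro allI impI)
    fix s assume "M.MCauchy s"
    then have s: "\<And>n. s n \<in> V"
      and c: "\<And>e. e > 0 \<Longrightarrow> \<exists>M. \<forall>n n'. M \<le> n \<longrightarrow> M \<le> n' \<longrightarrow> d (s n) (s n') < e"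
      unfolding M.MCauchy_def by auto
    have "\<exists>l\<in>V. (\<lambda>n. N (s n - l)) \<longlonglongrightarrow> 0"
    proof (rule N_complete[OF s])
      fix e :: real assume "e > 0"
      then show "\<exists>M. \<forall>m\<ge>M. \<forall>n\<ge>M. N (s m - s n) < e" using c[of e] s by (simp add: d_def)
    qed
    then obtain l where l: "l \<in> V" "(\<lambda>n. N (s n - l)) \<longlonglongrightarrow> 0" by blast
    have "limitin M.mtopology s l sequentially"
      unfolding M.limitin_metric using l s order_tendstoD(2)[OF l(2)] by (simp add: d_def)
    then show "\<exists>x. limitin M.mtopology s x sequentially" by blast
  qed
  define A where "A n = {x \<in> V. N (R x) \<le> real n}" for n
  let ?G = "range (\<lambda>n. M.mtopology closure_of (A n))"
  have "\<Union>?G = V"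
  proof
    show "\<Union>?G \<subseteq> V" using closure_of_subset_topspace[of M.mtopology] by auto
    show "V \<subseteq> \<Union>?G"
    proof
      fix x assume x: "x \<in> V"
      obtain n where "N (R x) \<le> real n" using real_arch_simple by blast
      then have "x \<in> A n" using x by (simp add: A_def)
      moreover have "A n \<subseteq> M.mtopology closure_of (A n)"
        by (rule closure_of_subset) (auto simp: A_def)
      ultimately show "x \<in> \<Union>?G" by blast
    qed
  qed
  then have "M.mtopology interior_of \<Union>?G = V"
    using interior_of_topspace[of M.mtopology] by simp
  then have ne: "M.mtopology interior_of \<Union>?G \<noteq> {}" using V_0 by auto
  have "\<exists>n. M.mtopology interior_of (M.mtopology closure_of (A n)) \<noteq> {}"
  proof (rule ccontr)
    assume "\<not> ?thesis"
    then have "M.mtopology interior_of \<Union>?G = {}"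
      by (intro M.metric_Baire_category_alt[OF complete]) auto
    then show False using ne by simp
  qed
  then obtain n x0 where "x0 \<in> M.mtopology interior_of (M.mtopology closure_of (A n))" by blast
  then obtain r where x0: "x0 \<in> V" and r: "r > 0" "M.mball x0 r \<subseteq> M.mtopology closure_of (A n)"
    unfolding M.metric_interior_of by blast
  have near: "\<exists>a\<in>A n. N (y - a) < e" if "y \<in> V" "N (y - x0) < r" "e > 0" for y e
  proof -
    have "y \<in> M.mball x0 r" using that x0 N_minus_commute[of y x0] by (simp add: d_def)
    then have "y \<in> M.mtopology closure_of (A n)" using r by blast
    then obtain a where "a \<in> A n" "a \<in> M.mball y e" using \<open>e > 0\<close> unfolding M.metric_closure_of by blast
    then show ?thesis using that by (auto simp: d_def)
  qed
  have ball: "\<exists>a\<in>V. N (R a) \<le> 2 * real n \<and> N (z - a) < e" if zz: "z \<in> V" "N z < r" "e > 0" for z e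
  proof -
    obtain a where a: "a \<in> A n" "N (x0 + z - a) < e / 2"
      using near[of "x0 + z" "e/2"] zz V_add x0 by auto
    obtain b where b: "b \<in> A n" "N (x0 - b) < e / 2"
      using near[of x0 "e/2"] zz x0 r by (auto simp: N_0)
    have ab: "a \<in> V" "b \<in> V" using a b by (auto simp: A_def)
    have "N (R (a - b)) \<le> N (R a) + N (R b)"
      using linear_on_diff[of V R a b] R V ab N_diff[of "R a" "R b"]
      by (simp add: endo_def endo_in image_subset_iff)
    then have 1: "N (R (a - b)) \<le> 2 * real n" using a b by (simp add: A_def)
    have "z - (a - b) = (x0 + z - a) - (x0 - b)" by simp
    then have "N (z - (a - b)) < e"
      using N_diff[of "x0 + z - a" "x0 - b"] a b ab x0 zz V_add V_diff by (simp only:) force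
    then show ?thesis using 1 V_diff[OF ab] by blast
  qed
  define K where "K = 2 * real n / (r / 2)"
  have K: "K \<ge> 0" using r by (simp add: K_def)
  have half: "\<exists>a. a \<in> V \<and> N (R a) \<le> K * N z \<and> N (z - a) \<le> N z / 2" if z: "z \<in> V" for z
  proof (cases "N z = 0")
    case True
    then have "z = 0" using N_eq_0 z by blast
    then show ?thesis
      using V_0 linear_on_zero[of V R] R V by (intro exI[of _ 0]) (simp add: N_0 endo_def)
  next
    case False
    then have pos: "N z > 0" using N_nonneg[OF z] by simp
    define t where "t = complex_of_real (r / 2 / N z)"
    have t: "cmod t = r / 2 / N z" "t \<noteq> 0"
      using pos r unfolding t_def by (simp_all only: norm_of_real of_real_eq_0_iff) auto
    have "N (t *\<^sub>C z) < r" using t pos r N_scale[OF z] by simp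
    moreover have "r / 4 > 0" using r by simp
    ultimately obtain a where a: "a \<in> V" "N (R a) \<le> 2 * real n" "N (t *\<^sub>C z - a) < r / 4"
      using ball[of "t *\<^sub>C z" "r / 4"] V_scale[OF z] by blast
    let ?a = "inverse t *\<^sub>C a"
    have i: "cmod (inverse t) = N z / (r / 2)" unfolding norm_inverse t(1) using pos r by (simp add: field_simps)
    have Rm: "R (inverse t *\<^sub>C a) = inverse t *\<^sub>C R a" using endo_scale[OF R a(1)] .
    have "N (R ?a) = N z / (r / 2) * N (R a)" using Rm N_scale[of "R a"] i R a by (simp add: endo_in)
    also have "\<dots> \<le> N z / (r / 2) * (2 * real n)"
      using a(2) pos r by (intro mult_left_mono) auto
    also have "\<dots> = K * N z" by (simp add: K_def)
    finally have 1: "N (R ?a) \<le> K * N z" .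
    have "z - ?a = inverse t *\<^sub>C (t *\<^sub>C z - a)"
      using t by (simp add: complex_vector.scale_right_diff_distrib scaleC_scaleC scaleC_one)
    then have "N (z - ?a) = N z / (r / 2) * N (t *\<^sub>C z - a)"
      using N_scale[OF V_diff[OF V_scale[OF z] a(1)], of "inverse t" t] i by simp
    also have "\<dots> \<le> N z / (r / 2) * (r / 4)"
      using a(3) pos r by (intro mult_left_mono) auto
    also have "\<dots> = N z / 2" using r by simp
    finally show ?thesis using 1 V_scale[OF a(1)] by blast
  qed
  then obtain g where g: "\<And>z. z \<in> V \<Longrightarrow> g z \<in> V" "\<And>z. z \<in> V \<Longrightarrow> N (R (g z)) \<le> K * N z"
      "\<And>z. z \<in> V \<Longrightarrow> N (z - g z) \<le> N z / 2" by metis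
  have "opb R (2 * K)"
    unfolding opb_def
  proof
    fix z assume z: "z \<in> V"
    define f where "f k = ((\<lambda>w. w - g w) ^^ k) z" for k
    have f: "f k \<in> V" "N (f k) \<le> N z / 2 ^ k" for k
    proof (induction k)
      case 0
      { case 1 show ?case using z by (simp add: f_def) next case 2 show ?case by (simp add: f_def) }
    next
      case (Suc k)
      have fs: "f (Suc k) = f k - g (f k)" by (simp add: f_def)
      { case 1 show ?case using Suc g V_diff fs by simp
      next
        case 2
        have "N (f (Suc k)) \<le> N (f k) / 2" using g(3)[OF Suc(1)] fs by simp
        then show ?case using Suc(2) by simp }
    qed
    define s where "s k = z - f k" for k
    have sV: "s k \<in> V" for k using f z V_diff by (simp add: s_def)
    have lin: "linear_on V R" using R by (simp add: endo_def)
    have "R (s (Suc k)) = R (s k) + R (g (f k))" for k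
    proof -
      have "s (Suc k) = s k + g (f k)" by (simp add: s_def f_def)
      then show ?thesis using endo_add[OF R sV g(1)[OF f(1)]] by simp
    qed
    then have step: "N (R (s (Suc k)) - R (s k)) \<le> K * N z / 2 ^ k" for k
      using g(2)[OF f(1), of k] mult_left_mono[OF f(2)[of k] K] by simp
    have tail: "N (R (s (m + j)) - R (s m)) \<le> 2 * K * N z / 2 ^ m - 2 * K * N z / 2 ^ (m + j)" for m j
    proof (induction j)
      case 0 then show ?case by (simp add: N_0)
    next
      case (Suc j)
      have "N (R (s (m + Suc j)) - R (s m)) \<le>
          N (R (s (Suc (m + j))) - R (s (m + j))) + N (R (s (m + j)) - R (s m))"
        using N_diff_triangle endo_in[OF R sV] by simp
      also have "\<dots> \<le> K * N z / 2 ^ (m + j) + (2 * K * N z / 2 ^ m - 2 * K * N z / 2 ^ (m + j))"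
        using step[of "m + j"] Suc by linarith
      finally show ?case by (simp add: field_simps)
    qed
    have bnd: "N (R (s k)) \<le> 2 * K * N z" for k
    proof -
      have "s 0 = 0" by (simp add: s_def f_def)
      then have "R (s 0) = 0" using linear_on_zero[OF lin V] by simp
      moreover have "0 \<le> 2 * K * N z / 2 ^ k" using K N_nonneg[OF z] by simp
      ultimately show ?thesis using tail[of 0 k] by simp
    qed
    have lim0: "(\<lambda>k. C / 2 ^ k) \<longlonglongrightarrow> 0" for C :: real
      by (rule LIMSEQ_divide_realpow_zero) simp
    have "\<exists>l\<in>V. (\<lambda>k. N (R (s k) - l)) \<longlonglongrightarrow> 0"
    proof (rule N_complete)
      show "R (s k) \<in> V" for k using endo_in[OF R sV] .
      fix e :: real assume "e > 0"
      then have "\<forall>\<^sub>F k in sequentially. 2 * K * N z / 2 ^ k < e / 2"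
        using order_tendstoD(2)[OF lim0[of "2 * K * N z"], of "e / 2"] by simp
      then obtain m0 where m0: "2 * K * N z / 2 ^ m0 < e / 2" by (auto simp: eventually_sequentially)
      have near0: "N (R (s m) - R (s m0)) < e / 2" if "m \<ge> m0" for m
      proof -
        have "0 \<le> 2 * K * N z / 2 ^ (m0 + (m - m0))" using K N_nonneg[OF z] by simp
        then show ?thesis using tail[of m0 "m - m0"] m0 that by simp
      qed
      have "N (R (s m) - R (s k)) < e" if "m \<ge> m0" "k \<ge> m0" for m k
        using N_diff_triangle[of "R (s m)" "R (s m0)" "R (s k)"] endo_in[OF R sV]
          N_minus_commute[of "R (s m0)" "R (s k)"] near0[OF that(1)] near0[OF that(2)] by simp
      then show "\<exists>M. \<forall>m\<ge>M. \<forall>n\<ge>M. N (R (s m) - R (s n)) < e" by blast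
    qed
    then obtain l where l: "l \<in> V" "(\<lambda>k. N (R (s k) - l)) \<longlonglongrightarrow> 0" by blast
    have "(\<lambda>k. N (s k - z)) \<longlonglongrightarrow> 0"
      by (rule tendsto_sandwich[OF _ _ tendsto_const lim0[of "N z"]])
        (use f N_minus N_nonneg in \<open>auto simp: s_def\<close>)
    then have Rz: "R z = l" by (rule closed[OF sV z l(1) _ l(2)])
    have "N l \<le> 2 * K * N z + N (R (s k) - l)" for k
      using N_le_diff[OF l(1) endo_in[OF R sV], of k] N_minus_commute[OF l(1) endo_in[OF R sV], of k]
        bnd[of k] by linarith
    moreover have "(\<lambda>k. 2 * K * N z + N (R (s k) - l)) \<longlonglongrightarrow> 2 * K * N z + 0"
      by (intro tendsto_intros l(2))
    ultimately have "N l \<le> 2 * K * N z + 0" by (intro LIMSEQ_le_const) auto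
    then show "N (R z) \<le> 2 * K * N z" using Rz by simp
  qed
  then show "bop R" using R unfolding bop_def by blast
qed

end

context banach_carrier
begin

section \<open>Finite-dimensional subspaces\<close>

lemma span_in_V: "B \<subseteq> V \<Longrightarrow> cspan B \<subseteq> V"
  using complex_vector.span_minimal V by blast

lemma lim_in_span_of_coordinate_bound:
  assumes B: "finite B" "B \<subseteq> V" and C: "\<And>u b. b \<in> B \<Longrightarrow> cmod (u b) \<le> C * N (\<Sum>b\<in>B. u b *\<^sub>C b)"
    and s: "\<And>n::nat. s n \<in> cspan B" "l \<in> V" "(\<lambda>n. N (s n - l)) \<longlonglongrightarrow> 0"
  shows "l \<in> cspan B"
proof -
  have sV: "s n \<in> V" for n using s(1) span_in_V[OF B(2)] by blast
  have "\<forall>n. \<exists>u. s n = (\<Sum>b\<in>B. u b *\<^sub>C b)"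
    using s(1) unfolding complex_vector.span_finite[OF B(1)] by blast
  then obtain u where u: "\<And>n. s n = (\<Sum>b\<in>B. u n b *\<^sub>C b)" by metis
  have "convergent (\<lambda>n. u n b)" if b: "b \<in> B" for b
  proof -
    have "Cauchy (\<lambda>n. u n b)"
    proof (rule metric_CauchyI)
      fix e :: real assume "e > 0"
      obtain D where D: "D > 0" "C \<le> D" by (rule that[of "\<bar>C\<bar> + 1"]) auto
      define e' where "e' = e / (2 * D)"
      have e': "e' > 0" using \<open>e > 0\<close> D by (simp add: e'_def)
      then obtain M where M: "\<And>n. n \<ge> M \<Longrightarrow> N (s n - l) < e'"
        using order_tendstoD(2)[OF s(3) e'] by (auto simp: eventually_sequentially)
      have "dist (u m b) (u n b) < e" if "m \<ge> M" "n \<ge> M" for m n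
      proof -
        have "(\<Sum>b\<in>B. (u m b - u n b) *\<^sub>C b) = s m - s n"
          by (simp add: u complex_vector.scale_left_diff_distrib sum_subtractf)
        then have "cmod (u m b - u n b) \<le> C * N (s m - s n)"
          using C[OF b, of "\<lambda>b. u m b - u n b"] by simp
        also have "\<dots> \<le> D * N (s m - s n)"
          using D(2) N_nonneg[OF V_diff[OF sV sV]] by (intro mult_right_mono) auto
        also have "\<dots> < D * (2 * e')"
        proof (rule mult_strict_left_mono)
          show "N (s m - s n) < 2 * e'"
            using N_diff_triangle[OF sV s(2) sV, of m n] N_minus_commute[OF s(2) sV, of n]
              M[OF that(1)] M[OF that(2)] by linarith
        qed (rule D)
        also have "\<dots> = e" using D by (simp add: e'_def)
        finally show ?thesis by (simp add: dist_norm)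
      qed
      then show "\<exists>M. \<forall>m\<ge>M. \<forall>n\<ge>M. dist (u m b) (u n b) < e" by blast
    qed
    then show ?thesis by (simp add: Cauchy_convergent_iff)
  qed
  then have L: "(\<lambda>n. u n b) \<longlonglongrightarrow> lim (\<lambda>n. u n b)" if "b \<in> B" for b
    using that convergent_LIMSEQ_iff by blast
  define w where "w = (\<Sum>b\<in>B. lim (\<lambda>n. u n b) *\<^sub>C b)"
  have wV: "w \<in> V" unfolding w_def using B by (intro V_sum V_scale) auto
  have "(\<lambda>n. \<Sum>b\<in>B. cmod (u n b - lim (\<lambda>n. u n b)) * N b) \<longlonglongrightarrow> (\<Sum>b\<in>B. 0 * N b)"
    by (intro tendsto_sum tendsto_mult tendsto_const)
      (use L in \<open>simp add: tendsto_norm_zero_iff LIM_zero_iff\<close>)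
  then have "(\<lambda>n. \<Sum>b\<in>B. cmod (u n b - lim (\<lambda>n. u n b)) * N b) \<longlonglongrightarrow> 0" by simp
  moreover have "N (s n - w) \<le> (\<Sum>b\<in>B. cmod (u n b - lim (\<lambda>n. u n b)) * N b)" for n
  proof -
    have "s n - w = (\<Sum>b\<in>B. (u n b - lim (\<lambda>n. u n b)) *\<^sub>C b)"
      by (simp add: u w_def complex_vector.scale_left_diff_distrib sum_subtractf)
    also have "N \<dots> \<le> (\<Sum>b\<in>B. N ((u n b - lim (\<lambda>n. u n b)) *\<^sub>C b))"
      by (rule N_sum) (use B V_scale in auto)
    also have "\<dots> = (\<Sum>b\<in>B. cmod (u n b - lim (\<lambda>n. u n b)) * N b)"
      by (rule sum.cong) (use B N_scale in auto)
    finally show ?thesis .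
  qed
  ultimately have "(\<lambda>n. N (s n - w)) \<longlonglongrightarrow> 0"
    using N_nonneg[OF V_diff[OF sV wV]]
    by (intro Lim_null_comparison[of "\<lambda>n. N (s n - w)"] always_eventually) auto
  then have "l = w" using lim_unique[OF sV s(2) wV s(3)] by blast
  moreover have "w \<in> cspan B"
    unfolding w_def by (intro complex_vector.span_sum complex_vector.span_scale complex_vector.span_base)
  ultimately show ?thesis by simp
qed

text \<open>The norm of a finite-dimensional subspace is equivalent to the maximum of the coordinates. By
induction: the span of the vectors treated so far is closed by the bound itself, so that the new
vector has a positive distance \<open>d\<close> from it.\<close>

lemma coordinate_bound:
  assumes "finite B" "complex_vector.independent B" "B \<subseteq> V"
  shows "\<exists>C>0. \<forall>u. \<forall>b\<in>B. cmod (u b) \<le> C * N (\<Sum>b\<in>B. u b *\<^sub>C b)"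
  using assms
proof (induction B rule: finite_induct)
  case empty
  then show ?case by (intro exI[of _ 1]) simp
next
  case (insert v B)
  have ind: "complex_vector.independent B" "v \<notin> cspan B"
    using insert.prems(1) insert.hyps(2) complex_vector.independent_insert[of v B] by auto
  have BV: "B \<subseteq> V" "v \<in> V" using insert.prems by auto
  obtain C where C: "C > 0" "\<And>u b. b \<in> B \<Longrightarrow> cmod (u b) \<le> C * N (\<Sum>b\<in>B. u b *\<^sub>C b)"
    using insert.IH[OF ind(1) BV(1)] by blast
  have "\<exists>d>0. \<forall>w\<in>cspan B. d \<le> N (w - v)"
  proof (rule ccontr)
    assume "\<not> ?thesis"
    then have "\<forall>n. \<exists>w. w \<in> cspan B \<and> N (w - v) < 1 / Suc n"
      by (metis not_le of_nat_0_less_iff zero_less_Suc zero_less_divide_1_iff)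
    then obtain s where s: "\<And>n. s n \<in> cspan B" "\<And>n. N (s n - v) < 1 / Suc n" by metis
    have sV: "s n \<in> V" for n using s(1) span_in_V[OF BV(1)] by blast
    have lim: "(\<lambda>n. N (s n - v)) \<longlonglongrightarrow> 0"
      by (rule Lim_null_comparison[OF always_eventually LIMSEQ_Suc[OF lim_1_over_n]])
        (use s(2) N_nonneg[OF V_diff[OF sV BV(2)]] in \<open>auto intro: less_imp_le\<close>)
    have "v \<in> cspan B"
      by (rule lim_in_span_of_coordinate_bound[of B C s v])
        (simp_all add: insert.hyps(1) BV C(2) s(1) lim)
    then show False using ind by blast
  qed
  then obtain d where d: "d > 0" "\<And>w. w \<in> cspan B \<Longrightarrow> d \<le> N (w - v)" by blast
  have Nv: "0 \<le> N v" using N_nonneg BV by blast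
  define D where "D = 1 / d + C * (1 + N v / d)"
  have D: "D > 0" "1 / d \<le> D" "C * (1 + N v / d) \<le> D"
    using d C Nv unfolding D_def by (auto intro!: add_pos_nonneg)
  have "cmod (u b) \<le> D * N (\<Sum>b\<in>insert v B. u b *\<^sub>C b)" if b: "b \<in> insert v B" for u b
  proof -
    let ?w = "\<Sum>b\<in>B. u b *\<^sub>C b" and ?t = "\<Sum>b\<in>insert v B. u b *\<^sub>C b"
    have wS: "?w \<in> cspan B"
      by (intro complex_vector.span_sum complex_vector.span_scale complex_vector.span_base)
    then have wV: "?w \<in> V" using span_in_V[OF BV(1)] by blast
    have t: "?t = u v *\<^sub>C v + ?w" using insert.hyps by simp
    have tV: "?t \<in> V" unfolding t using wV V_scale[OF BV(2)] V_add by blast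
    have uv: "cmod (u v) * d \<le> N ?t"
    proof (cases "u v = 0")
      case True then show ?thesis using N_nonneg[OF tV] by simp
    next
      case False
      let ?x = "(- inverse (u v)) *\<^sub>C ?w"
      have x: "?x \<in> cspan B" using wS by (rule complex_vector.span_scale)
      have "?t = (- u v) *\<^sub>C (?x - v)"
        using False by (simp add: t complex_vector.scale_right_diff_distrib scaleC_scaleC scaleC_one)
      then have "N ?t = cmod (- u v) * N (?x - v)"
        using N_scale[OF V_diff[OF V_scale[OF wV] BV(2)], of "- u v" "- inverse (u v)"] by (simp only:)
      then have "N ?t = cmod (u v) * N (?x - v)" by simp
      then show ?thesis using d(2)[OF x] by (simp add: mult_left_mono)
    qed
    then have uv': "cmod (u v) \<le> N ?t / d" using d by (simp add: field_simps)
    show ?thesis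
    proof (cases "b = v")
      case True
      have "N ?t / d \<le> D * N ?t" using mult_right_mono[OF D(2) N_nonneg[OF tV]] by simp
      then show ?thesis using True uv' by simp
    next
      case False
      then have "b \<in> B" using b by simp
      then have "cmod (u b) \<le> C * N ?w" by (rule C(2))
      also have "N ?w \<le> N ?t + N (u v *\<^sub>C v)"
        using N_diff[OF tV V_scale[OF BV(2)], of "u v"] t by simp
      also have "N (u v *\<^sub>C v) = cmod (u v) * N v" using N_scale[OF BV(2)] .
      also have "\<dots> \<le> N ?t / d * N v" using uv' Nv by (rule mult_right_mono)
      finally have "cmod (u b) \<le> C * (N ?t + N ?t / d * N v)" using C(1) by simp
      also have "\<dots> = C * (1 + N v / d) * N ?t" by (simp add: field_simps)
      also have "\<dots> \<le> D * N ?t" using D(3) N_nonneg[OF tV] by (rule mult_right_mono)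
      finally show ?thesis .
    qed
  qed
  then show ?case using D(1) by blast
qed

lemma finite_span_closed:
  assumes "finite B" "B \<subseteq> V" "\<And>n::nat. s n \<in> cspan B" "l \<in> V" "(\<lambda>n. N (s n - l)) \<longlonglongrightarrow> 0"
  shows "l \<in> cspan B"
proof -
  obtain C where C: "C \<subseteq> B" "complex_vector.independent C" "B \<subseteq> cspan C"
    by (rule complex_vector.maximal_independent_subset[of B])
  have sp: "cspan C = cspan B"
    using C by (metis complex_vector.span_mono complex_vector.span_span subset_antisym)
  have fC: "finite C" "C \<subseteq> V" using C assms finite_subset by auto
  obtain K where "\<And>u b. b \<in> C \<Longrightarrow> cmod (u b) \<le> K * N (\<Sum>b\<in>C. u b *\<^sub>C b)"
    using coordinate_bound[OF fC(1) C(2) fC(2)] by blast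
  then show ?thesis
    using lim_in_span_of_coordinate_bound[of C K s l] fC assms(3-5) sp by simp
qed

lemma finite_basis_of_subspace:
  assumes "csubspace U" "U \<subseteq> V" "qfin U {0}"
  obtains B where "finite B" "complex_vector.independent B" "B \<subseteq> U" "U = cspan B"
proof -
  obtain B where B: "B \<subseteq> U" "complex_vector.independent B" "U \<subseteq> cspan B"
    by (rule complex_vector.basis_exists[of U])
  obtain S where S: "finite S" "U \<subseteq> cspan (S \<union> {0})" using assms(3) unfolding qfin_def by blast
  have "B \<subseteq> cspan S" using B(1) S(2) by (simp add: complex_vector.span_insert_0)
  then have "finite B" using complex_vector.independent_span_bound[OF S(1) B(2)] by blast
  moreover have "U = cspan B" using B complex_vector.span_minimal[OF B(1) assms(1)] by blast
  ultimately show ?thesis using that B by blast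
qed

lemma qfin_span: "finite B \<Longrightarrow> qfin (cspan B) {0}"
  unfolding qfin_def by (intro exI[of _ B]) (simp add: complex_vector.span_insert_0)

text \<open>The boundedness of \<open>F\<close> is kept separate, since the rank is a purely algebraic matter.\<close>

definition finrank :: "('v \<Rightarrow> 'v) \<Rightarrow> bool" where
  "finrank F \<longleftrightarrow> qfin (F ` V) {0}"

lemma finrankI: "finite B \<Longrightarrow> (\<And>x. x \<in> V \<Longrightarrow> F x \<in> cspan B) \<Longrightarrow> finrank F"
  unfolding finrank_def by (rule qfin_mono[of "cspan B" "{0}"]) (auto simp: qfin_span)

lemma finrankE:
  assumes "finrank F" obtains B where "finite B" "\<And>x. x \<in> V \<Longrightarrow> F x \<in> cspan B"
proof -
  obtain S where "finite S" "F ` V \<subseteq> cspan (S \<union> {0})" using assms unfolding finrank_def qfin_def by blast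
  then show ?thesis using that[of S] by (simp add: complex_vector.span_insert_0 image_subset_iff)
qed

lemma finrank_cong: "finrank F \<Longrightarrow> (\<And>x. x \<in> V \<Longrightarrow> F x = G x) \<Longrightarrow> finrank G"
  unfolding finrank_def using image_cong[of V V F G] by simp

lemma finrank_comp_right: "finrank F \<Longrightarrow> bop T \<Longrightarrow> finrank (\<lambda>x. F (T x))"
  unfolding finrank_def by (erule qfin_mono) (use bop_in in auto)

lemma finrank_comp_left:
  assumes F: "bop F" "finrank F" and T: "bop T"
  shows "finrank (\<lambda>x. T (F x))"
proof -
  have U: "csubspace (F ` V)" "F ` V \<subseteq> V"
    using range_subspace[OF V bop_endo[OF F(1)]] bop_in[OF F(1)] by auto
  obtain B where B: "finite B" "complex_vector.independent B" "B \<subseteq> F ` V" "F ` V = cspan B"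
    by (rule finite_basis_of_subspace[OF U F(2)[unfolded finrank_def]])
  show ?thesis
  proof (rule finrankI[of "T ` B"])
    fix x assume "x \<in> V"
    then have "F x \<in> cspan B" using B(4) by blast
    then obtain u where u: "F x = (\<Sum>b\<in>B. u b *\<^sub>C b)"
      unfolding complex_vector.span_finite[OF B(1)] by blast
    have "T (F x) = (\<Sum>b\<in>B. u b *\<^sub>C T b)"
      unfolding u by (rule linear_on_sum[OF bop_lin[OF T] V]) (use B U in auto)
    then show "T (F x) \<in> cspan (T ` B)"
      by (simp add: complex_vector.span_sum complex_vector.span_scale complex_vector.span_base)
  qed (use B in simp)
qed

lemma finrank_plus:
  assumes "finrank F" "finrank G" shows "finrank (\<lambda>x. F x + G x)"
proof -
  obtain B where B: "finite B" "\<And>x. x \<in> V \<Longrightarrow> F x \<in> cspan B" by (rule finrankE[OF assms(1)]) blast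
  obtain C where C: "finite C" "\<And>x. x \<in> V \<Longrightarrow> G x \<in> cspan C" by (rule finrankE[OF assms(2)]) blast
  have "cspan B \<subseteq> cspan (B \<union> C)" "cspan C \<subseteq> cspan (B \<union> C)" by (simp_all add: complex_vector.span_mono)
  then show ?thesis using B C by (intro finrankI[of "B \<union> C"] complex_vector.span_add) auto
qed

section \<open>Norm limits of finite-rank operators\<close>

text \<open>Such operators form a closed ideal which takes the place of the compact operators.\<close>

definition approximable :: "('v \<Rightarrow> 'v) \<Rightarrow> bool" where
  "approximable K \<longleftrightarrow> bop K \<and> (\<forall>e>0. \<exists>F. bop F \<and> finrank F \<and> opb (\<lambda>x. K x - F x) e)"

lemma approximable_bop: "approximable K \<Longrightarrow> bop K" by (simp add: approximable_def)

lemma approximable_finrank: "bop F \<Longrightarrow> finrank F \<Longrightarrow> approximable F"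
  unfolding approximable_def opb_def
  by (auto intro!: exI[of _ F] simp: N_0 N_nonneg)

lemma approximable_limit:
  assumes K: "bop K" and lim: "\<And>e. e > 0 \<Longrightarrow> \<exists>L. approximable L \<and> opb (\<lambda>x. K x - L x) e"
  shows "approximable K"
  unfolding approximable_def
proof (intro conjI K allI impI)
  fix e :: real assume e: "e > 0"
  then obtain L where L: "approximable L" "opb (\<lambda>x. K x - L x) (e / 2)" using lim[of "e / 2"] by auto
  then obtain F where F: "bop F" "finrank F" "opb (\<lambda>x. L x - F x) (e / 2)"
    using e unfolding approximable_def by (meson half_gt_zero)
  have "opb (\<lambda>x. (K x - L x) + (L x - F x)) (e / 2 + e / 2)"
    using L F K by (intro opb_add bop_subtract) (auto dest: approximable_bop)
  then show "\<exists>F. bop F \<and> finrank F \<and> opb (\<lambda>x. K x - F x) e" using F by (intro exI[of _ F]) simp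
qed

lemma approximable_cong:
  assumes "approximable K" "\<And>x. x \<in> V \<Longrightarrow> K x = L x" shows "approximable L"
proof -
  have "bop L" using bop_cong[OF approximable_bop[OF assms(1)]] assms(2) by blast
  then show ?thesis using assms unfolding approximable_def opb_def by auto
qed

lemma approximable_plus:
  assumes "approximable K" "approximable L" shows "approximable (\<lambda>x. K x + L x)"
  unfolding approximable_def
proof (intro conjI allI impI)
  show "bop (\<lambda>x. K x + L x)" using assms by (intro bop_plus approximable_bop)
  fix e :: real assume e: "e > 0"
  obtain F where F: "bop F" "finrank F" "opb (\<lambda>x. K x - F x) (e / 2)"
    using assms(1) e unfolding approximable_def by (meson half_gt_zero)
  obtain G where G: "bop G" "finrank G" "opb (\<lambda>x. L x - G x) (e / 2)"
    using assms(2) e unfolding approximable_def by (meson half_gt_zero)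
  have "opb (\<lambda>x. (K x - F x) + (L x - G x)) (e / 2 + e / 2)"
    using F G assms by (intro opb_add bop_subtract) (auto dest: approximable_bop)
  then show "\<exists>F. bop F \<and> finrank F \<and> opb (\<lambda>x. K x + L x - F x) e"
    using F G by (intro exI[of _ "\<lambda>x. F x + G x"] conjI bop_plus finrank_plus) (auto simp: algebra_simps)
qed

lemma approximable_comp_left:
  assumes K: "approximable K" and T: "bop T" shows "approximable (\<lambda>x. T (K x))"
  unfolding approximable_def
proof (intro conjI allI impI)
  show "bop (\<lambda>x. T (K x))" by (rule bop_comp[OF T approximable_bop[OF K]])
  obtain C where C: "C > 0" "opb T C" by (rule bop_bound[OF T])
  fix e :: real assume e: "e > 0"
  then have "e / C > 0" using C by simp
  then obtain F where F: "bop F" "finrank F" "opb (\<lambda>x. K x - F x) (e / C)"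
    using K unfolding approximable_def by meson
  have "opb (\<lambda>x. T (K x - F x)) (C * (e / C))"
    using C by (intro opb_comp[OF C(2) F(3) bop_subtract[OF approximable_bop[OF K] F(1)]]) simp
  then have "opb (\<lambda>x. T (K x) - T (F x)) e"
    using C bop_diff[OF T] bop_in[OF F(1)] bop_in[OF approximable_bop[OF K]] by (simp add: opb_def)
  then show "\<exists>F. bop F \<and> finrank F \<and> opb (\<lambda>x. T (K x) - F x) e"
    using bop_comp[OF T F(1)] finrank_comp_left[OF F(1,2) T] by blast
qed

lemma approximable_comp_right:
  assumes K: "approximable K" and T: "bop T" shows "approximable (\<lambda>x. K (T x))"
  unfolding approximable_def
proof (intro conjI allI impI)
  show "bop (\<lambda>x. K (T x))" by (rule bop_comp[OF approximable_bop[OF K] T])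
  obtain C where C: "C > 0" "opb T C" by (rule bop_bound[OF T])
  fix e :: real assume e: "e > 0"
  then have "e / C > 0" using C by simp
  then obtain F where F: "bop F" "finrank F" "opb (\<lambda>x. K x - F x) (e / C)"
    using K unfolding approximable_def by meson
  have "opb (\<lambda>x. K (T x) - F (T x)) (e / C * C)"
    using opb_comp[OF F(3) C(2) T] e C by simp
  then show "\<exists>F. bop F \<and> finrank F \<and> opb (\<lambda>x. K (T x) - F x) e"
    using bop_comp[OF F(1) T] finrank_comp_right[OF F(2) T] C by auto
qed

lemma approximable_uminus: "approximable K \<Longrightarrow> approximable (\<lambda>x. - K x)"
proof -
  assume K: "approximable K"
  have "bop (\<lambda>x. - x)" using bop_subtract[OF bop_const_0 bop_ident] by simp
  from approximable_comp_left[OF K this] show ?thesis .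
qed

lemma approximable_diff:
  "approximable K \<Longrightarrow> approximable L \<Longrightarrow> approximable (\<lambda>x. K x - L x)"
  using approximable_plus[OF _ approximable_uminus] by simp

lemma approximable_const_0: "approximable (\<lambda>x. 0)"
  by (intro approximable_finrank bop_const_0 finrankI[of "{}"]) simp_all

lemma approximable_sum:
  "(\<And>i. i \<in> I \<Longrightarrow> approximable (K i)) \<Longrightarrow> approximable (\<lambda>x. \<Sum>i\<in>I. K i x)"
proof (induction I rule: infinite_finite_induct)
  case (insert i I)
  then show ?case using approximable_plus[of "K i" "\<lambda>x. \<Sum>i\<in>I. K i x"] by simp
qed (simp_all add: approximable_const_0)

text \<open>Split \<open>K\<close> into a finite-rank part and a part of norm at most one half; the identity minus the
latter is invertible.\<close>

lemma index_ident_minus_approximable: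
  assumes K: "approximable K"
  shows "alg_fredholm V (\<lambda>x. x - K x)" "index V (\<lambda>x. x - K x) = 0"
proof -
  obtain F where F: "bop F" "finrank F" "opb (\<lambda>x. K x - F x) (1/2)"
    using K unfolding approximable_def by (meson half_gt_zero zero_less_one)
  have S: "bop (\<lambda>x. K x - F x)" using K F by (intro bop_subtract) (auto dest: approximable_bop)
  let ?J = "\<lambda>x. x - (K x - F x)"
  have J: "endo V ?J" "inj_on ?J V" "?J ` V = V"
    using bop_endo[OF bop_subtract[OF bop_ident S]] ident_minus_small_bij[OF S F(3)] by auto
  have "qfin (F ` V) {0}" using F(2) by (simp add: finrank_def)
  from index_bij_minus_finite_rank[OF V J bop_endo[OF F(1)] this]
  show "alg_fredholm V (\<lambda>x. x - K x)" "index V (\<lambda>x. x - K x) = 0" by (simp_all add: algebra_simps)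
qed

text \<open>Both products \<open>R T\<close> and \<open>T R\<close> have index zero, and the index is additive.\<close>

lemma fredholm_of_regularizer:
  assumes T: "bop T" and R: "bop R"
    and RT: "approximable (\<lambda>x. x - R (T x))" and TR: "approximable (\<lambda>x. x - T (R x))"
  shows "alg_fredholm V T" "alg_fredholm V R" "index V T = - index V R"
proof -
  have *: "alg_fredholm V (R \<circ> T)" "index V (R \<circ> T) = 0" "alg_fredholm V (T \<circ> R)"
    using index_ident_minus_approximable[OF RT] index_ident_minus_approximable[OF TR]
    by (simp_all add: comp_def)
  note e = bop_endo[OF T] bop_endo[OF R]
  show T': "alg_fredholm V T" by (rule alg_fredholm_factor[OF V e(2,1,2) *(1,3)])
  show R': "alg_fredholm V R" by (rule alg_fredholm_factor[OF V e(1,2,1) *(3,1)])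
  show "index V T = - index V R" using alg_fredholm_comp(2)[OF V R' T'] *(2) by simp
qed

end

section \<open>Regularizers of Fredholm operators\<close>

text \<open>The assumption supplies the bounded projections onto finite-dimensional subspaces for which one would otherwise appeal
to the Hahn-Banach theorem.\<close>

locale banach_carrier_approx = banach_carrier +
  assumes finrank_near_ident: "finite X \<Longrightarrow> X \<subseteq> V \<Longrightarrow> e > 0 \<Longrightarrow>
    \<exists>F. bop F \<and> finrank F \<and> (\<forall>x\<in>X. N (F x - x) < e)"
begin

text \<open>A finite-rank operator \<open>F\<close> that almost fixes a basis of \<open>U\<close> is injective on \<open>U\<close>. Extending the
images of the basis to a basis of the range of \<open>F\<close> and reading off coordinates gives a left
inverse of the restriction of \<open>F\<close> to \<open>U\<close>, bounded because the range is finite-dimensional.\<close>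

lemma projection_onto_finite_dimensional:
  assumes U: "csubspace U" "U \<subseteq> V" "qfin U {0}"
  shows "\<exists>J. bop J \<and> J ` V \<subseteq> U \<and> (\<forall>x\<in>U. J x = x)"
proof -
  obtain B where B: "finite B" "complex_vector.independent B" "B \<subseteq> U" "U = cspan B"
    by (rule finite_basis_of_subspace[OF U])
  have BV: "B \<subseteq> V" using B U by blast
  obtain C where C: "C > 0" "\<And>u b. b \<in> B \<Longrightarrow> cmod (u b) \<le> C * N (\<Sum>b\<in>B. u b *\<^sub>C b)"
    using coordinate_bound[OF B(1,2) BV] by blast
  \<comment> \<open>This tolerance leaves a relative error of at most one half on the span of the basis.\<close>
  define e where "e = 1 / (2 * C * (card B + 1))"
  have e: "e > 0" using C by (simp add: e_def)
  obtain F where F: "bop F" "finrank F" "\<And>x. x \<in> B \<Longrightarrow> N (F x - x) < e"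
    using finrank_near_ident[OF B(1) BV e] by blast
  have Fsum: "F (\<Sum>b\<in>B. u b *\<^sub>C b) = (\<Sum>b\<in>B. u b *\<^sub>C F b)" for u
    by (rule linear_on_sum[OF bop_lin[OF F(1)] V]) (use BV in auto)
  have near: "N (F x - x) \<le> N x / 2" if x: "x \<in> U" for x
  proof -
    obtain u where u: "x = (\<Sum>b\<in>B. u b *\<^sub>C b)"
      using x unfolding B(4) complex_vector.span_finite[OF B(1)] by blast
    have xV: "x \<in> V" using x U by blast
    have "F x - x = (\<Sum>b\<in>B. u b *\<^sub>C (F b - b))"
      unfolding u Fsum by (simp add: complex_vector.scale_right_diff_distrib sum_subtractf)
    also have "N \<dots> \<le> (\<Sum>b\<in>B. N (u b *\<^sub>C (F b - b)))"
      by (rule N_sum) (use BV bop_in[OF F(1)] V_diff V_scale in auto)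
    also have "\<dots> \<le> (\<Sum>b\<in>B. C * N x * e)"
    proof (rule sum_mono)
      fix b assume b: "b \<in> B"
      then have "F b - b \<in> V" using BV bop_in[OF F(1)] V_diff by blast
      then have "N (u b *\<^sub>C (F b - b)) = cmod (u b) * N (F b - b)" by (rule N_scale)
      also have "\<dots> \<le> C * N x * e"
        using C(1) C(2)[OF b, of u] F(3)[OF b] u N_nonneg[OF \<open>F b - b \<in> V\<close>] N_nonneg[OF xV]
        by (intro mult_mono mult_nonneg_nonneg) auto
      finally show "N (u b *\<^sub>C (F b - b)) \<le> C * N x * e" .
    qed
    also have "\<dots> = card B * (C * e) * N x" by simp
    also have "\<dots> \<le> 1 / 2 * N x"
    proof (rule mult_right_mono[OF _ N_nonneg[OF xV]])
      have Ce: "C * e = 1 / (2 * (real (card B) + 1))" using C(1) by (simp add: e_def)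
      show "real (card B) * (C * e) \<le> 1 / 2" unfolding Ce by (simp add: field_simps)
    qed
    finally show ?thesis by simp
  qed
  have ker: "x = 0" if "x \<in> U" "F x = 0" for x
  proof -
    have xV: "x \<in> V" using that U by blast
    then have "N x \<le> N x / 2" using near[OF that(1)] that(2) N_minus[OF xV] by simp
    then show ?thesis using N_nonneg[OF xV] N_eq_0[OF xV] by simp
  qed
  have inj: "inj_on F B"
  proof (rule inj_onI)
    fix a b assume ab: "a \<in> B" "b \<in> B" "F a = F b"
    then have "a - b \<in> U" "F (a - b) = 0"
      using B U complex_vector.subspace_diff[OF U(1)] bop_diff[OF F(1)] BV by (auto simp: subset_iff)
    then show "a = b" using ker[of "a - b"] by simp
  qed
  have "complex_vector.independent (F ` B)"
  proof
    assume "complex_vector.dependent (F ` B)"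
    then obtain v c where v: "c \<in> F ` B" "v c \<noteq> 0" "(\<Sum>c\<in>F ` B. v c *\<^sub>C c) = 0"
      unfolding complex_vector.dependent_finite[OF finite_imageI[OF B(1)]] by blast
    have "(\<Sum>b\<in>B. v (F b) *\<^sub>C F b) = 0" using v(3) inj by (simp add: sum.reindex)
    then have "F (\<Sum>b\<in>B. v (F b) *\<^sub>C b) = 0" unfolding Fsum .
    moreover have "(\<Sum>b\<in>B. v (F b) *\<^sub>C b) \<in> U" by (rule csubspace_sum_scale[OF U(1)]) (use B(3) in blast)
    ultimately have z: "(\<Sum>b\<in>B. v (F b) *\<^sub>C b) = 0" using ker by blast
    have "cmod (v (F b)) \<le> C * N 0" if "b \<in> B" for b
      using C(2)[OF that, of "\<lambda>b. v (F b)"] z by simp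
    then show False using v(1,2) by (auto simp: N_0)
  qed
  note indF = this
  have FBV: "F ` B \<subseteq> F ` V" using BV by blast
  obtain D where D: "F ` B \<subseteq> D" "D \<subseteq> F ` V" "complex_vector.independent D" "F ` V \<subseteq> cspan D"
    by (rule complex_vector.maximal_independent_subset_extend[OF FBV indF])
  have FV: "F ` V \<subseteq> V" using bop_in[OF F(1)] by blast
  obtain S where S: "finite S" "F ` V \<subseteq> cspan (S \<union> {0})"
    using F(2) unfolding finrank_def qfin_def by blast
  have "D \<subseteq> cspan S" using D(2) S(2) by (simp add: complex_vector.span_insert_0)
  then have fD: "finite D" using complex_vector.independent_span_bound[OF S(1) D(3)] by blast
  have DV: "D \<subseteq> V" using D FV by blast
  obtain C' where C': "C' > 0" "\<And>u b. b \<in> D \<Longrightarrow> cmod (u b) \<le> C' * N (\<Sum>b\<in>D. u b *\<^sub>C b)"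
    using coordinate_bound[OF fD D(3) DV] by blast
  let ?r = "complex_vector.representation D"
  have Fsp: "F x \<in> cspan D" if "x \<in> V" for x using that D(4) by blast
  define J where "J x = (\<Sum>b\<in>B. ?r (F x) (F b) *\<^sub>C b)" for x
  have JU: "J x \<in> U" for x unfolding J_def by (rule csubspace_sum_scale[OF U(1)]) (use B(3) in blast)
  have endoJ: "endo V J"
  proof (rule endoI)
    show "J x \<in> V" for x using JU U by blast
    fix x assume x: "x \<in> V"
    show "J (x + y) = J x + J y" if y: "y \<in> V" for y
      using bop_add[OF F(1) x y] complex_vector.representation_add[OF D(3) Fsp[OF y] Fsp[OF x]]
      by (simp add: J_def scaleC_add_left sum.distrib)
    show "J (c *\<^sub>C x) = c *\<^sub>C J x" for c
      using bop_scale[OF F(1) x] complex_vector.representation_scale[OF D(3) Fsp[OF x]]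
      by (simp add: J_def complex_vector.scale_sum_right scaleC_scaleC)
  qed
  obtain M where M: "M > 0" "opb F M" by (rule bop_bound[OF F(1)])
  have "opb J (\<Sum>b\<in>B. C' * M * N b)"
    unfolding opb_def
  proof
    fix x assume x: "x \<in> V"
    have rep: "(\<Sum>b\<in>D. ?r (F x) b *\<^sub>C b) = F x"
      by (rule complex_vector.sum_representation_eq[OF D(3) Fsp[OF x] fD]) simp
    have "N (J x) \<le> (\<Sum>b\<in>B. N (?r (F x) (F b) *\<^sub>C b))"
      unfolding J_def by (rule N_sum) (use BV V_scale in auto)
    also have "\<dots> \<le> (\<Sum>b\<in>B. C' * M * N b * N x)"
    proof (rule sum_mono)
      fix b assume b: "b \<in> B"
      then have "F b \<in> D" using D by blast
      have "cmod (?r (F x) (F b)) \<le> C' * N (F x)" using C'(2)[OF \<open>F b \<in> D\<close>, of "?r (F x)"] rep by simp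
      also have "\<dots> \<le> C' * (M * N x)" using C'(1) opbD[OF M(2) x] by (simp add: mult_left_mono)
      finally have "cmod (?r (F x) (F b)) * N b \<le> C' * (M * N x) * N b"
        using N_nonneg BV b by (intro mult_right_mono) auto
      then show "N (?r (F x) (F b) *\<^sub>C b) \<le> C' * M * N b * N x"
        using N_scale BV b by (simp add: subset_iff mult_ac)
    qed
    finally show "N (J x) \<le> (\<Sum>b\<in>B. C' * M * N b) * N x" by (simp add: sum_distrib_right)
  qed
  then have "bop J" using endoJ unfolding bop_def by blast
  moreover have "J ` V \<subseteq> U" using JU by blast
  moreover have "\<forall>x\<in>U. J x = x"
  proof
    fix x assume "x \<in> U"
    then obtain u where u: "x = (\<Sum>b\<in>B. u b *\<^sub>C b)"
      unfolding B(4) complex_vector.span_finite[OF B(1)] by blast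
    have Jb: "J b = b" if b: "b \<in> B" for b
    proof -
      have "F b \<in> D" using b D by blast
      then have r: "?r (F b) = (\<lambda>v. if v = F b then 1 else 0)"
        by (rule complex_vector.representation_basis[OF D(3)])
      have "J b = (\<Sum>c\<in>B. (if c = b then 1 else 0) *\<^sub>C c)"
        unfolding J_def r by (rule sum.cong) (use inj b in \<open>auto simp: inj_on_def\<close>)
      also have "\<dots> = b"
        using b B(1) by (simp add: if_distrib[of "\<lambda>z. z *\<^sub>C _"] scaleC_one cong: if_cong)
      finally show ?thesis .
    qed
    have "J x = (\<Sum>b\<in>B. u b *\<^sub>C J b)"
      unfolding u by (rule linear_on_sum[OF _ V]) (use endoJ BV in \<open>auto simp: endo_def\<close>)
    also have "\<dots> = x" unfolding u by (rule sum.cong) (simp_all add: Jb)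
    finally show "J x = x" .
  qed
  ultimately show ?thesis by blast
qed

text \<open>With a projection \<open>J\<close> onto the kernel and a basis \<open>B\<close> of a complement of the range, every \<open>y\<close> is
\<open>T x\<close> up to the span of \<open>B\<close> for exactly one \<open>x\<close> with \<open>J x = 0\<close>. This \<open>x\<close> is \<open>R y\<close>; the graph of \<open>R\<close>
is closed because the span of \<open>B\<close> is.\<close>

lemma regularizer_exists:
  assumes T: "bop T" "alg_fredholm V T"
  shows "\<exists>R. bop R \<and> finrank (\<lambda>x. x - R (T x)) \<and> finrank (\<lambda>x. x - T (R x))"
proof -
  have eT: "endo V T" and q: "qfin (kern V T) {0}" "qfin V (T ` V)"
    using T(2) by (auto simp: alg_fredholm_def)
  have ksub: "csubspace (kern V T)" "kern V T \<subseteq> V"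
    using kern_subspace[OF V eT] by (auto simp: kern_def)
  obtain J where J: "bop J" "J ` V \<subseteq> kern V T" "\<And>x. x \<in> kern V T \<Longrightarrow> J x = x"
    using projection_onto_finite_dimensional[OF ksub q(1)] by blast
  obtain B where B: "quotient_basis V (T ` V) B"
    using quotient_basis_exists[OF V range_subspace[OF V eT] q(2)] by blast
  note d = B[unfolded quotient_basis_def]
  have BV: "finite B" "B \<subseteq> V" using d by auto
  have spV: "cspan B \<subseteq> V" by (rule span_in_V[OF BV(2)])
  define rel where "rel y x \<longleftrightarrow> x \<in> V \<and> J x = 0 \<and> y - T x \<in> cspan B" for y x
  have ex: "\<exists>x. rel y x" if y: "y \<in> V" for y
  proof -
    obtain u x where u: "x \<in> V" "y - (\<Sum>b\<in>B. u b *\<^sub>C b) = T x" using d y by blast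
    have Jx: "J x \<in> V" "T (J x) = 0" "J (J x) = J x" using J u by (auto simp: kern_def)
    have "y - T (x - J x) = (\<Sum>b\<in>B. u b *\<^sub>C b)" using bop_diff[OF T(1) u(1) Jx(1)] Jx u(2) by (simp add: algebra_simps)
    moreover have "(\<Sum>b\<in>B. u b *\<^sub>C b) \<in> cspan B"
      by (intro complex_vector.span_sum complex_vector.span_scale complex_vector.span_base)
    ultimately have "rel y (x - J x)"
      unfolding rel_def using u Jx V_diff bop_diff[OF J(1) u(1) Jx(1)] by simp
    then show ?thesis by blast
  qed
  have uniq0: "x = 0" if "rel 0 x" for x
  proof -
    have x: "x \<in> V" "J x = 0" "- T x \<in> cspan B" using that by (auto simp: rel_def)
    then obtain u where u: "- T x = (\<Sum>b\<in>B. u b *\<^sub>C b)"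
      unfolding complex_vector.span_finite[OF BV(1)] by blast
    have "(\<Sum>b\<in>B. u b *\<^sub>C b) = T (- x)" using u bop_minus[OF T(1) x(1)] by simp
    then have "(\<Sum>b\<in>B. u b *\<^sub>C b) \<in> T ` V" using V_minus[OF x(1)] by blast
    then have "\<forall>b\<in>B. u b = 0" using d by simp
    then have "T x = 0" using u by simp
    then show ?thesis using J(3)[of x] x by (simp add: kern_def)
  qed
  have rel_add: "rel (y + y') (x + x')" if "rel y x" "rel y' x'" for y y' x x'
    using that complex_vector.span_add[of "y - T x" B "y' - T x'"] V_add bop_add[OF T(1)] bop_add[OF J(1)]
    by (simp add: rel_def algebra_simps)
  have rel_scale: "rel (c *\<^sub>C y) (c *\<^sub>C x)" if "rel y x" for y x c
    using that complex_vector.span_scale[of "y - T x" B c] V_scale bop_scale[OF T(1)] bop_scale[OF J(1)]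
    by (simp add: rel_def complex_vector.scale_right_diff_distrib)
  have uniq: "x = x'" if "rel y x" "rel y x'" for y x x'
  proof -
    have "rel (y + (-1) *\<^sub>C y) (x + (-1) *\<^sub>C x')" by (rule rel_add[OF that(1) rel_scale[OF that(2)]])
    then have "rel 0 (x - x')" by (simp add: complex_vector.scale_minus_left scaleC_one)
    then have "x - x' = 0" by (rule uniq0)
    then show ?thesis by simp
  qed
  define R where "R y = (THE x. rel y x)" for y
  have R: "rel y (R y)" if "y \<in> V" for y
    unfolding R_def using theI'[of "rel y"] ex[OF that] uniq by blast
  have Req: "R y = x" if "rel y x" "y \<in> V" for x y using uniq[OF R[OF that(2)] that(1)] .
  have endoR: "endo V R"
  proof (rule endoI)
    show "R x \<in> V" if "x \<in> V" for x using R[OF that] by (simp add: rel_def)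
    show "R (x + y) = R x + R y" if "x \<in> V" "y \<in> V" for x y
      using Req[OF rel_add[OF R[OF that(1)] R[OF that(2)]] V_add[OF that]] .
    show "R (c *\<^sub>C x) = c *\<^sub>C R x" if "x \<in> V" for c x
      using Req[OF rel_scale[OF R[OF that]] V_scale[OF that]] .
  qed
  have bR: "bop R"
  proof (rule closed_graph[OF endoR])
    fix s :: "nat \<Rightarrow> 'a" and x y
    assume s: "\<And>n. s n \<in> V" "x \<in> V" "y \<in> V" "(\<lambda>n. N (s n - x)) \<longlonglongrightarrow> 0" "(\<lambda>n. N (R (s n) - y)) \<longlonglongrightarrow> 0"
    have RV: "R (s n) \<in> V" for n using endo_in[OF endoR s(1)] .
    have TV: "T (R (s n)) \<in> V" for n using bop_in[OF T(1) RV] .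
    have Ty: "T y \<in> V" using bop_in[OF T(1) s(3)] .
    have "(\<lambda>n. N (s n - x) + N (T (R (s n)) - T y)) \<longlonglongrightarrow> 0 + 0"
      by (intro tendsto_add s(4) bop_lim[OF T(1) RV s(3) s(5)])
    then have lim: "(\<lambda>n. N (s n - x) + N (T (R (s n)) - T y)) \<longlonglongrightarrow> 0" by simp
    have "N ((s n - T (R (s n))) - (x - T y)) \<le> N (s n - x) + N (T (R (s n)) - T y)" for n
    proof -
      have "(s n - T (R (s n))) - (x - T y) = (s n - x) - (T (R (s n)) - T y)" by simp
      then show ?thesis using N_diff[OF V_diff[OF s(1) s(2)] V_diff[OF TV Ty], of n n] by metis
    qed
    then have "(\<lambda>n. N ((s n - T (R (s n))) - (x - T y))) \<longlonglongrightarrow> 0"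
      using lim N_nonneg[OF V_diff[OF V_diff[OF s(1) TV] V_diff[OF s(2) Ty]]]
      by (intro Lim_null_comparison[OF always_eventually lim]) auto
    moreover have "s n - T (R (s n)) \<in> cspan B" for n using R[OF s(1)] by (simp add: rel_def)
    ultimately have 1: "x - T y \<in> cspan B"
      using finite_span_closed[OF BV, of "\<lambda>n. s n - T (R (s n))" "x - T y"] V_diff[OF s(2) Ty] by blast
    have "J (R (s n)) = 0" for n using R[OF s(1)] by (simp add: rel_def)
    then have "(\<lambda>n. N (0 - J y)) \<longlonglongrightarrow> 0" using bop_lim[OF J(1) RV s(3) s(5)] by simp
    then have "N (- J y) = 0" by (simp add: LIMSEQ_const_iff)
    then have "J y = 0" using N_minus N_eq_0 bop_in[OF J(1) s(3)] by simp
    then show "R x = y" using 1 s Req[of x y] by (simp add: rel_def)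
  qed
  have "finrank J"
    unfolding finrank_def by (rule qfin_mono[OF q(1) J(2)]) simp
  moreover have "J x = x - R (T x)" if x: "x \<in> V" for x
  proof -
    have Jx: "J x \<in> V" "T (J x) = 0" "J (J x) = J x" using J x by (auto simp: kern_def)
    have "rel (T x) (x - J x)"
      unfolding rel_def using x Jx V_diff bop_diff[OF J(1) x Jx(1)] bop_diff[OF T(1) x Jx(1)]
      by (simp add: complex_vector.span_zero)
    then have "R (T x) = x - J x" using Req bop_in[OF T(1) x] by blast
    then show ?thesis by simp
  qed
  ultimately have "finrank (\<lambda>x. x - R (T x))" by (rule finrank_cong)
  moreover have "finrank (\<lambda>x. x - T (R x))"
    by (rule finrankI[OF BV(1)]) (use R in \<open>simp add: rel_def\<close>)
  ultimately show ?thesis using bR by blast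
qed

lemma approximable_of_finrank_diff:
  "bop S \<Longrightarrow> bop T \<Longrightarrow> finrank (\<lambda>x. S x - T x) \<Longrightarrow> approximable (\<lambda>x. S x - T x)"
  by (intro approximable_finrank bop_subtract)

text \<open>A regularizer of \<open>T\<close> is also one of \<open>T + K\<close>.\<close>

lemma fredholm_perturb:
  assumes T: "bop T" "alg_fredholm V T" and K: "approximable K"
  shows "alg_fredholm V (\<lambda>x. T x + K x)" "index V (\<lambda>x. T x + K x) = index V T"
proof -
  obtain R where R: "bop R" "finrank (\<lambda>x. x - R (T x))" "finrank (\<lambda>x. x - T (R x))"
    using regularizer_exists[OF T] by blast
  have bK: "bop K" using K by (rule approximable_bop)
  have A1: "approximable (\<lambda>x. x - R (T x))" "approximable (\<lambda>x. x - T (R x))"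
    using approximable_of_finrank_diff[OF bop_ident bop_comp[OF R(1) T(1)] R(2)]
      approximable_of_finrank_diff[OF bop_ident bop_comp[OF T(1) R(1)] R(3)] by auto
  have b: "bop (\<lambda>x. T x + K x)" using T(1) bK by (rule bop_plus)
  have "approximable (\<lambda>x. (x - R (T x)) - R (K x))"
    by (rule approximable_diff[OF A1(1) approximable_comp_left[OF K R(1)]])
  then have A2: "approximable (\<lambda>x. x - R (T x + K x))"
    by (rule approximable_cong) (simp add: bop_add[OF R(1)] bop_in[OF T(1)] bop_in[OF bK])
  have "approximable (\<lambda>x. (x - T (R x)) - K (R x))"
    by (rule approximable_diff[OF A1(2) approximable_comp_right[OF K R(1)]])
  then have A3: "approximable (\<lambda>x. x - (T (R x) + K (R x)))" by (simp add: algebra_simps)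
  show "alg_fredholm V (\<lambda>x. T x + K x)" "index V (\<lambda>x. T x + K x) = index V T"
    using fredholm_of_regularizer[OF b R(1) A2 A3] fredholm_of_regularizer[OF T(1) R(1) A1] by auto
qed

end

section \<open>The space of p-summable sequences\<close>

lemma powr_convex_nonneg:
  fixes x y u v p :: real
  assumes "1 \<le> p" "0 \<le> x" "0 \<le> y" "0 < u" "0 < v" "u + v = 1"
  shows "(u * x + v * y) powr p \<le> u * x powr p + v * y powr p"
proof -
  have *: "(w * z) powr p \<le> w * z powr p" if "0 \<le> z" "0 < w" "w \<le> 1" for w z :: real
  proof -
    have "w powr p \<le> w powr 1" using that assms(1) by (intro powr_mono') auto
    then show ?thesis using that by (simp add: powr_mult mult_right_mono)
  qed
  consider "x = 0" | "y = 0" | "x > 0" "y > 0" using assms by fastforce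
  then show ?thesis
  proof cases
    case 1 then show ?thesis using *[of y v] assms by simp
  next
    case 2 then show ?thesis using *[of x u] assms by simp
  next
    case 3
    have "(u *\<^sub>R x + v *\<^sub>R y) powr p \<le> u * x powr p + v * y powr p"
      using powr_convex[OF assms(1)] 3 assms(4-6) unfolding convex_on_def by fastforce
    then show ?thesis by simp
  qed
qed

text \<open>Convexity of the power function, applied to \<open>a / A\<close> and \<open>b / B\<close> with weights proportional to \<open>A\<close>
and \<open>B\<close>.\<close>

lemma Minkowski_finite:
  fixes a b :: "'i \<Rightarrow> real"
  assumes p: "1 \<le> p" and F: "finite F" and ab: "\<And>i. i \<in> F \<Longrightarrow> 0 \<le> a i" "\<And>i. i \<in> F \<Longrightarrow> 0 \<le> b i"
    and AB: "0 < A" "0 < B" "(\<Sum>i\<in>F. a i powr p) \<le> A powr p" "(\<Sum>i\<in>F. b i powr p) \<le> B powr p"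
  shows "(\<Sum>i\<in>F. (a i + b i) powr p) \<le> (A + B) powr p"
proof -
  let ?u = "A / (A + B)" and ?v = "B / (A + B)"
  have uv: "?u > 0" "?v > 0" "?u + ?v = 1" using AB by (auto simp: add_divide_distrib[symmetric])
  have "(a i + b i) powr p \<le>
      (A + B) powr p * (?u * (a i powr p / A powr p) + ?v * (b i powr p / B powr p))" if i: "i \<in> F" for i
  proof -
    have "a i + b i = (A + B) * (?u * (a i / A) + ?v * (b i / B))"
      using AB uv(1,2) by (simp add: distrib_left)
    then have "(a i + b i) powr p = (A + B) powr p * (?u * (a i / A) + ?v * (b i / B)) powr p"
      using AB ab[OF i] by (simp add: powr_mult)
    also have "\<dots> \<le> (A + B) powr p * (?u * (a i / A) powr p + ?v * (b i / B) powr p)"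
      using powr_convex_nonneg[OF p _ _ uv, of "a i / A" "b i / B"] AB ab[OF i]
      by (intro mult_left_mono) auto
    finally show ?thesis using AB ab[OF i] by (simp add: powr_divide)
  qed
  then have "(\<Sum>i\<in>F. (a i + b i) powr p) \<le>
      (\<Sum>i\<in>F. (A + B) powr p * (?u * (a i powr p / A powr p) + ?v * (b i powr p / B powr p)))"
    by (rule sum_mono)
  also have "\<dots> = (A + B) powr p * (?u * ((\<Sum>i\<in>F. a i powr p) / A powr p) + ?v * ((\<Sum>i\<in>F. b i powr p) / B powr p))"
    by (simp add: sum_distrib_left[symmetric] sum_divide_distrib[symmetric] sum.distrib del: times_divide_eq_left times_divide_eq_right)
  also have "\<dots> \<le> (A + B) powr p * (?u * 1 + ?v * 1)"
    using AB uv by (intro mult_left_mono add_mono) (auto simp: divide_le_eq)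
  finally show ?thesis using uv(3) by simp
qed

lemma lp_normI:
  assumes p: "1 < p" and r: "0 \<le> r" and le: "\<And>F. finite F \<Longrightarrow> (\<Sum>n\<in>F. norm (x n) powr p) \<le> r powr p"
  shows "x \<in> lp p" "lp_norm p x \<le> r"
proof -
  have s: "(\<lambda>n. norm (x n) powr p) summable_on UNIV"
    by (rule nonneg_bdd_above_summable_on) (use le in \<open>auto intro!: bdd_aboveI[of _ "r powr p"]\<close>)
  then show "x \<in> lp p" by (simp add: lp_def)
  have "(\<Sum>\<^sub>\<infinity>n. norm (x n) powr p) \<le> r powr p" by (rule infsum_le_finite_sums[OF s le])
  then have "lp_norm p x \<le> (r powr p) powr (1 / p)"
    unfolding lp_norm_def using p by (intro powr_mono2) (auto intro: infsum_nonneg)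
  then show "lp_norm p x \<le> r" using p r by (simp add: powr_powr)
qed

lemma lp_norm_nonneg: "0 \<le> lp_norm p x" by (simp add: lp_norm_def)

lemma lp_norm_powr: "1 < p \<Longrightarrow> lp_norm p x powr p = (\<Sum>\<^sub>\<infinity>n. norm (x n) powr p)"
  by (simp add: lp_norm_def powr_powr infsum_nonneg)

lemma sum_le_lp_norm:
  assumes "1 < p" "x \<in> lp p" "finite F"
  shows "(\<Sum>n\<in>F. norm (x n) powr p) \<le> lp_norm p x powr p"
  unfolding lp_norm_powr[OF assms(1)]
  by (rule finite_sum_le_infsum) (use assms in \<open>auto simp: lp_def\<close>)

lemma norm_le_lp_norm:
  assumes "1 < p" "x \<in> lp p" shows "norm (x n) \<le> lp_norm p x"
proof -
  have "norm (x n) powr p \<le> lp_norm p x powr p" using sum_le_lp_norm[OF assms, of "{n}"] by simp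
  then show ?thesis using assms(1) powr_less_mono2[of p "lp_norm p x" "norm (x n)"] lp_norm_nonneg
    by (meson not_le order.strict_trans zero_less_one)
qed

text \<open>The common source of the bounds for shifts, multiplications and single diagonals.\<close>

lemma lp_dominated:
  fixes x :: "int \<Rightarrow> 'a::complex_banach" and y :: "int \<Rightarrow> 'b::complex_banach"
  assumes p: "1 < p" and x: "x \<in> lp p" and c: "0 \<le> c" and g: "inj g"
    and le: "\<And>n. norm (y n) \<le> c * norm (x (g n))"
  shows "y \<in> lp p" "lp_norm p y \<le> c * lp_norm p x"
proof -
  have *: "(\<Sum>n\<in>F. norm (y n) powr p) \<le> (c * lp_norm p x) powr p" if F: "finite F" for F
  proof -
    have "(\<Sum>n\<in>F. norm (y n) powr p) \<le> (\<Sum>n\<in>F. c powr p * norm (x (g n)) powr p)"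
    proof (rule sum_mono)
      fix n assume "n \<in> F"
      have "norm (y n) powr p \<le> (c * norm (x (g n))) powr p"
        using le p by (intro powr_mono2) auto
      then show "norm (y n) powr p \<le> c powr p * norm (x (g n)) powr p" using c by (simp add: powr_mult)
    qed
    also have "\<dots> = c powr p * (\<Sum>m\<in>g ` F. norm (x m) powr p)"
      using g by (simp add: sum_distrib_left sum.reindex inj_on_subset)
    also have "\<dots> \<le> c powr p * lp_norm p x powr p"
      using sum_le_lp_norm[OF p x] F by (intro mult_left_mono) auto
    also have "\<dots> = (c * lp_norm p x) powr p" using c lp_norm_nonneg by (simp add: powr_mult)
    finally show ?thesis .
  qed
  show "y \<in> lp p" "lp_norm p y \<le> c * lp_norm p x"
    by (rule lp_normI[OF p _ *]; simp add: c lp_norm_nonneg)+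
qed

lemma lp_add:
  assumes p: "1 < p" and x: "x \<in> lp p" and y: "y \<in> lp p"
  shows "x + y \<in> lp p" "lp_norm p (x + y) \<le> lp_norm p x + lp_norm p y"
proof -
  have *: "x + y \<in> lp p \<and> lp_norm p (x + y) \<le> (lp_norm p x + e) + (lp_norm p y + e)" if e: "e > 0" for e
  proof -
    \<comment> \<open>The slack avoids division by the norm of the zero sequence.\<close>
    let ?A = "lp_norm p x + e" and ?B = "lp_norm p y + e"
    have AB: "0 < ?A" "0 < ?B" using e lp_norm_nonneg[of p x] lp_norm_nonneg[of p y] by linarith+
    have "(\<Sum>n\<in>F. norm ((x + y) n) powr p) \<le> (?A + ?B) powr p" if F: "finite F" for F
    proof -
      have "(\<Sum>n\<in>F. norm ((x + y) n) powr p) \<le> (\<Sum>n\<in>F. (norm (x n) + norm (y n)) powr p)"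
        using p by (intro sum_mono powr_mono2) (auto simp: norm_triangle_ineq)
      also have "\<dots> \<le> (?A + ?B) powr p"
      proof (rule Minkowski_finite)
        have "(\<Sum>n\<in>F. norm (x n) powr p) \<le> lp_norm p x powr p" by (rule sum_le_lp_norm[OF p x F])
        also have "\<dots> \<le> ?A powr p" using e p lp_norm_nonneg by (intro powr_mono2) auto
        finally show "(\<Sum>n\<in>F. norm (x n) powr p) \<le> ?A powr p" .
        have "(\<Sum>n\<in>F. norm (y n) powr p) \<le> lp_norm p y powr p" by (rule sum_le_lp_norm[OF p y F])
        also have "\<dots> \<le> ?B powr p" using e p lp_norm_nonneg by (intro powr_mono2) auto
        finally show "(\<Sum>n\<in>F. norm (y n) powr p) \<le> ?B powr p" .
      qed (use p F AB in auto)
      finally show ?thesis .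
    qed
    then show ?thesis using lp_normI[OF p, of "?A + ?B" "x + y"] AB by auto
  qed
  then show "x + y \<in> lp p" using zero_less_one by blast
  show "lp_norm p (x + y) \<le> lp_norm p x + lp_norm p y"
  proof (rule field_le_epsilon)
    fix e :: real assume "e > 0"
    then show "lp_norm p (x + y) \<le> lp_norm p x + lp_norm p y + e" using *[of "e / 2"] by simp
  qed
qed

lemma lp_scale:
  assumes p: "1 < p" and x: "x \<in> lp p"
  shows "c *\<^sub>C x \<in> lp p" "lp_norm p (c *\<^sub>C x) = cmod c * lp_norm p x"
proof -
  have le: "d *\<^sub>C y \<in> lp p \<and> lp_norm p (d *\<^sub>C y) \<le> cmod d * lp_norm p y" if "y \<in> lp p" for d and y :: "int \<Rightarrow> 'a"
    using lp_dominated[OF p that, of "cmod d" "\<lambda>n. n" "d *\<^sub>C y"] by (simp add: scaleC_fun_def norm_scaleC)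
  then show 1: "c *\<^sub>C x \<in> lp p" using x by blast
  show "lp_norm p (c *\<^sub>C x) = cmod c * lp_norm p x"
  proof (cases "c = 0")
    case True
    then show ?thesis using le[OF x, of 0] lp_norm_nonneg[of p "c *\<^sub>C x"] by simp
  next
    case False
    have "lp_norm p (inverse c *\<^sub>C (c *\<^sub>C x)) \<le> cmod (inverse c) * lp_norm p (c *\<^sub>C x)" using le[OF 1] by blast
    then have "cmod c * lp_norm p x \<le> lp_norm p (c *\<^sub>C x)"
      using False unfolding norm_inverse by (simp add: scaleC_scaleC scaleC_one field_simps)
    then show ?thesis using le[OF x, of c] by simp
  qed
qed

lemma lp_subspace: "1 < p \<Longrightarrow> csubspace (lp p)"
proof (rule complex_vector.subspaceI)
  assume p: "1 < p"
  show "0 \<in> lp p" by (simp add: lp_def)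
  show "x + y \<in> lp p" if "x \<in> lp p" "y \<in> lp p" for x y :: "int \<Rightarrow> 'a" by (rule lp_add(1)[OF p that])
  show "c *\<^sub>C x \<in> lp p" if "x \<in> lp p" for c and x :: "int \<Rightarrow> 'a" by (rule lp_scale(1)[OF p that])
qed

lemma lp_complete:
  fixes s :: "nat \<Rightarrow> int \<Rightarrow> 'a::complex_banach"
  assumes p: "1 < p" and s: "\<And>n. s n \<in> lp p"
    and C: "\<And>e. e > 0 \<Longrightarrow> \<exists>M. \<forall>m\<ge>M. \<forall>n\<ge>M. lp_norm p (s m - s n) < e"
  shows "\<exists>l\<in>lp p. (\<lambda>n. lp_norm p (s n - l)) \<longlonglongrightarrow> 0"
proof -
  have d: "s m - s n \<in> lp p" for m n using complex_vector.subspace_diff[OF lp_subspace[OF p] s s] .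
  have "Cauchy (\<lambda>n. s n k)" for k
  proof (rule metric_CauchyI)
    fix e :: real assume "e > 0"
    then obtain M where M: "\<And>m n. m \<ge> M \<Longrightarrow> n \<ge> M \<Longrightarrow> lp_norm p (s m - s n) < e" using C by metis
    have "dist (s m k) (s n k) < e" if "m \<ge> M" "n \<ge> M" for m n
      using norm_le_lp_norm[OF p d, of m n k] M[OF that] by (simp add: dist_norm)
    then show "\<exists>M. \<forall>m\<ge>M. \<forall>n\<ge>M. dist (s m k) (s n k) < e" by blast
  qed
  then have "\<exists>l. (\<lambda>n. s n k) \<longlonglongrightarrow> l" for k by (simp add: Cauchy_convergent_iff convergent_def)
  then obtain l where l: "\<And>k. (\<lambda>n. s n k) \<longlonglongrightarrow> l k" by metis
  have near: "\<exists>M. \<forall>m\<ge>M. s m - l \<in> lp p \<and> lp_norm p (s m - l) \<le> e" if e: "e > 0" for e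
  proof -
    obtain M where M: "\<And>m n. m \<ge> M \<Longrightarrow> n \<ge> M \<Longrightarrow> lp_norm p (s m - s n) < e" using C e by metis
    have "s m - l \<in> lp p \<and> lp_norm p (s m - l) \<le> e" if m: "m \<ge> M" for m
    proof -
      have "(\<Sum>k\<in>F. norm ((s m - l) k) powr p) \<le> e powr p" if F: "finite F" for F
      proof (rule LIMSEQ_le_const2)
        show "(\<lambda>n. \<Sum>k\<in>F. norm ((s m - s n) k) powr p) \<longlonglongrightarrow> (\<Sum>k\<in>F. norm ((s m - l) k) powr p)"
          by (simp only: fun_diff_def, intro tendsto_sum tendsto_powr' tendsto_norm tendsto_diff tendsto_const l) (use p in auto)
        have "(\<Sum>k\<in>F. norm ((s m - s n) k) powr p) \<le> e powr p" if "n \<ge> M" for n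
        proof -
          have "(\<Sum>k\<in>F. norm ((s m - s n) k) powr p) \<le> lp_norm p (s m - s n) powr p"
            by (rule sum_le_lp_norm[OF p d F])
          also have "\<dots> \<le> e powr p"
            using M[OF m that] p lp_norm_nonneg by (intro powr_mono2) auto
          finally show ?thesis .
        qed
        then show "\<exists>N. \<forall>n\<ge>N. (\<Sum>k\<in>F. norm ((s m - s n) k) powr p) \<le> e powr p" by blast
      qed
      then show ?thesis using lp_normI[OF p, of e "s m - l"] e by auto
    qed
    then show ?thesis by blast
  qed
  obtain M where "s M - l \<in> lp p" using near[of 1] by auto
  then have "s M - (s M - l) \<in> lp p" using complex_vector.subspace_diff[OF lp_subspace[OF p] s] by blast
  then have "l \<in> lp p" by simp
  moreover have "(\<lambda>n. lp_norm p (s n - l)) \<longlonglongrightarrow> 0"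
  proof (rule LIMSEQ_I)
    fix r :: real assume "r > 0"
    then obtain M where "\<forall>m\<ge>M. lp_norm p (s m - l) \<le> r / 2" using near[of "r / 2"] by auto
    then have "norm (lp_norm p (s n - l) - 0) < r" if "n \<ge> M" for n
      using \<open>r > 0\<close> lp_norm_nonneg[of p "s n - l"] that by fastforce
    then show "\<exists>no. \<forall>n\<ge>no. norm (lp_norm p (s n - l) - 0) < r" by blast
  qed
  ultimately show ?thesis by blast
qed

lemma banach_carrier_lp: "1 < p \<Longrightarrow> banach_carrier (lp p :: (int \<Rightarrow> 'a::complex_banach) set) (lp_norm p)"
proof
  assume p: "1 < p"
  show "csubspace (lp p :: (int \<Rightarrow> 'a) set)" by (rule lp_subspace[OF p])
  show "0 \<le> lp_norm p x" for x :: "int \<Rightarrow> 'a" by (rule lp_norm_nonneg)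
  show "x = 0" if "x \<in> lp p" "lp_norm p x = 0" for x :: "int \<Rightarrow> 'a"
    using norm_le_lp_norm[OF p that(1)] that(2) by (simp add: fun_eq_iff)
  show "lp_norm p (x + y) \<le> lp_norm p x + lp_norm p y" if "x \<in> lp p" "y \<in> lp p" for x y :: "int \<Rightarrow> 'a"
    by (rule lp_add(2)[OF p that])
  show "lp_norm p (c *\<^sub>C x) = cmod c * lp_norm p x" if "x \<in> lp p" for c and x :: "int \<Rightarrow> 'a"
    by (rule lp_scale(2)[OF p that])
  show "\<exists>l\<in>lp p. (\<lambda>n. lp_norm p (s n - l)) \<longlonglongrightarrow> 0"
    if "\<And>n. s n \<in> lp p" "\<And>e. e > 0 \<Longrightarrow> \<exists>M. \<forall>m\<ge>M. \<forall>n\<ge>M. lp_norm p (s m - s n) < e"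
    for s :: "nat \<Rightarrow> int \<Rightarrow> 'a" by (rule lp_complete[OF p that])
qed

definition mul :: "(int \<Rightarrow> real) \<Rightarrow> 'a::complex_banach seq_op" where
  "mul \<theta> x = (\<lambda>k. \<theta> k *\<^sub>R x k)"

locale lp_space =
  fixes p :: real and ty :: "'a::complex_banach itself"
  assumes p: "1 < p" and sap: "symmetric_approximation_property TYPE('a)"
begin

sublocale banach_carrier "lp p :: (int \<Rightarrow> 'a) set" "lp_norm p"
  by (rule banach_carrier_lp[OF p])

lemma mul_bound:
  fixes x :: "int \<Rightarrow> 'a"
  assumes x: "x \<in> lp p" and c: "\<And>k. \<bar>\<theta> k\<bar> \<le> c"
  shows "mul \<theta> x \<in> lp p" "lp_norm p (mul \<theta> x) \<le> c * lp_norm p x"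
proof -
  have "0 \<le> c" using c[of 0] by simp
  then show "mul \<theta> x \<in> lp p" "lp_norm p (mul \<theta> x) \<le> c * lp_norm p x"
    using lp_dominated[OF p x, of c "\<lambda>n. n" "mul \<theta> x"] c by (simp_all add: mul_def mult_right_mono)
qed

lemma mul_linear:
  "mul \<theta> (x + y) = mul \<theta> x + mul \<theta> y" "mul \<theta> (x - y) = mul \<theta> x - mul \<theta> y"
  "mul \<theta> (c *\<^sub>C x) = c *\<^sub>C mul \<theta> x"
  by (simp_all add: mul_def fun_eq_iff scaleC_fun_def scaleC_add_right
      complex_vector.scale_right_diff_distrib scaleR_scaleC scaleC_scaleC mult.commute)

lemma bop_mul: "(\<And>k. \<bar>\<theta> k\<bar> \<le> c) \<Longrightarrow> bop (mul \<theta>)" and opb_mul: "(\<And>k. \<bar>\<theta> k\<bar> \<le> c) \<Longrightarrow> opb (mul \<theta>) c"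
proof -
  assume c: "\<And>k. \<bar>\<theta> k\<bar> \<le> c"
  show o: "opb (mul \<theta>) c" unfolding opb_def using mul_bound(2)[of _ \<theta> c] c by blast
  have "endo (lp p :: (int \<Rightarrow> 'a) set) (mul \<theta>)"
    by (rule endoI) (simp_all add: mul_bound(1)[of _ \<theta> c] c mul_linear)
  then show "bop (mul \<theta>)" using o unfolding bop_def by blast
qed

lemma shift_bound:
  fixes x :: "int \<Rightarrow> 'a"
  assumes x: "x \<in> lp p" shows "shift h x \<in> lp p" "lp_norm p (shift h x) \<le> lp_norm p x"
  using lp_dominated[OF p x, of 1 "\<lambda>n. n - h" "shift h x"] by (simp_all add: shift_def inj_on_def)

lemma shift_shift: "shift h (shift k x) = shift (h + k) x"
  by (simp add: shift_def algebra_simps)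

lemma shift_0: "shift 0 x = x" by (simp add: shift_def)

lemma shift_linear:
  "shift h (x + y) = shift h x + shift h y" "shift h (x - y) = shift h x - shift h y"
  "shift h (c *\<^sub>C x) = c *\<^sub>C shift h x"
  by (simp_all add: shift_def fun_eq_iff scaleC_fun_def)

lemma shift_norm: "x \<in> lp p \<Longrightarrow> lp_norm p (shift h x) = lp_norm p (x :: int \<Rightarrow> 'a)"
  using shift_bound(2)[of x h] shift_bound(2)[OF shift_bound(1), of x "-h" h]
  by (simp add: shift_shift shift_0)

lemma bop_shift: "bop (shift h)"
proof -
  have "opb (shift h) 1" by (simp add: opb_def shift_norm)
  moreover have "endo (lp p :: (int \<Rightarrow> 'a) set) (shift h)"
    by (rule endoI) (simp_all add: shift_bound shift_linear)
  ultimately show ?thesis unfolding bop_def by blast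
qed

lemma trunc_conv_mul: "trunc n = mul (\<lambda>k. if \<bar>k\<bar> \<le> int n then 1 else 0)"
  by (auto simp: trunc_def mul_def fun_eq_iff)

lemma bop_trunc: "bop (trunc n)" unfolding trunc_conv_mul by (rule bop_mul[of _ 1]) simp
lemma opb_trunc: "opb (trunc n) 1" unfolding trunc_conv_mul by (rule opb_mul) simp
lemma trunc_in: "x \<in> lp p \<Longrightarrow> trunc n (x :: int \<Rightarrow> 'a) \<in> lp p" by (rule bop_in[OF bop_trunc])

lemma trunc_lim:
  fixes x :: "int \<Rightarrow> 'a"
  assumes x: "x \<in> lp p" and e: "e > 0"
  shows "\<exists>n0. \<forall>n\<ge>n0. lp_norm p (x - trunc n x) < e"
proof -
  have s: "(\<lambda>n. norm (x n) powr p) summable_on UNIV" using x by (simp add: lp_def)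
  have ep: "(e / 2) powr p > 0" using e by simp
  obtain F where F: "finite F" "dist (\<Sum>n\<in>F. norm (x n) powr p) (\<Sum>\<^sub>\<infinity>n. norm (x n) powr p) \<le> (e / 2) powr p"
    using infsum_finite_approximation[OF s ep] by auto
  obtain n0 :: nat where n0: "\<And>k. k \<in> F \<Longrightarrow> \<bar>k\<bar> \<le> int n0"
  proof
    show "\<bar>k\<bar> \<le> int (\<Sum>j\<in>F. nat \<bar>j\<bar>)" if "k \<in> F" for k
      using member_le_sum[of k F "\<lambda>j. nat \<bar>j\<bar>"] F that by linarith
  qed
  have "lp_norm p (x - trunc n x) < e" if n: "n \<ge> n0" for n
  proof -
    have "(\<Sum>k\<in>G. norm ((x - trunc n x) k) powr p) \<le> (e / 2) powr p" if G: "finite G" for G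
    proof -
      have "(\<Sum>k\<in>G. norm ((x - trunc n x) k) powr p) = (\<Sum>k\<in>G - F. norm ((x - trunc n x) k) powr p)"
        using G n0 n by (intro sum.mono_neutral_right) (force simp: trunc_def)+
      also have "\<dots> \<le> (\<Sum>k\<in>G - F. norm (x k) powr p)"
        using p by (intro sum_mono) (auto simp: trunc_def)
      also have "\<dots> = (\<Sum>k\<in>(G - F) \<union> F. norm (x k) powr p) - (\<Sum>k\<in>F. norm (x k) powr p)"
        using G F by (subst sum.union_disjoint) auto
      also have "\<dots> \<le> (\<Sum>\<^sub>\<infinity>n. norm (x n) powr p) - (\<Sum>k\<in>F. norm (x k) powr p)"
        using finite_sum_le_infsum[OF s, of "(G - F) \<union> F"] G F by simp
      also have "\<dots> \<le> (e / 2) powr p" using F(2) by (simp add: dist_real_def)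
      finally show ?thesis .
    qed
    then have "lp_norm p (x - trunc n x) \<le> e / 2" using lp_normI(2)[OF p, of "e / 2" "x - trunc n x"] e by simp
    then show ?thesis using e by simp
  qed
  then show ?thesis by blast
qed

lemma single_in: "single k a \<in> lp p" and single_norm: "lp_norm p (single k a) \<le> norm a" for a :: 'a
proof -
  have "(\<Sum>n\<in>F. norm (single k a n) powr p) \<le> norm a powr p" if "finite F" for F
  proof -
    have "(\<Sum>n\<in>F. norm (single k a n) powr p) = (\<Sum>n\<in>F. if n = k then norm a powr p else 0)"
      using p by (intro sum.cong) (auto simp: single_def)
    then show ?thesis using that by simp
  qed
  then show "single k a \<in> lp p" "lp_norm p (single k a) \<le> norm a"
    using lp_normI[OF p, of "norm a" "single k a"] by auto
qed

lemma single_linear: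
  "single k (a + b) = single k a + single k b" "single k (a - b) = single k a - single k b"
  "single k (c *\<^sub>C a) = c *\<^sub>C single k a"
  by (auto simp: single_def fun_eq_iff scaleC_fun_def)

lemma sum_fun_at: "sum f I j = (\<Sum>i\<in>I. f i j)"
  by (induction I rule: infinite_finite_induct) simp_all

lemma trunc_as_sum: "trunc n x = (\<Sum>k\<in>{- int n..int n}. single k (x k))"
proof
  fix j
  have "(\<Sum>k\<in>{- int n..int n}. single k (x k)) j = (\<Sum>k\<in>{- int n..int n}. if j = k then x k else 0)"
    by (simp add: sum_fun_at single_def)
  then show "trunc n x j = (\<Sum>k\<in>{- int n..int n}. single k (x k)) j" by (auto simp: trunc_def)
qed

lemma single_in_span:
  fixes v :: 'a
  shows "v \<in> cspan S \<Longrightarrow> single k v \<in> cspan (single k ` S)"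
proof (induction rule: complex_vector.span_induct_alt)
  case base
  have "single k (0::'a) = 0" by (simp add: single_def fun_eq_iff)
  then show ?case using complex_vector.span_zero[of "single k ` S"] by (simp only:)
next
  case (step c x y)
  then show ?case
    unfolding single_linear
    by (intro complex_vector.span_add[OF complex_vector.span_scale[OF complex_vector.span_base]] imageI)
qed

lemma coordinate_op:
  fixes K :: "'a \<Rightarrow> 'a"
  assumes K: "bounded_clinear K" and c: "\<And>v. norm (K v) \<le> c * norm v"
  shows "bop (\<lambda>x. single i (K (x j)))" "opb (\<lambda>x. single i (K (x j))) \<bar>c\<bar>"
proof -
  have lin: "K (v + w) = K v + K w" "K (a *\<^sub>C v) = a *\<^sub>C K v" for v w a
    using K unfolding bounded_clinear_def by (auto simp: linear_simps)
  show o: "opb (\<lambda>x. single i (K (x j))) \<bar>c\<bar>"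
    unfolding opb_def
  proof
    fix x :: "int \<Rightarrow> 'a" assume x: "x \<in> lp p"
    have "lp_norm p (single i (K (x j))) \<le> c * norm (x j)" using single_norm c order_trans by blast
    also have "\<dots> \<le> \<bar>c\<bar> * norm (x j)" by (intro mult_right_mono) auto
    also have "\<dots> \<le> \<bar>c\<bar> * lp_norm p x" using norm_le_lp_norm[OF p x] by (intro mult_left_mono) auto
    finally show "lp_norm p (single i (K (x j))) \<le> \<bar>c\<bar> * lp_norm p x" .
  qed
  have "endo (lp p) (\<lambda>x. single i (K (x j)))"
    by (rule endoI) (simp_all add: single_in lin single_linear scaleC_fun_def)
  then show "bop (\<lambda>x. single i (K (x j)))" using o unfolding bop_def by blast
qed

lemma coordinate_op_finrank:
  fixes F :: "'a \<Rightarrow> 'a"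
  assumes "finite_dimensional (range F)" shows "finrank (\<lambda>x. single i (F (x j)))"
proof -
  obtain S where "finite S" "range F \<subseteq> cspan S" using assms unfolding finite_dimensional_def by blast
  then show ?thesis by (intro finrankI[of "single i ` S"] single_in_span) auto
qed


end

text \<open>From here on sums of sequences are treated as vectors; evaluating them pointwise would hide the
additivity of operators.\<close>

declare plus_fun_apply [simp del] zero_fun_apply [simp del] minus_apply [simp del] uminus_apply [simp del]

context lp_space
begin

lemma bop_finrank_sum:
  "(\<And>i. i \<in> I \<Longrightarrow> bop (f i) \<and> finrank (f i)) \<Longrightarrow>
    bop (\<lambda>x. \<Sum>i\<in>I. f i x) \<and> finrank (\<lambda>x. \<Sum>i\<in>I. f i x)"
proof (induction I rule: infinite_finite_induct)
  case (insert i I)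
  then show ?case
    using bop_plus[of "f i" "\<lambda>x. \<Sum>i\<in>I. f i x"] finrank_plus[of "f i" "\<lambda>x. \<Sum>i\<in>I. f i x"]
    unfolding sum.insert[OF insert(1,2)] by blast
qed (auto intro!: bop_const_0 finrankI[of "{}"] complex_vector.span_zero)

lemma obtain_approximate_identity:
  obtains Pr :: "nat \<Rightarrow> 'a \<Rightarrow> 'a" where
    "\<And>N. bounded_clinear (Pr N)" "\<And>N. finite_dimensional (range (Pr N))"
    "\<And>x. (\<lambda>N. Pr N x) \<longlonglongrightarrow> x"
  using sap unfolding symmetric_approximation_property_def by blast

text \<open>Truncate to finitely many entries and approximate the identity on each of them.\<close>

lemma finrank_near_ident_lp:
  fixes X :: "(int \<Rightarrow> 'a) set"
  assumes X: "finite X" "X \<subseteq> lp p" and e: "e > 0"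
  shows "\<exists>F. bop F \<and> finrank F \<and> (\<forall>x\<in>X. lp_norm p (F x - x) < e)"
proof -
  obtain Pr :: "nat \<Rightarrow> 'a \<Rightarrow> 'a" where Pr: "\<And>N. bounded_clinear (Pr N)"
      "\<And>N. finite_dimensional (range (Pr N))" "\<And>x. (\<lambda>N. Pr N x) \<longlonglongrightarrow> x"
    by (rule obtain_approximate_identity) blast
  have "\<forall>x\<in>X. \<exists>n0. \<forall>n\<ge>n0. lp_norm p (x - trunc n x) < e / 2"
    using trunc_lim e X by (meson half_gt_zero subsetD)
  then obtain n0 where n0: "\<And>x n. x \<in> X \<Longrightarrow> n \<ge> n0 x \<Longrightarrow> lp_norm p (x - trunc n x) < e / 2" by metis
  define n where "n = (\<Sum>x\<in>X. n0 x)"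
  have n: "lp_norm p (x - trunc n x) < e / 2" if "x \<in> X" for x
    using n0[OF that] member_le_sum[of x X n0] X that by (simp add: n_def)
  let ?I = "{- int n..int n}"
  define d where "d = e / (2 * (card ?I + 1))"
  have d: "d > 0" using e by (simp add: d_def add_pos_nonneg)
  have "\<forall>x\<in>X. \<forall>k\<in>?I. \<forall>\<^sub>F N in sequentially. norm (Pr N (x k) - x k) < d"
    using tendstoD[OF Pr(3) d] by (simp add: dist_norm)
  then have "\<forall>\<^sub>F N in sequentially. \<forall>x\<in>X. \<forall>k\<in>?I. norm (Pr N (x k) - x k) < d"
    using X(1) by (simp add: eventually_ball_finite_distrib)
  then obtain M where "\<forall>x\<in>X. \<forall>k\<in>?I. norm (Pr M (x k) - x k) < d"
    unfolding eventually_sequentially by blast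
  then have M: "\<And>x k. x \<in> X \<Longrightarrow> k \<in> ?I \<Longrightarrow> norm (Pr M (x k) - x k) < d" by blast
  define F where "F = (\<lambda>x. \<Sum>k\<in>?I. single k (Pr M (x k)))"
  obtain c where c: "\<And>v. norm (Pr M v) \<le> c * norm v"
    using Pr(1)[of M] bounded_linear.bounded[of "Pr M"] unfolding bounded_clinear_def by (metis mult.commute)
  have "bop (\<lambda>x. single k (Pr M (x k))) \<and> finrank (\<lambda>x. single k (Pr M (x k)))" for k
    using coordinate_op(1)[OF Pr(1) c] coordinate_op_finrank[OF Pr(2)] by blast
  then have "bop F \<and> finrank F" unfolding F_def by (rule bop_finrank_sum)
  then have "bop F" "finrank F" by simp_all
  moreover have "lp_norm p (F x - x) < e" if x: "x \<in> X" for x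
  proof -
    have xV: "x \<in> lp p" using X x by blast
    have FV: "F x \<in> lp p" using bop_in[OF \<open>bop F\<close> xV] .
    have eq: "F x - trunc n x = (\<Sum>k\<in>?I. single k (Pr M (x k) - x k))"
      unfolding F_def trunc_as_sum single_linear by (rule sum_subtractf[symmetric])
    have "lp_norm p (F x - trunc n x) \<le> (\<Sum>k\<in>?I. lp_norm p (single k (Pr M (x k) - x k)))"
      unfolding eq by (rule N_sum) (rule single_in)
    also have "\<dots> \<le> (\<Sum>k\<in>?I. d)"
    proof (rule sum_mono)
      fix k assume "k \<in> ?I"
      then show "lp_norm p (single k (Pr M (x k) - x k)) \<le> d"
        using single_norm[of k "Pr M (x k) - x k"] M[OF x] by fastforce
    qed
    also have "\<dots> = card ?I * d" by simp
    also have "\<dots> \<le> e / 2" using e by (simp add: d_def field_simps del: card_atLeastAtMost_int)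
    finally have 1: "lp_norm p (F x - trunc n x) \<le> e / 2" .
    have "lp_norm p (F x - x) \<le> lp_norm p (F x - trunc n x) + lp_norm p (trunc n x - x)"
      by (rule N_diff_triangle[OF FV trunc_in[OF xV] xV])
    also have "lp_norm p (trunc n x - x) = lp_norm p (x - trunc n x)"
      by (rule N_minus_commute[OF trunc_in[OF xV] xV])
    finally show ?thesis using 1 n[OF x] by simp
  qed
  ultimately show ?thesis by blast
qed

sublocale banach_carrier_approx "lp p :: (int \<Rightarrow> 'a) set" "lp_norm p"
  by unfold_locales (rule finrank_near_ident_lp)

end

section \<open>Compact operators as norm limits\<close>

text \<open>The sets on which all norms are bounded by \<open>m\<close> are closed and cover the space, so one of them
contains a ball.\<close>

lemma uniform_boundedness:
  fixes T :: "nat \<Rightarrow> 'a::banach \<Rightarrow> 'b::real_normed_vector"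
  assumes T: "\<And>n. bounded_linear (T n)" and bd: "\<And>x. \<exists>B. \<forall>n. norm (T n x) \<le> B"
  shows "\<exists>C>0. \<forall>n x. norm (T n x) \<le> C * norm x"
proof -
  define A where "A m = {x. \<forall>n. norm (T n x) \<le> real m}" for m
  have closedA: "closed (A m)" for m
    unfolding A_def
    by (intro closed_Collect_all closed_Collect_le continuous_on_norm continuous_on_const
        linear_continuous_on T)
  have un: "\<Union>(range A) = UNIV"
  proof -
    have "\<exists>m. x \<in> A m" for x
    proof -
      obtain B where B: "\<forall>n. norm (T n x) \<le> B" using bd by blast
      obtain m where "B \<le> real m" using real_arch_simple by blast
      then have "x \<in> A m" unfolding A_def using B order_trans by blast
      then show ?thesis by blast
    qed
    then show ?thesis by blast
  qed
  have "\<exists>m. Met_TC.mtopology interior_of (A m) \<noteq> {}"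
  proof (rule ccontr)
    assume "\<not> ?thesis"
    then have "Met_TC.mtopology interior_of \<Union>(range A) = {}"
    proof (intro Met_TC.metric_Baire_category_alt)
      show "Met_TC.mcomplete TYPE('a)" unfolding mcomplete_iff_complete by (simp add: complete_UNIV)
    qed (use closedA in auto)
    then show False using interior_of_topspace[of "Met_TC.mtopology :: 'a topology"] unfolding un by simp
  qed
  then obtain m x0 r where r: "r > 0" "ball x0 r \<subseteq> A m"
    unfolding Met_TC.metric_interior_of by auto
  have "norm (T n x) \<le> (4 * real m / r + 1) * norm x" for n x
  proof (cases "x = 0")
    case True
    then show ?thesis using linear_simps(3)[OF T, of n] by simp
  next
    case False
    define t where "t = r / (2 * norm x)"
    have t: "t > 0" using r False by (simp add: t_def)
    have "norm (t *\<^sub>R x) < r" using r False by (simp add: t_def)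
    then have "x0 + t *\<^sub>R x \<in> A m" "x0 \<in> A m" using r by (auto simp: dist_norm)
    then have "norm (T n (x0 + t *\<^sub>R x)) \<le> m" "norm (T n x0) \<le> m" by (auto simp: A_def)
    moreover have "T n (x0 + t *\<^sub>R x) - T n x0 = t *\<^sub>R T n x"
      using T[of n] by (simp add: linear_simps)
    ultimately have "norm (t *\<^sub>R T n x) \<le> 2 * real m"
      using norm_triangle_ineq4[of "T n (x0 + t *\<^sub>R x)" "T n x0"] by simp
    then have "norm (T n x) \<le> 2 * real m / t" using t by (simp add: field_simps)
    also have "\<dots> = 4 * real m / r * norm x" using False r by (simp add: t_def)
    finally show ?thesis using norm_ge_zero[of x] unfolding distrib_right by linarith
  qed
  moreover have "4 * real m / r + 1 > 0" using r by (intro add_nonneg_pos) auto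
  ultimately show ?thesis by blast
qed

text \<open>A uniformly bounded sequence that converges to the identity at every point does so uniformly on
totally bounded sets.\<close>

lemma compact_operator_near_identity:
  fixes K :: "'a::complex_banach \<Rightarrow> 'a" and Pr :: "nat \<Rightarrow> 'a \<Rightarrow> 'a"
  assumes K: "compact_operator K" and Pr: "\<And>N. bounded_clinear (Pr N)" "\<And>x. (\<lambda>N. Pr N x) \<longlonglongrightarrow> x"
    and e: "e > 0"
  shows "\<exists>M. \<forall>v. norm (K v - Pr M (K v)) \<le> e * norm v"
proof -
  have PrL: "bounded_linear (Pr N)" for N using Pr(1) by (simp add: bounded_clinear_def)
  have KL: "bounded_linear K" using K by (simp add: compact_operator_def bounded_clinear_def)
  have "\<exists>B. \<forall>n. norm (Pr n x) \<le> B" for x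
  proof -
    have "Bseq (\<lambda>n. Pr n x)" using Pr(2) convergent_imp_Bseq convergentI by blast
    then show ?thesis unfolding Bseq_def by blast
  qed
  then obtain C where C: "C > 0" "\<And>n x. norm (Pr n x) \<le> C * norm x"
    using uniform_boundedness[of Pr, OF PrL] by blast
  define d where "d = e / (2 * (C + 1))"
  have C1: "C + 1 > 0" using C by simp
  have d: "d > 0" using e C1 by (simp add: d_def)
  have d2: "(C + 1) * d = e / 2"
    using C1 nonzero_mult_divide_mult_cancel_left[of "C + 1" e 2] by (simp add: d_def mult.commute)
  have "compact (closure (K ` cball 0 1))" using K by (simp add: compact_operator_def)
  then obtain Z where Z: "finite Z" "closure (K ` cball 0 1) \<subseteq> (\<Union>z\<in>Z. ball z d)"
    using d unfolding compact_eq_totally_bounded by blast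
  have "\<forall>z\<in>Z. \<forall>\<^sub>F N in sequentially. norm (Pr N z - z) < e / 2"
    using tendstoD[OF Pr(2), of "e / 2"] e by (simp add: dist_norm)
  then have "\<forall>\<^sub>F N in sequentially. \<forall>z\<in>Z. norm (Pr N z - z) < e / 2"
    using Z(1) by (simp add: eventually_ball_finite_distrib)
  then obtain M where M: "\<And>z. z \<in> Z \<Longrightarrow> norm (Pr M z - z) < e / 2" by (auto simp: eventually_sequentially)
  have unit: "norm (K v - Pr M (K v)) \<le> e" if "norm v \<le> 1" for v
  proof -
    have "K v \<in> closure (K ` cball 0 1)" using that closure_subset[of "K ` cball 0 1"] by auto
    then obtain z where z: "z \<in> Z" "norm (K v - z) < d" using Z(2) by (force simp: dist_norm norm_minus_commute)
    have "K v - Pr M (K v) = (K v - z) - Pr M (K v - z) - (Pr M z - z)"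
      using PrL[of M] by (simp add: linear_simps)
    also have "norm \<dots> \<le> norm (K v - z) + norm (Pr M (K v - z)) + norm (Pr M z - z)"
      using norm_triangle_ineq4[of "(K v - z) - Pr M (K v - z)" "Pr M z - z"]
        norm_triangle_ineq4[of "K v - z" "Pr M (K v - z)"] by linarith
    also have "norm (Pr M (K v - z)) \<le> C * norm (K v - z)" by (rule C(2))
    finally have "norm (K v - Pr M (K v)) \<le> (C + 1) * norm (K v - z) + norm (Pr M z - z)"
      by (simp add: algebra_simps)
    also have "\<dots> \<le> (C + 1) * d + e / 2"
      using z M[OF z(1)] C(1) by (intro add_mono mult_left_mono) auto
    finally show ?thesis using d2 by simp
  qed
  have "norm (K v - Pr M (K v)) \<le> e * norm v" for v
  proof (cases "v = 0")
    case True
    then show ?thesis using KL PrL[of M] by (simp add: linear_simps)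
  next
    case False
    let ?w = "inverse (norm v) *\<^sub>R v"
    have "K ?w - Pr M (K ?w) = inverse (norm v) *\<^sub>R (K v - Pr M (K v))"
      using KL PrL[of M] by (simp add: linear_simps scaleR_diff_right)
    then have "inverse (norm v) * norm (K v - Pr M (K v)) \<le> e" using unit[of ?w] False by simp
    then show ?thesis using False by (simp add: field_simps)
  qed
  then show ?thesis by blast
qed

context lp_space
begin

lemma coordinate_op_approximable:
  fixes K :: "'a \<Rightarrow> 'a"
  assumes K: "compact_operator K"
  shows "approximable (\<lambda>x. single i (K (x j)))"
proof (rule approximable_limit)
  have KL: "bounded_clinear K" using K by (simp add: compact_operator_def)
  obtain c where c: "\<And>v. norm (K v) \<le> c * norm v"
    using KL bounded_linear.bounded[of K] unfolding bounded_clinear_def by (metis mult.commute)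
  show "bop (\<lambda>x. single i (K (x j)))" by (rule coordinate_op(1)[OF KL c])
  obtain Pr :: "nat \<Rightarrow> 'a \<Rightarrow> 'a" where Pr: "\<And>N. bounded_clinear (Pr N)"
      "\<And>N. finite_dimensional (range (Pr N))" "\<And>x. (\<lambda>N. Pr N x) \<longlonglongrightarrow> x"
    by (rule obtain_approximate_identity) blast
  fix e :: real assume e: "e > 0"
  obtain M where M: "\<And>v. norm (K v - Pr M (K v)) \<le> e * norm v"
    using compact_operator_near_identity[OF K Pr(1,3) e] by blast
  have comp: "bounded_clinear (\<lambda>v. Pr M (K v))"
    using KL Pr(1)[of M] bounded_linear_compose unfolding bounded_clinear_def by auto
  have diff: "bounded_clinear (\<lambda>v. K v - Pr M (K v))"
    using KL comp bounded_linear_sub unfolding bounded_clinear_def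
    by (auto simp: complex_vector.scale_right_diff_distrib)
  obtain c' where c': "\<And>v. norm (Pr M (K v)) \<le> c' * norm v"
    using comp bounded_linear.bounded[of "\<lambda>v. Pr M (K v)"] unfolding bounded_clinear_def by (metis mult.commute)
  have "finite_dimensional (range (\<lambda>v. Pr M (K v)))"
    using Pr(2)[of M] unfolding finite_dimensional_def by blast
  then have "approximable (\<lambda>x. single i (Pr M (K (x j))))"
    using coordinate_op(1)[OF comp c'] coordinate_op_finrank[of "\<lambda>v. Pr M (K v)"]
    by (intro approximable_finrank) auto
  moreover have "opb (\<lambda>x. single i (K (x j)) - single i (Pr M (K (x j)))) e"
    using coordinate_op(2)[OF diff M, of i j] e by (simp add: single_linear)
  ultimately show "\<exists>L. approximable L \<and> opb (\<lambda>x. single i (K (x j)) - L x) e" by blast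
qed

section \<open>Operator norm, Fredholm property and index on the sequence space\<close>

lemma lp_op_iff: "(T :: 'a seq_op) \<in> lp_op p \<longleftrightarrow> bop T"
  by (auto simp: lp_op_def bop_def opb_def endo_def linear_on_def)

lemma opb_op_norm:
  assumes T: "bop T" shows "opb T (op_norm p T)"
proof -
  obtain C where C: "C > 0" "opb T C" by (rule bop_bound[OF T])
  have bdd: "bdd_above ((\<lambda>x. lp_norm p (T x)) ` {x \<in> lp p. lp_norm p x \<le> 1})"
  proof (rule bdd_aboveI)
    fix r assume "r \<in> (\<lambda>x. lp_norm p (T x)) ` {x \<in> lp p. lp_norm p x \<le> 1}"
    then obtain x where x: "x \<in> lp p" "lp_norm p x \<le> 1" "r = lp_norm p (T x)" by blast
    then have "r \<le> C * lp_norm p x" using opbD[OF C(2)] by simp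
    also have "\<dots> \<le> C * 1" using x C by (intro mult_left_mono) auto
    finally show "r \<le> C * 1" .
  qed
  show ?thesis
    unfolding opb_def
  proof
    fix x :: "int \<Rightarrow> 'a" assume x: "x \<in> lp p"
    show "lp_norm p (T x) \<le> op_norm p T * lp_norm p x"
    proof (cases "lp_norm p x = 0")
      case True
      then show ?thesis using opbD[OF C(2) x] by simp
    next
      case False
      then have pos: "lp_norm p x > 0" using lp_norm_nonneg[of p x] by simp
      let ?c = "complex_of_real (inverse (lp_norm p x))"
      have c: "cmod ?c = inverse (lp_norm p x)" using pos by (simp only: norm_of_real) simp
      have "?c *\<^sub>C x \<in> {x \<in> lp p. lp_norm p x \<le> 1}"
        using V_scale[OF x] N_scale[OF x, of ?c] c pos by simp
      then have "lp_norm p (T (?c *\<^sub>C x)) \<le> op_norm p T"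
        unfolding op_norm_def by (rule cSUP_upper[OF _ bdd])
      then have "inverse (lp_norm p x) * lp_norm p (T x) \<le> op_norm p T"
        using bop_scale[OF T x, of ?c] N_scale[OF bop_in[OF T x], of ?c] c by simp
      then show ?thesis using pos by (simp add: field_simps)
    qed
  qed
qed

text \<open>The topological part of the two definitions is the same, and finite codimension is expressed
by the existence of a basis of the quotient.\<close>

lemma fredholm_iff: "fredholm p (T :: 'a seq_op) \<longleftrightarrow> bop T \<and> alg_fredholm (lp p) T"
proof -
  have k: "op_kernel p T = kern (lp p) T" by (simp add: op_kernel_def kern_def)
  have "(\<exists>B. quotient_basis (lp p) (T ` lp p) B) \<longleftrightarrow> qfin (lp p) (T ` lp p)" if "bop T"
    using quotient_basis_exists[OF V range_subspace[OF V bop_endo[OF that]]] quotient_basis_qfin by blast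
  then show ?thesis
    unfolding fredholm_def alg_fredholm_def lp_op_iff k finite_dimensional_iff_qfin
    using bop_endo by blast
qed

lemma ind_eq_index:
  assumes "fredholm p (T :: 'a seq_op)" shows "ind p T = index (lp p) T"
proof -
  have k: "op_kernel p T = kern (lp p) T" by (simp add: op_kernel_def kern_def)
  have T: "bop T" "finite_dimensional (kern (lp p) T)" using assms by (auto simp: fredholm_def lp_op_iff k)
  show ?thesis
    unfolding ind_def index_def k dim_eq_quotient_dim[OF kern_subspace[OF V bop_endo[OF T(1)]] T(2)] ..
qed

end

section \<open>Null sequences of operators\<close>

context banach_carrier
begin

lemma opb_cong: "opb T c \<Longrightarrow> (\<And>x. x \<in> V \<Longrightarrow> T x = T' x) \<Longrightarrow> opb T' c"
  by (simp add: opb_def)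

lemma opb_uminus: "opb T c \<Longrightarrow> bop T \<Longrightarrow> opb (\<lambda>x. - T x) c"
  unfolding opb_def by (simp add: N_minus bop_in)

lemma bop_uminus: "bop T \<Longrightarrow> bop (\<lambda>x. - T x)"
  using bop_subtract[OF bop_const_0] by fastforce

definition null :: "(nat \<Rightarrow> 'v \<Rightarrow> 'v) \<Rightarrow> bool" where
  "null T \<longleftrightarrow> (\<forall>\<epsilon>>0. \<forall>\<^sub>F n in sequentially. opb (T n) \<epsilon>)"

lemma null_add:
  assumes "null S" "null T" "\<And>n. bop (S n)" "\<And>n. bop (T n)" shows "null (\<lambda>n x. S n x + T n x)"
  unfolding null_def
proof (intro allI impI)
  fix e :: real assume "e > 0"
  then have "\<forall>\<^sub>F n in sequentially. opb (S n) (e / 2)" "\<forall>\<^sub>F n in sequentially. opb (T n) (e / 2)"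
    using assms(1,2) unfolding null_def by (meson half_gt_zero)+
  then show "\<forall>\<^sub>F n in sequentially. opb (\<lambda>x. S n x + T n x) e"
  proof eventually_elim
    case (elim n)
    then show ?case using opb_add[OF elim assms(3,4)] by simp
  qed
qed

lemma null_comp_left:
  assumes T: "null T" "\<And>n. bop (T n)" and S: "\<And>n. opb (S n) C"
  shows "null (\<lambda>n x. S n (T n x))"
  unfolding null_def
proof (intro allI impI)
  fix e :: real assume e: "e > 0"
  have pos: "\<bar>C\<bar> + 1 > 0" by simp
  have S': "opb (S n) (\<bar>C\<bar> + 1)" for n by (rule opb_mono[OF S]) simp
  have "\<forall>\<^sub>F n in sequentially. opb (T n) (e / (\<bar>C\<bar> + 1))"
    using T(1) e pos unfolding null_def by (meson divide_pos_pos)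
  then show "\<forall>\<^sub>F n in sequentially. opb (\<lambda>x. S n (T n x)) e"
  proof eventually_elim
    case (elim n)
    show ?case using opb_comp[OF S' elim T(2)] pos by simp
  qed
qed

lemma null_comp_right:
  assumes T: "null T" and S: "\<And>n. opb (S n) C" "\<And>n. bop (S n)"
  shows "null (\<lambda>n x. T n (S n x))"
  unfolding null_def
proof (intro allI impI)
  fix e :: real assume e: "e > 0"
  have pos: "\<bar>C\<bar> + 1 > 0" by simp
  have S': "opb (S n) (\<bar>C\<bar> + 1)" for n by (rule opb_mono[OF S(1)]) simp
  have "\<forall>\<^sub>F n in sequentially. opb (T n) (e / (\<bar>C\<bar> + 1))"
    using T(1) e pos unfolding null_def by (meson divide_pos_pos)
  then show "\<forall>\<^sub>F n in sequentially. opb (\<lambda>x. T n (S n x)) e"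
  proof eventually_elim
    case (elim n)
    have "0 \<le> e / (\<bar>C\<bar> + 1)" using e pos by simp
    then show ?case using opb_comp[OF elim S' S(2)] pos by simp
  qed
qed

lemma null_uminus:
  assumes "null T" "\<And>n. bop (T n)" shows "null (\<lambda>n x. - T n x)"
  unfolding null_def
proof (intro allI impI)
  fix e :: real assume "e > 0"
  then have "\<forall>\<^sub>F n in sequentially. opb (T n) e" using assms(1) unfolding null_def by blast
  then show "\<forall>\<^sub>F n in sequentially. opb (\<lambda>x. - T n x) e"
    by eventually_elim (rule opb_uminus[OF _ assms(2)])
qed

end

section \<open>Multiplication by functions on the integers\<close>

definition cutoff :: "int set \<Rightarrow> 'a::complex_banach seq_op" where
  "cutoff S = mul (\<lambda>k. if k \<in> S then 1 else 0)"

definition gentle :: "real \<Rightarrow> (int \<Rightarrow> real) \<Rightarrow> bool" where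
  "gentle \<delta> \<theta> \<longleftrightarrow> (\<forall>k. 0 \<le> \<theta> k \<and> \<theta> k \<le> 1) \<and> (\<forall>i j. \<bar>\<theta> i - \<theta> j\<bar> \<le> \<delta> * \<bar>i - j\<bar>)"

lemma gentle_mono: "gentle \<delta> \<theta> \<Longrightarrow> \<delta> \<le> \<delta>' \<Longrightarrow> gentle \<delta>' \<theta>"
  unfolding gentle_def by (meson abs_ge_zero mult_right_mono of_int_0_le_iff order_trans)

lemma gentle_shift: "gentle \<delta> \<theta> \<Longrightarrow> gentle \<delta> (\<lambda>k. \<theta> (k + h))"
  unfolding gentle_def by (metis add_diff_cancel_right)

lemma gentle_abs: "gentle \<delta> \<theta> \<Longrightarrow> \<bar>\<theta> k\<bar> \<le> 1"
  unfolding gentle_def by simp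

lemma mul_mul: "mul \<theta> (mul \<eta> x) = mul (\<lambda>k. \<theta> k * \<eta> k) x"
  by (simp add: mul_def)

lemma mul_shift: "mul \<theta> (shift h x) = shift h (mul (\<lambda>k. \<theta> (k + h)) x)"
  by (simp add: mul_def shift_def fun_eq_iff)

lemma trunc_cutoff: "trunc n = cutoff {- int n..int n}"
  by (auto simp: trunc_def cutoff_def mul_def fun_eq_iff)

lemma cutoff_cutoff: "cutoff S (cutoff T x) = cutoff (S \<inter> T) x"
  by (auto simp: cutoff_def mul_def fun_eq_iff)

lemma cutoff_empty: "cutoff {} x = 0" by (simp add: cutoff_def mul_def fun_eq_iff zero_fun_apply)

lemma cutoff_compl_self: "cutoff S (cutoff (- S) x) = 0" "cutoff (- S) (cutoff S x) = 0"
  by (simp_all add: cutoff_cutoff cutoff_empty Int_commute)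

lemma cutoff_idem: "cutoff S (cutoff S x) = cutoff S x"
  by (simp add: cutoff_cutoff)

lemma cutoff_split: "cutoff S x + cutoff (- S) x = x"
  by (auto simp: cutoff_def mul_def fun_eq_iff plus_fun_apply)

lemma cutoff_compl: "cutoff (- S) x = x - cutoff S x"
  by (auto simp: cutoff_def mul_def fun_eq_iff minus_apply)

lemma cutoff_commute: "cutoff S (cutoff T x) = cutoff T (cutoff S x)"
  by (simp add: cutoff_cutoff Int_commute)

lemma cutoff_mul: "cutoff S (mul \<theta> x) = mul \<theta> (cutoff S x)"
  by (simp add: cutoff_def mul_mul mult.commute)

lemma cutoff_shift: "cutoff S (shift h x) = shift h (cutoff ((\<lambda>k. k - h) ` S) x)"
proof -
  have "k + h \<in> S \<longleftrightarrow> k \<in> (\<lambda>k. k - h) ` S" for k by (auto simp: image_iff) (metis add_diff_cancel)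
  then show ?thesis by (simp add: cutoff_def mul_shift)
qed

text \<open>Both directions are admitted, so that the two ends of the line are treated at once. The
  complement of a half line is one again.\<close>

definition halfline :: "int set \<Rightarrow> bool" where
  "halfline S \<longleftrightarrow> S = {0..} \<or> S = {..<0}"

lemma halfline_compl: "halfline S \<Longrightarrow> halfline (- S)"
  unfolding halfline_def by auto

text \<open>Vanishes outside \<open>S\<close> and equals \<open>1\<close> on the part of \<open>S\<close> at distance at least \<open>M\<close> from the origin.\<close>

definition ramp :: "int set \<Rightarrow> nat \<Rightarrow> int \<Rightarrow> real" where
  "ramp S M k = (if k \<in> S then min 1 (\<bar>k\<bar> / M) else 0)"

lemma ramp_gentle:
  assumes S: "halfline S" and M: "M > 0" shows "gentle (1 / M) (ramp S M)"
  unfolding gentle_def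
proof (intro conjI allI)
  fix i j :: int
  show "0 \<le> ramp S M i" "ramp S M i \<le> 1" by (simp_all add: ramp_def)
  have 1: "\<bar>min 1 (real_of_int \<bar>i\<bar> / M) - min 1 (real_of_int \<bar>j\<bar> / M)\<bar> \<le> real_of_int \<bar>i - j\<bar> / M"
  proof -
    have "\<bar>real_of_int \<bar>i\<bar> / M - real_of_int \<bar>j\<bar> / M\<bar> = \<bar>real_of_int \<bar>i\<bar> - real_of_int \<bar>j\<bar>\<bar> / M"
      using M by (simp add: diff_divide_distrib[symmetric])
    also have "\<dots> \<le> real_of_int \<bar>i - j\<bar> / M" using M by (intro divide_right_mono) auto
    finally show ?thesis by linarith
  qed
  have 2: "min 1 (real_of_int \<bar>i\<bar> / M) \<le> real_of_int \<bar>i - j\<bar> / M" if "i \<in> S \<longleftrightarrow> j \<notin> S" for i j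
  proof -
    have "\<bar>i\<bar> \<le> \<bar>i - j\<bar>" using S that unfolding halfline_def by auto
    then have "real_of_int \<bar>i\<bar> / M \<le> real_of_int \<bar>i - j\<bar> / M" using M by (intro divide_right_mono) auto
    then show ?thesis by linarith
  qed
  have 3: "0 \<le> min 1 (real_of_int \<bar>i\<bar> / M)" for i by simp
  have "\<bar>ramp S M i - ramp S M j\<bar> \<le> real_of_int \<bar>i - j\<bar> / M"
  proof (cases "i \<in> S"; cases "j \<in> S")
    assume "i \<in> S" "j \<in> S"
    then show ?thesis using 1 by (simp only: ramp_def if_True of_int_abs)
  next
    assume "i \<in> S" "j \<notin> S"
    then show ?thesis using 2[of i j] 3[of i] by (simp add: ramp_def)
  next
    assume "i \<notin> S" "j \<in> S"
    then show ?thesis using 2[of j i] 3[of j] by (simp add: ramp_def abs_minus_commute)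
  next
    assume "i \<notin> S" "j \<notin> S"
    then show ?thesis by (simp add: ramp_def)
  qed
  then show "\<bar>ramp S M i - ramp S M j\<bar> \<le> 1 / M * real_of_int \<bar>i - j\<bar>" by simp
qed

text \<open>Equals \<open>1\<close> on the window of radius \<open>m\<close> and vanishes outside the window of radius \<open>m + M\<close>.\<close>

definition plateau :: "nat \<Rightarrow> nat \<Rightarrow> int \<Rightarrow> real" where
  "plateau m M k = max 0 (min 1 (1 - (\<bar>k\<bar> - m) / M))"

lemma plateau_gentle:
  assumes M: "M > 0" shows "gentle (1 / M) (plateau m M)"
  unfolding gentle_def
proof (intro conjI allI)
  fix i j :: int
  show "0 \<le> plateau m M i" "plateau m M i \<le> 1" by (simp_all add: plateau_def)
  have "(1 - (real_of_int \<bar>i\<bar> - m) / M) - (1 - (real_of_int \<bar>j\<bar> - m) / M) = (real_of_int \<bar>j\<bar> - real_of_int \<bar>i\<bar>) / M"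
    by (simp add: diff_divide_distrib)
  then have "\<bar>(1 - (real_of_int \<bar>i\<bar> - m) / M) - (1 - (real_of_int \<bar>j\<bar> - m) / M)\<bar> = \<bar>real_of_int \<bar>j\<bar> - real_of_int \<bar>i\<bar>\<bar> / M"
    by (simp only: abs_divide abs_of_nat)
  also have "\<dots> \<le> real_of_int \<bar>i - j\<bar> / M" using M by (intro divide_right_mono) auto
  finally have d: "\<bar>(1 - (real_of_int \<bar>i\<bar> - m) / M) - (1 - (real_of_int \<bar>j\<bar> - m) / M)\<bar> \<le> real_of_int \<bar>i - j\<bar> / M" .
  have clamp: "\<bar>max 0 (min 1 a) - max 0 (min 1 b)\<bar> \<le> \<bar>a - b\<bar>" for a b :: real
    by (auto simp: max_def min_def)
  have "\<bar>plateau m M i - plateau m M j\<bar> \<le> real_of_int \<bar>i - j\<bar> / M"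
    using order_trans[OF clamp d] unfolding plateau_def by (simp only: of_int_abs)
  then show "\<bar>plateau m M i - plateau m M j\<bar> \<le> 1 / M * real_of_int \<bar>i - j\<bar>" by simp
qed

lemma trunc_mul_plateau: "trunc m (mul (plateau m M) x) = trunc m x"
  by (auto simp: trunc_def mul_def plateau_def fun_eq_iff divide_nonpos_nonneg)

lemma mul_plateau_trunc:
  assumes "M > 0" shows "mul (plateau m M) (trunc (m + M) x) = mul (plateau m M) x"
proof -
  have "plateau m M k = 0" if "\<not> \<bar>k\<bar> \<le> int (m + M)" for k
  proof -
    have "real M \<le> real_of_int \<bar>k\<bar> - m" using that by linarith
    then have "1 \<le> (real_of_int \<bar>k\<bar> - m) / M" using assms by (simp add: le_divide_eq)
    then have "1 - (real_of_int \<bar>k\<bar> - m) / M \<le> 0" by linarith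
    then show ?thesis unfolding plateau_def by (simp only: min_def max_def) auto
  qed
  then show ?thesis by (auto simp: trunc_def mul_def fun_eq_iff)
qed

section \<open>Operators commuting asymptotically with gentle functions\<close>

context lp_space
begin

abbreviation "E \<equiv> (lp p :: (int \<Rightarrow> 'a) set)"

definition comm :: "'a seq_op \<Rightarrow> (int \<Rightarrow> real) \<Rightarrow> 'a seq_op" where
  "comm T \<theta> x = T (mul \<theta> x) - mul \<theta> (T x)"

text \<open>A uniformly bounded sequence of operators whose commutators with slowly varying functions are
uniformly small. Sequences are needed for the shifted copies of one operator; a single operator
is a constant sequence.\<close>

definition uslow :: "(nat \<Rightarrow> 'a seq_op) \<Rightarrow> bool" where
  "uslow T \<longleftrightarrow> (\<forall>n. bop (T n)) \<and> (\<exists>C. \<forall>n. opb (T n) C) \<and>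
     (\<forall>\<epsilon>>0. \<exists>\<delta>>0. \<forall>\<theta>. gentle \<delta> \<theta> \<longrightarrow> (\<forall>n. opb (comm (T n) \<theta>) \<epsilon>))"

abbreviation slow :: "'a seq_op \<Rightarrow> bool" where "slow T \<equiv> uslow (\<lambda>_. T)"

lemma uslow_bop: "uslow T \<Longrightarrow> bop (T n)" by (simp add: uslow_def)

lemma slow_bop: "slow T \<Longrightarrow> bop T" by (simp add: uslow_def)

lemma uslow_bound: assumes "uslow T" obtains C where "C > 0" "\<And>n. opb (T n) C"
proof -
  obtain C where "\<And>n. opb (T n) C" using assms unfolding uslow_def by blast
  then have "opb (T n) (\<bar>C\<bar> + 1)" for n by (rule opb_mono) simp
  then show ?thesis using that[of "\<bar>C\<bar> + 1"] by simp
qed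

lemma uslowD:
  assumes "uslow T" "\<epsilon> > 0"
  obtains \<delta> where "\<delta> > 0" "\<And>\<theta> n. gentle \<delta> \<theta> \<Longrightarrow> opb (comm (T n) \<theta>) \<epsilon>"
proof -
  have "\<exists>\<delta>>0. \<forall>\<theta>. gentle \<delta> \<theta> \<longrightarrow> (\<forall>n. opb (comm (T n) \<theta>) \<epsilon>)"
    using assms unfolding uslow_def by simp
  then show ?thesis using that by blast
qed

lemma bop_mul_gentle: "gentle \<delta> \<theta> \<Longrightarrow> bop (mul \<theta>)"
  by (rule bop_mul[OF gentle_abs])

lemma opb_mul_gentle: "gentle \<delta> \<theta> \<Longrightarrow> opb (mul \<theta>) 1"
  by (rule opb_mul[OF gentle_abs])

lemma bop_cutoff: "bop (cutoff S)" unfolding cutoff_def by (rule bop_mul[of _ 1]) simp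
lemma opb_cutoff: "opb (cutoff S) 1" unfolding cutoff_def by (rule opb_mul) simp
lemma cutoff_linear: "cutoff S (x + y) = cutoff S x + cutoff S y" "cutoff S (x - y) = cutoff S x - cutoff S y"
  by (simp_all add: cutoff_def mul_linear)
lemma cutoff_in: "x \<in> E \<Longrightarrow> cutoff S x \<in> E" by (rule bop_in[OF bop_cutoff])

lemma bop_comm: "bop T \<Longrightarrow> gentle \<delta> \<theta> \<Longrightarrow> bop (comm T \<theta>)"
  unfolding comm_def by (intro bop_subtract bop_comp[of T "mul \<theta>"] bop_comp[of "mul \<theta>" T] bop_mul_gentle)

lemma uslow_subseq: "uslow T \<Longrightarrow> uslow (\<lambda>n. T (f n))"
  unfolding uslow_def by blast

lemma uslow_diff:
  assumes S: "uslow S" and T: "uslow T" shows "uslow (\<lambda>n x. S n x - T n x)"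
  unfolding uslow_def
proof (intro conjI allI impI)
  note b = uslow_bop[OF S] uslow_bop[OF T]
  show "bop (\<lambda>x. S n x - T n x)" for n by (rule bop_subtract[OF b])
  obtain C where C: "\<And>n. opb (S n) C" by (rule uslow_bound[OF S]) blast
  obtain D where D: "\<And>n. opb (T n) D" by (rule uslow_bound[OF T]) blast
  show "\<exists>C. \<forall>n. opb (\<lambda>x. S n x - T n x) C" using opb_diff[OF C D b] by blast
  fix \<epsilon> :: real assume "\<epsilon> > 0"
  then have e: "\<epsilon> / 2 > 0" by simp
  obtain \<delta>1 where 1: "\<delta>1 > 0" "\<And>\<theta> n. gentle \<delta>1 \<theta> \<Longrightarrow> opb (comm (S n) \<theta>) (\<epsilon> / 2)" by (rule uslowD[OF S e]) blast
  obtain \<delta>2 where 2: "\<delta>2 > 0" "\<And>\<theta> n. gentle \<delta>2 \<theta> \<Longrightarrow> opb (comm (T n) \<theta>) (\<epsilon> / 2)" by (rule uslowD[OF T e]) blast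
  have "opb (comm (\<lambda>x. S n x - T n x) \<theta>) \<epsilon>" if g: "gentle (min \<delta>1 \<delta>2) \<theta>" for \<theta> n
  proof -
    have g1: "gentle \<delta>1 \<theta>" "gentle \<delta>2 \<theta>" using gentle_mono[OF g] by auto
    have "opb (\<lambda>x. comm (S n) \<theta> x - comm (T n) \<theta> x) (\<epsilon> / 2 + \<epsilon> / 2)"
      by (rule opb_diff[OF 1(2)[OF g1(1)] 2(2)[OF g1(2)] bop_comm[OF b(1) g] bop_comm[OF b(2) g]])
    then show ?thesis
      by (simp add: opb_def comm_def mul_linear algebra_simps)
  qed
  then show "\<exists>\<delta>>0. \<forall>\<theta>. gentle \<delta> \<theta> \<longrightarrow> (\<forall>n. opb (comm (\<lambda>x. S n x - T n x) \<theta>) \<epsilon>)"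
    using 1(1) 2(1) by (intro exI[of _ "min \<delta>1 \<delta>2"]) simp
qed

lemma slow_ident: "slow (\<lambda>x. x)"
  unfolding uslow_def comm_def opb_def
  by (auto simp: bop_ident N_0 N_nonneg intro!: exI[of _ 1])

lemma uslow_comp:
  assumes S: "uslow S" and T: "uslow T" shows "uslow (\<lambda>n x. S n (T n x))"
  unfolding uslow_def
proof (intro conjI allI impI)
  note b = uslow_bop[OF S] uslow_bop[OF T]
  show "bop (\<lambda>x. S n (T n x))" for n by (rule bop_comp[OF b])
  obtain C where C: "C > 0" "\<And>n. opb (S n) C" by (rule uslow_bound[OF S]) blast
  obtain D where D: "D > 0" "\<And>n. opb (T n) D" by (rule uslow_bound[OF T]) blast
  show "\<exists>C. \<forall>n. opb (\<lambda>x. S n (T n x)) C" using opb_comp[OF C(2) D(2) b(2)] C(1) by fastforce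
  fix \<epsilon> :: real assume e: "\<epsilon> > 0"
  have e1: "\<epsilon> / (2 * D) > 0" "\<epsilon> / (2 * C) > 0" using e C D by auto
  obtain \<delta>1 where 1: "\<delta>1 > 0" "\<And>\<theta> n. gentle \<delta>1 \<theta> \<Longrightarrow> opb (comm (S n) \<theta>) (\<epsilon> / (2 * D))" by (rule uslowD[OF S e1(1)]) blast
  obtain \<delta>2 where 2: "\<delta>2 > 0" "\<And>\<theta> n. gentle \<delta>2 \<theta> \<Longrightarrow> opb (comm (T n) \<theta>) (\<epsilon> / (2 * C))" by (rule uslowD[OF T e1(2)]) blast
  have "opb (comm (\<lambda>x. S n (T n x)) \<theta>) \<epsilon>" if g: "gentle (min \<delta>1 \<delta>2) \<theta>" for \<theta> n
  proof -
    have g1: "gentle \<delta>1 \<theta>" "gentle \<delta>2 \<theta>" using gentle_mono[OF g] by auto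
    note bc = bop_comm[OF b(1) g] bop_comm[OF b(2) g]
    have "opb (\<lambda>x. S n (comm (T n) \<theta> x)) (C * (\<epsilon> / (2 * C)))"
      using C(1) by (intro opb_comp[OF C(2) 2(2)[OF g1(2)] bc(2)]) simp
    moreover have "opb (\<lambda>x. comm (S n) \<theta> (T n x)) (\<epsilon> / (2 * D) * D)"
      using e1 by (intro opb_comp[OF 1(2)[OF g1(1)] D(2) b(2)]) simp
    ultimately have "opb (\<lambda>x. S n (comm (T n) \<theta> x) + comm (S n) \<theta> (T n x))
        (C * (\<epsilon> / (2 * C)) + \<epsilon> / (2 * D) * D)"
      by (rule opb_add) (rule bop_comp[OF b(1) bc(2)], rule bop_comp[OF bc(1) b(2)])
    then have "opb (\<lambda>x. S n (comm (T n) \<theta> x) + comm (S n) \<theta> (T n x)) \<epsilon>"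
      using C(1) D(1) by simp
    then show ?thesis
    proof (rule opb_cong)
      fix x assume x: "x \<in> E"
      have "S n (T n (mul \<theta> x) - mul \<theta> (T n x)) = S n (T n (mul \<theta> x)) - S n (mul \<theta> (T n x))"
        using x by (intro bop_diff[OF b(1)] bop_in[OF b(2)] bop_in[OF bop_mul_gentle[OF g]])
      then show "S n (comm (T n) \<theta> x) + comm (S n) \<theta> (T n x) = comm (\<lambda>x. S n (T n x)) \<theta> x"
        unfolding comm_def by simp
    qed
  qed
  then show "\<exists>\<delta>>0. \<forall>\<theta>. gentle \<delta> \<theta> \<longrightarrow> (\<forall>n. opb (comm (\<lambda>x. S n (T n x)) \<theta>) \<epsilon>)"
    using 1(1) 2(1) by (intro exI[of _ "min \<delta>1 \<delta>2"]) simp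
qed

text \<open>The commutator depends continuously on the operator, uniformly in the function.\<close>

lemma slow_limit:
  assumes T: "bop T" and lim: "\<And>\<epsilon>. \<epsilon> > 0 \<Longrightarrow> \<exists>S. slow S \<and> opb (\<lambda>x. T x - S x) \<epsilon>"
  shows "slow T"
  unfolding uslow_def
proof (intro conjI allI impI)
  show "bop T" by (rule T)
  obtain C where "opb T C" by (rule bop_bound[OF T])
  then show "\<exists>C. \<forall>n::nat. opb T C" by blast
  fix \<epsilon> :: real assume e: "\<epsilon> > 0"
  then obtain S where S: "slow S" "opb (\<lambda>x. T x - S x) (\<epsilon> / 4)" using lim[of "\<epsilon> / 4"] by auto
  have bD: "bop (\<lambda>x. T x - S x)" by (rule bop_subtract[OF T slow_bop[OF S(1)]])
  have "\<epsilon> / 2 > 0" using e by simp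
  obtain \<delta> where \<delta>: "\<delta> > 0" "\<And>\<theta>. gentle \<delta> \<theta> \<Longrightarrow> opb (comm S \<theta>) (\<epsilon> / 2)"
    by (rule uslowD[OF S(1) \<open>\<epsilon> / 2 > 0\<close>]) blast
  have "opb (comm T \<theta>) \<epsilon>" if g: "gentle \<delta> \<theta>" for \<theta>
  proof -
    note bm = bop_mul_gentle[OF g] and om = opb_mul_gentle[OF g]
    have "opb (\<lambda>x. T (mul \<theta> x) - S (mul \<theta> x)) (\<epsilon> / 4 * 1)"
      using e by (intro opb_comp[OF S(2) om bm]) simp
    moreover have "opb (\<lambda>x. mul \<theta> (T x - S x)) (1 * (\<epsilon> / 4))"
      by (rule opb_comp[OF om S(2) bD]) simp
    ultimately have "opb (\<lambda>x. (T (mul \<theta> x) - S (mul \<theta> x)) - mul \<theta> (T x - S x)) (\<epsilon> / 4 * 1 + 1 * (\<epsilon> / 4))"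
      by (rule opb_diff) (rule bop_comp[OF bD bm], rule bop_comp[OF bm bD])
    then have "opb (\<lambda>x. comm S \<theta> x + ((T (mul \<theta> x) - S (mul \<theta> x)) - mul \<theta> (T x - S x)))
        (\<epsilon> / 2 + (\<epsilon> / 4 * 1 + 1 * (\<epsilon> / 4)))"
      by (rule opb_add[OF \<delta>(2)[OF g] _ bop_comm[OF slow_bop[OF S(1)] g]])
        (rule bop_subtract[OF bop_comp[OF bD bm] bop_comp[OF bm bD]])
    then have "opb (\<lambda>x. comm S \<theta> x + ((T (mul \<theta> x) - S (mul \<theta> x)) - mul \<theta> (T x - S x))) \<epsilon>" by simp
    then show ?thesis by (rule opb_cong) (simp add: comm_def mul_linear)
  qed
  then show "\<exists>\<delta>>0. \<forall>\<theta>. gentle \<delta> \<theta> \<longrightarrow> (\<forall>n::nat. opb (comm T \<theta>) \<epsilon>)" using \<delta>(1) by blast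
qed

lemma bop_shifted: "bop A \<Longrightarrow> bop (\<lambda>x. shift (- h) (A (shift h x)))"
  by (rule bop_comp[OF bop_shift bop_comp[OF _ bop_shift]])

lemma opb_shifted:
  assumes A: "bop A" "opb A C" shows "opb (\<lambda>x. shift (- h) (A (shift h x))) C"
  unfolding opb_def
proof
  fix x assume x: "x \<in> E"
  show "lp_norm p (shift (- h) (A (shift h x))) \<le> C * lp_norm p x"
    using opbD[OF A(2) shift_bound(1)[OF x, of h]]
    unfolding shift_norm[OF bop_in[OF A(1) shift_bound(1)[OF x]]] shift_norm[OF x] .
qed

text \<open>Conjugation with a shift only translates the function, and translates vary just as slowly.\<close>

lemma uslow_shifted:
  assumes A: "slow A" shows "uslow (\<lambda>n x. shift (- h n) (A (shift (h n) x)))"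
  unfolding uslow_def
proof (intro conjI allI impI)
  note b = slow_bop[OF A]
  show "bop (\<lambda>x. shift (- h n) (A (shift (h n) x)))" for n by (rule bop_shifted[OF b])
  obtain C where C: "\<And>n::nat. opb A C" by (rule uslow_bound[OF A]) blast
  show "\<exists>C. \<forall>n. opb (\<lambda>x. shift (- h n) (A (shift (h n) x))) C" using opb_shifted[OF b C] by blast
  fix \<epsilon> :: real assume e: "\<epsilon> > 0"
  obtain \<delta> where \<delta>: "\<delta> > 0" "\<And>\<theta>. gentle \<delta> \<theta> \<Longrightarrow> opb (comm A \<theta>) \<epsilon>"
    by (rule uslowD[OF A e]) blast
  have "opb (comm (\<lambda>x. shift (- h n) (A (shift (h n) x))) \<theta>) \<epsilon>" if g: "gentle \<delta> \<theta>" for \<theta> n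
  proof -
    let ?\<eta> = "\<lambda>k. \<theta> (k - h n)"
    have g': "gentle \<delta> ?\<eta>" using gentle_shift[OF g, of "- h n"] by simp
    have 1: "shift (h n) (mul \<theta> x) = mul ?\<eta> (shift (h n) x)" for x :: "int \<Rightarrow> 'a"
      by (simp add: mul_shift)
    have 2: "mul \<theta> (shift (- h n) y) = shift (- h n) (mul ?\<eta> y)" for y :: "int \<Rightarrow> 'a"
      by (simp add: mul_shift)
    have "opb (\<lambda>x. shift (- h n) (comm A ?\<eta> (shift (h n) x))) \<epsilon>"
      by (rule opb_shifted[OF bop_comm[OF b g'] \<delta>(2)[OF g']])
    then show ?thesis
      by (rule opb_cong) (simp add: comm_def 1 2 shift_linear)
  qed
  then show "\<exists>\<delta>>0. \<forall>\<theta>. gentle \<delta> \<theta> \<longrightarrow> (\<forall>n. opb (comm (\<lambda>x. shift (- h n) (A (shift (h n) x))) \<theta>) \<epsilon>)"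
    using \<delta>(1) by blast
qed

text \<open>Write \<open>K\<^sub>1 = I - R A\<close>, \<open>K\<^sub>2 = I - A R\<close> and \<open>[T] = T \<theta> - \<theta> T\<close>. Then
\<open>[R] = - R [A] R + R \<theta> K\<^sub>2 - K\<^sub>1 \<theta> R\<close>, and since \<open>R K\<^sub>2 = K\<^sub>1 R\<close>, moving \<open>\<theta>\<close> to the outside turns the
last two terms into \<open>[R K\<^sub>2] - R [K\<^sub>2] - [K\<^sub>1] R\<close>.\<close>

lemma slow_regularizer:
  assumes A: "slow A" and R: "bop R"
    and K: "slow (\<lambda>x. x - R (A x))" "slow (\<lambda>x. x - A (R x))" "slow (\<lambda>x. R (x - A (R x)))"
  shows "slow R"
  unfolding uslow_def
proof (intro conjI allI impI)
  show "bop R" by (rule R)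
  obtain C where C: "C > 0" "opb R C" by (rule bop_bound[OF R])
  then show "\<exists>C. \<forall>n::nat. opb R C" by blast
  note bA = slow_bop[OF A] and bK = slow_bop[OF K(1)] slow_bop[OF K(2)] slow_bop[OF K(3)]
  fix \<epsilon> :: real assume e: "\<epsilon> > 0"
  have e1: "\<epsilon> / (4 * C * C) > 0" "\<epsilon> / (4 * C) > 0" "\<epsilon> / 4 > 0" using e C by auto
  obtain \<delta>1 where 1: "\<delta>1 > 0" "\<And>\<theta>. gentle \<delta>1 \<theta> \<Longrightarrow> opb (comm A \<theta>) (\<epsilon> / (4 * C * C))"
    by (rule uslowD[OF A e1(1)]) blast
  obtain \<delta>2 where 2: "\<delta>2 > 0" "\<And>\<theta>. gentle \<delta>2 \<theta> \<Longrightarrow> opb (comm (\<lambda>x. x - R (A x)) \<theta>) (\<epsilon> / (4 * C))"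
    by (rule uslowD[OF K(1) e1(2)]) blast
  obtain \<delta>3 where 3: "\<delta>3 > 0" "\<And>\<theta>. gentle \<delta>3 \<theta> \<Longrightarrow> opb (comm (\<lambda>x. x - A (R x)) \<theta>) (\<epsilon> / (4 * C))"
    by (rule uslowD[OF K(2) e1(2)]) blast
  obtain \<delta>4 where 4: "\<delta>4 > 0" "\<And>\<theta>. gentle \<delta>4 \<theta> \<Longrightarrow> opb (comm (\<lambda>x. R (x - A (R x))) \<theta>) (\<epsilon> / 4)"
    by (rule uslowD[OF K(3) e1(3)]) blast
  let ?\<delta> = "min (min \<delta>1 \<delta>2) (min \<delta>3 \<delta>4)"
  have "opb (comm R \<theta>) \<epsilon>" if g: "gentle ?\<delta> \<theta>" for \<theta>
  proof -
    have gs: "gentle \<delta>1 \<theta>" "gentle \<delta>2 \<theta>" "gentle \<delta>3 \<theta>" "gentle \<delta>4 \<theta>" using gentle_mono[OF g] by auto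
    note bc = bop_comm[OF bA g] bop_comm[OF bK(1) g] bop_comm[OF bK(2) g] bop_comm[OF bK(3) g]
    have b1: "bop (\<lambda>x. R (comm A \<theta> (R x)))" by (rule bop_comp[OF R bop_comp[OF bc(1) R]])
    have b2: "bop (\<lambda>x. comm (\<lambda>x. x - R (A x)) \<theta> (R x))" by (rule bop_comp[OF bc(2) R])
    have b3: "bop (\<lambda>x. R (comm (\<lambda>x. x - A (R x)) \<theta> x))" by (rule bop_comp[OF R bc(3)])
    have "opb (\<lambda>x. comm A \<theta> (R x)) (\<epsilon> / (4 * C * C) * C)"
      using e1 by (intro opb_comp[OF 1(2)[OF gs(1)] C(2) R]) simp
    then have "opb (\<lambda>x. R (comm A \<theta> (R x))) (C * (\<epsilon> / (4 * C * C) * C))"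
      using C(1) by (intro opb_comp[OF C(2) _ bop_comp[OF bc(1) R]]) auto
    then have o1: "opb (\<lambda>x. R (comm A \<theta> (R x))) (\<epsilon> / 4)" using C(1) by simp
    have "opb (\<lambda>x. comm (\<lambda>x. x - R (A x)) \<theta> (R x)) (\<epsilon> / (4 * C) * C)"
      using e1 by (intro opb_comp[OF 2(2)[OF gs(2)] C(2) R]) simp
    then have o2: "opb (\<lambda>x. comm (\<lambda>x. x - R (A x)) \<theta> (R x)) (\<epsilon> / 4)" using C(1) by simp
    have "opb (\<lambda>x. R (comm (\<lambda>x. x - A (R x)) \<theta> x)) (C * (\<epsilon> / (4 * C)))"
      using C(1) by (intro opb_comp[OF C(2) 3(2)[OF gs(3)] bc(3)]) auto
    then have o3: "opb (\<lambda>x. R (comm (\<lambda>x. x - A (R x)) \<theta> x)) (\<epsilon> / 4)" using C(1) by simp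
    note o4 = 4(2)[OF gs(4)]
    have "opb (\<lambda>x. ((comm (\<lambda>x. R (x - A (R x))) \<theta> x - R (comm A \<theta> (R x))) - comm (\<lambda>x. x - R (A x)) \<theta> (R x))
        - R (comm (\<lambda>x. x - A (R x)) \<theta> x)) (\<epsilon> / 4 + \<epsilon> / 4 + \<epsilon> / 4 + \<epsilon> / 4)"
      by (intro opb_diff o1 o2 o3 o4 bop_subtract b1 b2 b3 bc)
    then have "opb (\<lambda>x. ((comm (\<lambda>x. R (x - A (R x))) \<theta> x - R (comm A \<theta> (R x))) - comm (\<lambda>x. x - R (A x)) \<theta> (R x))
        - R (comm (\<lambda>x. x - A (R x)) \<theta> x)) \<epsilon>" by simp
    then show ?thesis
    proof (rule opb_cong)
      fix x assume x: "x \<in> E"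
      have m: "mul \<theta> y \<in> E" if "y \<in> E" for y using bop_in[OF bop_mul_gentle[OF g] that] .
      note i = bop_in[OF R] bop_in[OF bA] m x V_diff
      show "((comm (\<lambda>x. R (x - A (R x))) \<theta> x - R (comm A \<theta> (R x))) - comm (\<lambda>x. x - R (A x)) \<theta> (R x))
        - R (comm (\<lambda>x. x - A (R x)) \<theta> x) = comm R \<theta> x"
        unfolding comm_def by (simp add: bop_diff[OF R] bop_diff[OF bA] mul_linear i)
    qed
  qed
  then show "\<exists>\<delta>>0. \<forall>\<theta>. gentle \<delta> \<theta> \<longrightarrow> (\<forall>n::nat. opb (comm R \<theta>) \<epsilon>)"
    using 1(1) 2(1) 3(1) 4(1) by (intro exI[of _ ?\<delta>]) simp
qed

text \<open>The part of the corner \<open>P U Q\<close> that maps far into \<open>S\<close> is negligible: multiplication by a ramp is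
invisible on its far rows, annihilates \<open>Q\<close>, and nearly commutes with \<open>U\<close>.\<close>

lemma corner_left:
  assumes U: "uslow U" and S: "halfline S" and e: "\<epsilon> > 0"
  shows "\<exists>M. \<forall>n. opb (\<lambda>x. cutoff S (U n (cutoff (- S) x)) - cutoff S (trunc M (U n (cutoff (- S) x)))) \<epsilon>"
proof -
  obtain \<delta> where \<delta>: "\<delta> > 0" "\<And>\<theta> n. gentle \<delta> \<theta> \<Longrightarrow> opb (comm (U n) \<theta>) \<epsilon>" by (rule uslowD[OF U e]) blast
  obtain M0 where M0: "1 / real (Suc M0) < \<delta>" using reals_Archimedean[OF \<delta>(1)] by (auto simp: inverse_eq_divide)
  define M where "M = Suc M0"
  let ?\<theta> = "ramp S M"
  have g: "gentle \<delta> ?\<theta>" using gentle_mono[OF ramp_gentle[OF S, of M]] M0 by (simp add: M_def)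
  have z: "mul ?\<theta> (cutoff (- S) x) = 0" for x :: "int \<Rightarrow> 'a"
    by (simp add: mul_def cutoff_def ramp_def fun_eq_iff zero_fun_apply)
  have w: "cutoff S (y - trunc M y) = cutoff S (mul ?\<theta> y - trunc M (mul ?\<theta> y))" for y :: "int \<Rightarrow> 'a"
  proof
    fix k
    have "ramp S M k = 1" if "k \<in> S" "\<not> \<bar>k\<bar> \<le> int M"
    proof -
      have "real M \<le> real_of_int \<bar>k\<bar>" using that by linarith
      then have "1 \<le> real_of_int \<bar>k\<bar> / M" by (simp add: M_def le_divide_eq)
      then show ?thesis using that unfolding ramp_def by simp
    qed
    then show "cutoff S (y - trunc M y) k = cutoff S (mul ?\<theta> y - trunc M (mul ?\<theta> y)) k"
      by (auto simp: cutoff_def mul_def trunc_def minus_apply)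
  qed
  have "opb (\<lambda>x. cutoff S (U n (cutoff (- S) x)) - cutoff S (trunc M (U n (cutoff (- S) x)))) \<epsilon>" for n
    unfolding opb_def
  proof
    fix x assume x: "x \<in> E"
    let ?y = "U n (cutoff (- S) x)"
    have yE: "?y \<in> E" using bop_in[OF uslow_bop[OF U] cutoff_in[OF x]] .
    have mE: "mul ?\<theta> ?y \<in> E" using bop_in[OF bop_mul_gentle[OF g] yE] .
    have "mul ?\<theta> ?y = - comm (U n) ?\<theta> (cutoff (- S) x)"
      unfolding comm_def z bop_zero[OF uslow_bop[OF U]] by simp
    then have "lp_norm p (mul ?\<theta> ?y) = lp_norm p (comm (U n) ?\<theta> (cutoff (- S) x))"
      using N_minus[OF bop_in[OF bop_comm[OF uslow_bop[OF U] g] cutoff_in[OF x]]] by simp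
    also have "\<dots> \<le> \<epsilon> * lp_norm p (cutoff (- S) x)" by (rule opbD[OF \<delta>(2)[OF g] cutoff_in[OF x]])
    also have "\<dots> \<le> \<epsilon> * (1 * lp_norm p x)" using e opbD[OF opb_cutoff x] by (intro mult_left_mono) auto
    finally have 1: "lp_norm p (mul ?\<theta> ?y) \<le> \<epsilon> * lp_norm p x" by simp
    have 2: "mul ?\<theta> ?y - trunc M (mul ?\<theta> ?y) = cutoff (- {- int M..int M}) (mul ?\<theta> ?y)"
      by (simp add: cutoff_compl trunc_cutoff)
    have "cutoff S ?y - cutoff S (trunc M ?y) = cutoff S (cutoff (- {- int M..int M}) (mul ?\<theta> ?y))"
      using w[of ?y] unfolding 2 cutoff_linear .
    then show "lp_norm p (cutoff S ?y - cutoff S (trunc M ?y)) \<le> \<epsilon> * lp_norm p x"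
      using opbD[OF opb_cutoff cutoff_in[OF mE], of S "- {- int M..int M}"] opbD[OF opb_cutoff mE, of "- {- int M..int M}"] 1
      by simp
  qed
  then show ?thesis by blast
qed

text \<open>The mirror image of \<open>corner_left\<close>: here the part of the corner that starts far out in \<open>S\<close> is
negligible.\<close>

lemma corner_right:
  assumes U: "uslow U" and S: "halfline S" and e: "\<epsilon> > 0"
  shows "\<exists>M. \<forall>n. opb (\<lambda>x. cutoff (- S) (U n (cutoff S x)) - cutoff (- S) (U n (trunc M (cutoff S x)))) \<epsilon>"
proof -
  obtain \<delta> where \<delta>: "\<delta> > 0" "\<And>\<theta> n. gentle \<delta> \<theta> \<Longrightarrow> opb (comm (U n) \<theta>) \<epsilon>" by (rule uslowD[OF U e]) blast
  obtain M0 where M0: "1 / real (Suc M0) < \<delta>" using reals_Archimedean[OF \<delta>(1)] by (auto simp: inverse_eq_divide)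
  define M where "M = Suc M0"
  let ?\<theta> = "ramp S M"
  have g: "gentle \<delta> ?\<theta>" using gentle_mono[OF ramp_gentle[OF S, of M]] M0 by (simp add: M_def)
  have z: "cutoff (- S) (mul ?\<theta> y) = 0" for y :: "int \<Rightarrow> 'a"
    by (simp add: mul_def cutoff_def ramp_def fun_eq_iff zero_fun_apply)
  have w: "cutoff S x - trunc M (cutoff S x) = mul ?\<theta> (cutoff S x - trunc M (cutoff S x))" for x :: "int \<Rightarrow> 'a"
  proof
    fix k
    have "ramp S M k = 1" if "k \<in> S" "\<not> \<bar>k\<bar> \<le> int M"
    proof -
      have "real M \<le> real_of_int \<bar>k\<bar>" using that by linarith
      then have "1 \<le> real_of_int \<bar>k\<bar> / M" by (simp add: M_def le_divide_eq)
      then show ?thesis using that unfolding ramp_def by simp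
    qed
    then show "(cutoff S x - trunc M (cutoff S x)) k = mul ?\<theta> (cutoff S x - trunc M (cutoff S x)) k"
      by (auto simp: cutoff_def mul_def trunc_def minus_apply)
  qed
  have "opb (\<lambda>x. cutoff (- S) (U n (cutoff S x)) - cutoff (- S) (U n (trunc M (cutoff S x)))) \<epsilon>" for n
    unfolding opb_def
  proof
    fix x assume x: "x \<in> E"
    let ?v = "cutoff S x - trunc M (cutoff S x)"
    note bU = uslow_bop[OF U, of n]
    have v: "?v = cutoff (- {- int M..int M}) (cutoff S x)" by (simp add: cutoff_compl trunc_cutoff)
    have vE: "?v \<in> E" unfolding v by (intro cutoff_in x)
    have nv: "lp_norm p ?v \<le> lp_norm p x"
      using opbD[OF opb_cutoff cutoff_in[OF x], of "- {- int M..int M}" S] opbD[OF opb_cutoff x, of S] unfolding v by simp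
    have cE: "comm (U n) ?\<theta> ?v \<in> E" by (rule bop_in[OF bop_comm[OF bU g] vE])
    have "cutoff (- S) (U n (cutoff S x)) - cutoff (- S) (U n (trunc M (cutoff S x))) = cutoff (- S) (U n ?v)"
      using bop_diff[OF bU cutoff_in[OF x, of S] trunc_in[OF cutoff_in[OF x, of S], of M]] by (simp add: cutoff_linear)
    also have "U n ?v = comm (U n) ?\<theta> ?v + mul ?\<theta> (U n ?v)" unfolding comm_def w[symmetric] by simp
    also have "cutoff (- S) \<dots> = cutoff (- S) (comm (U n) ?\<theta> ?v)" unfolding cutoff_linear z by simp
    finally have eq: "cutoff (- S) (U n (cutoff S x)) - cutoff (- S) (U n (trunc M (cutoff S x))) = cutoff (- S) (comm (U n) ?\<theta> ?v)" .
    have "lp_norm p (cutoff (- S) (comm (U n) ?\<theta> ?v)) \<le> \<epsilon> * lp_norm p ?v"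
      using opbD[OF opb_cutoff cE, of "- S"] opbD[OF \<delta>(2)[OF g] vE, of n] by simp
    also have "\<dots> \<le> \<epsilon> * lp_norm p x" using nv e by (intro mult_left_mono) auto
    finally show "lp_norm p (cutoff (- S) (U n (cutoff S x)) - cutoff (- S) (U n (trunc M (cutoff S x)))) \<le> \<epsilon> * lp_norm p x"
      unfolding eq .
  qed
  then show ?thesis by blast
qed

text \<open>Up to a small error the corner consists of rows near the cut, on which the sequence converges
to zero.\<close>

lemma null_corner_left:
  assumes U: "uslow U" and S: "halfline S" and tr: "\<And>k. null (\<lambda>n x. trunc k (U n x))"
  shows "null (\<lambda>n x. cutoff S (U n (cutoff (- S) x)))"
  unfolding null_def
proof (intro allI impI)
  fix \<epsilon> :: real assume "\<epsilon> > 0"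
  then have e: "\<epsilon> / 2 > 0" by simp
  note bU = uslow_bop[OF U]
  obtain M where M: "\<And>n. opb (\<lambda>x. cutoff S (U n (cutoff (- S) x)) - cutoff S (trunc M (U n (cutoff (- S) x)))) (\<epsilon> / 2)"
    using corner_left[OF U S e] by blast
  have "\<forall>\<^sub>F n in sequentially. opb (\<lambda>x. trunc M (U n x)) (\<epsilon> / 2)" using tr e unfolding null_def by blast
  then show "\<forall>\<^sub>F n in sequentially. opb (\<lambda>x. cutoff S (U n (cutoff (- S) x))) \<epsilon>"
  proof eventually_elim
    case (elim n)
    have b1: "bop (\<lambda>x. trunc M (U n (cutoff (- S) x)))" by (rule bop_comp[OF bop_trunc bop_comp[OF bU bop_cutoff]])
    have b2: "bop (\<lambda>x. cutoff S (trunc M (U n (cutoff (- S) x))))" by (rule bop_comp[OF bop_cutoff b1])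
    have b3: "bop (\<lambda>x. cutoff S (U n (cutoff (- S) x)))" by (rule bop_comp[OF bop_cutoff bop_comp[OF bU bop_cutoff]])
    have "opb (\<lambda>x. trunc M (U n (cutoff (- S) x))) (\<epsilon> / 2 * 1)" using e by (intro opb_comp[OF elim opb_cutoff bop_cutoff]) simp
    then have "opb (\<lambda>x. cutoff S (trunc M (U n (cutoff (- S) x)))) (1 * (\<epsilon> / 2 * 1))"
      by (rule opb_comp[OF opb_cutoff _ b1]) simp
    from opb_add[OF M this bop_subtract[OF b3 b2] b2] show ?case by simp
  qed
qed

lemma null_corner_right:
  assumes U: "uslow U" and S: "halfline S" and tr: "\<And>k. null (\<lambda>n x. U n (trunc k x))"
  shows "null (\<lambda>n x. cutoff (- S) (U n (cutoff S x)))"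
  unfolding null_def
proof (intro allI impI)
  fix \<epsilon> :: real assume "\<epsilon> > 0"
  then have e: "\<epsilon> / 2 > 0" by simp
  note bU = uslow_bop[OF U]
  obtain M where M: "\<And>n. opb (\<lambda>x. cutoff (- S) (U n (cutoff S x)) - cutoff (- S) (U n (trunc M (cutoff S x)))) (\<epsilon> / 2)"
    using corner_right[OF U S e] by blast
  have "\<forall>\<^sub>F n in sequentially. opb (\<lambda>x. U n (trunc M x)) (\<epsilon> / 2)" using tr e unfolding null_def by blast
  then show "\<forall>\<^sub>F n in sequentially. opb (\<lambda>x. cutoff (- S) (U n (cutoff S x))) \<epsilon>"
  proof eventually_elim
    case (elim n)
    have b1: "bop (\<lambda>x. U n (trunc M (cutoff S x)))" by (rule bop_comp[OF bU bop_comp[OF bop_trunc bop_cutoff]])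
    have b2: "bop (\<lambda>x. cutoff (- S) (U n (trunc M (cutoff S x))))" by (rule bop_comp[OF bop_cutoff b1])
    have b3: "bop (\<lambda>x. cutoff (- S) (U n (cutoff S x)))" by (rule bop_comp[OF bop_cutoff bop_comp[OF bU bop_cutoff]])
    have "opb (\<lambda>x. U n (trunc M (cutoff S x))) (\<epsilon> / 2 * 1)" using e by (intro opb_comp[OF elim opb_cutoff bop_cutoff]) simp
    then have "opb (\<lambda>x. cutoff (- S) (U n (trunc M (cutoff S x)))) (1 * (\<epsilon> / 2 * 1))"
      by (rule opb_comp[OF opb_cutoff _ b1]) simp
    from opb_add[OF M this bop_subtract[OF b3 b2] b2] show ?case by simp
  qed
qed

end

context lp_space
begin

section \<open>Band-dominated operators\<close>

lemma bop_sum_apply: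
  "bop A \<Longrightarrow> (\<And>i. i \<in> I \<Longrightarrow> f i \<in> E) \<Longrightarrow> A (\<Sum>i\<in>I. f i) = (\<Sum>i\<in>I. A (f i))"
proof (induction I rule: infinite_finite_induct)
  case (insert i I)
  have "A (f i + (\<Sum>i\<in>I. f i)) = A (f i) + A (\<Sum>i\<in>I. f i)"
    using insert by (intro bop_add V_sum) auto
  then show ?case using insert by simp
qed (simp_all add: bop_zero)

lemma mat_entry_bound:
  assumes "opb A C" "0 \<le> C" "bop A" shows "norm (mat_entry A i j v) \<le> C * norm (v :: 'a)"
proof -
  have "norm (mat_entry A i j v) \<le> lp_norm p (A (single j v))"
    unfolding mat_entry_def by (rule norm_le_lp_norm[OF p bop_in[OF assms(3) single_in]])
  also have "\<dots> \<le> C * lp_norm p (single j v)" by (rule opbD[OF assms(1) single_in])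
  also have "\<dots> \<le> C * norm v" using single_norm assms(2) by (intro mult_left_mono)
  finally show ?thesis .
qed

lemma mat_entry_scaleR:
  assumes "bop A" shows "mat_entry A i j (r *\<^sub>R v) = r *\<^sub>R mat_entry A i j (v :: 'a)"
  unfolding mat_entry_def scaleR_scaleC single_linear bop_scale[OF assms single_in]
  by (simp add: scaleC_fun_def)

lemma apply_trunc_at:
  assumes "bop A"
  shows "A (trunc n x) i = (\<Sum>j\<in>{- int n..int n}. mat_entry A i j (x j))"
  unfolding trunc_as_sum bop_sum_apply[OF assms single_in] sum_fun_at mat_entry_def ..

text \<open>Holds for finitely supported sequences by linearity and carries over by density.\<close>

lemma band_apply:
  assumes A: "bop A" and band: "\<And>i j. \<bar>i - j\<bar> \<ge> k \<Longrightarrow> mat_entry A i j = (\<lambda>a. 0)" and x: "x \<in> E"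
  shows "A x i = (\<Sum>d\<in>{- k<..<k}. mat_entry A i (i + d) (x (i + d)))"
proof -
  let ?s = "\<Sum>d\<in>{- k<..<k}. mat_entry A i (i + d) (x (i + d))"
  obtain C where C: "C > 0" "opb A C" by (rule bop_bound[OF A])
  have "norm (A x i - ?s) \<le> 0 + e" if e: "e > 0" for e
  proof -
    have "e / C > 0" using e C by simp
    then obtain n0 where n0: "\<And>n. n \<ge> n0 \<Longrightarrow> lp_norm p (x - trunc n x) < e / C" using trunc_lim[OF x] by metis
    define n where "n = n0 + nat \<bar>i\<bar> + nat \<bar>k\<bar>"
    have n: "n \<ge> n0" "\<bar>i\<bar> + \<bar>k\<bar> \<le> int n" by (simp_all add: n_def)
    have "(\<Sum>j\<in>{- int n..int n}. mat_entry A i j (x j)) = (\<Sum>j\<in>{i - k<..<i + k}. mat_entry A i j (x j))"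
    proof (rule sum.mono_neutral_right)
      show "{i - k<..<i + k} \<subseteq> {- int n..int n}" using n(2) by auto
      show "\<forall>j\<in>{- int n..int n} - {i - k<..<i + k}. mat_entry A i j (x j) = 0"
      proof
        fix j assume "j \<in> {- int n..int n} - {i - k<..<i + k}"
        then have "\<bar>i - j\<bar> \<ge> k" by auto
        then show "mat_entry A i j (x j) = 0" using band by simp
      qed
    qed simp
    also have "\<dots> = ?s"
      by (rule sum.reindex_bij_witness[of _ "\<lambda>d. i + d" "\<lambda>j. j - i"]) auto
    finally have s: "?s = A (trunc n x) i" using apply_trunc_at[OF A] by simp
    have "norm (A x i - ?s) = norm ((A x - A (trunc n x)) i)" by (simp add: s minus_apply)
    also have "\<dots> \<le> lp_norm p (A x - A (trunc n x))"
      by (intro norm_le_lp_norm[OF p] V_diff bop_in[OF A] x trunc_in)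
    also have "A x - A (trunc n x) = A (x - trunc n x)" using bop_diff[OF A x trunc_in[OF x]] by simp
    also have "lp_norm p (A (x - trunc n x)) \<le> C * lp_norm p (x - trunc n x)"
      by (intro opbD[OF C(2)] V_diff x trunc_in)
    also have "\<dots> \<le> C * (e / C)" using n0[OF n(1)] C(1) by (intro mult_left_mono) auto
    finally show ?thesis using C(1) by simp
  qed
  then have "norm (A x i - ?s) \<le> 0" by (rule field_le_epsilon)
  then show ?thesis by simp
qed

text \<open>The commutator has the same diagonals, multiplied by the increments \<open>\<theta> (i + d) - \<theta> i\<close> with
\<open>\<bar>d\<bar> < k\<close>; each diagonal is bounded by the norm of \<open>A\<close>.\<close>

lemma band_slow:
  assumes "A \<in> band_op p" shows "slow A"
  unfolding uslow_def
proof (intro conjI allI impI)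
  have A: "bop A" using assms by (simp add: band_op_def lp_op_iff)
  then show "bop A" .
  obtain k where band: "\<And>i j. \<bar>i - j\<bar> \<ge> k \<Longrightarrow> mat_entry A i j = (\<lambda>a. 0)"
    using assms unfolding band_op_def by blast
  obtain C where C: "C > 0" "opb A C" by (rule bop_bound[OF A])
  then show "\<exists>C. \<forall>n::nat. opb A C" by blast
  let ?D = "{- k<..<k}"
  define c where "c = real (card ?D) * (\<bar>k\<bar> * C) + 1"
  have c: "c > 0" unfolding c_def using C(1) by (intro add_nonneg_pos) auto
  fix \<epsilon> :: real assume e: "\<epsilon> > 0"
  define \<delta> where "\<delta> = \<epsilon> / c"
  have \<delta>: "\<delta> > 0" using e c by (simp add: \<delta>_def)
  have "opb (comm A \<theta>) \<epsilon>" if g: "gentle \<delta> \<theta>" for \<theta>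
    unfolding opb_def
  proof
    fix x assume x: "x \<in> E"
    have mx: "mul \<theta> x \<in> E" by (rule bop_in[OF bop_mul_gentle[OF g] x])
    have ba: "A z i = (\<Sum>d\<in>?D. mat_entry A i (i + d) (z (i + d)))" if "z \<in> E" for z i
      by (rule band_apply[OF A band that])
    define y where "y d = (\<lambda>i. (\<theta> (i + d) - \<theta> i) *\<^sub>R mat_entry A i (i + d) (x (i + d)))" for d
    have eq: "comm A \<theta> x = (\<Sum>d\<in>?D. y d)"
    proof
      fix i
      have "comm A \<theta> x i = A (mul \<theta> x) i - \<theta> i *\<^sub>R A x i" by (simp add: comm_def minus_apply mul_def)
      also have "\<dots> = (\<Sum>d\<in>?D. mat_entry A i (i + d) (mul \<theta> x (i + d))) -
          \<theta> i *\<^sub>R (\<Sum>d\<in>?D. mat_entry A i (i + d) (x (i + d)))"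
        unfolding ba[OF mx] ba[OF x] ..
      also have "\<dots> = (\<Sum>d\<in>?D. y d i)"
        by (simp add: y_def mul_def mat_entry_scaleR[OF A] scaleR_sum_right sum_subtractf scaleR_diff_left)
      finally show "comm A \<theta> x i = (\<Sum>d\<in>?D. y d) i" by (simp add: sum_fun_at)
    qed
    have yd: "y d \<in> E \<and> lp_norm p (y d) \<le> \<delta> * \<bar>k\<bar> * C * lp_norm p x" if d: "d \<in> ?D" for d
    proof -
      have "norm (y d i) \<le> \<delta> * \<bar>k\<bar> * C * norm (x (i + d))" for i
      proof -
        have "\<bar>\<theta> (i + d) - \<theta> i\<bar> \<le> \<delta> * real_of_int \<bar>(i + d) - i\<bar>" using g unfolding gentle_def by blast
        also have "\<dots> \<le> \<delta> * real_of_int \<bar>k\<bar>" using d \<delta> by (intro mult_left_mono) auto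
        finally have "\<bar>\<theta> (i + d) - \<theta> i\<bar> * norm (mat_entry A i (i + d) (x (i + d))) \<le>
            \<delta> * real_of_int \<bar>k\<bar> * (C * norm (x (i + d)))"
          using mat_entry_bound[OF C(2) _ A] C(1) \<delta> by (intro mult_mono) auto
        then show ?thesis by (simp add: y_def mult.assoc)
      qed
      then show ?thesis
        using lp_dominated[OF p x, of "\<delta> * \<bar>k\<bar> * C" "\<lambda>i. i + d" "y d"] \<delta> C(1) by simp
    qed
    have "lp_norm p (comm A \<theta> x) \<le> (\<Sum>d\<in>?D. lp_norm p (y d))" unfolding eq by (rule N_sum) (use yd in blast)
    also have "\<dots> \<le> (\<Sum>d\<in>?D. \<delta> * \<bar>k\<bar> * C * lp_norm p x)" by (rule sum_mono) (use yd in blast)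
    also have "\<dots> = \<delta> * (real (card ?D) * (\<bar>k\<bar> * C)) * lp_norm p x"
      unfolding sum_constant by (simp only: mult_ac)
    also have "\<dots> \<le> \<delta> * c * lp_norm p x"
      using \<delta> lp_norm_nonneg[of p x] by (intro mult_right_mono mult_left_mono) (auto simp: c_def)
    also have "\<dots> = \<epsilon> * lp_norm p x" using c by (simp add: \<delta>_def)
    finally show "lp_norm p (comm A \<theta> x) \<le> \<epsilon> * lp_norm p x" .
  qed
  then show "\<exists>\<delta>>0. \<forall>\<theta>. gentle \<delta> \<theta> \<longrightarrow> (\<forall>n::nat. opb (comm A \<theta>) \<epsilon>)" using \<delta> by blast
qed

lemma bop_fun_diff: "bop S \<Longrightarrow> bop T \<Longrightarrow> bop (S - T)"
  using bop_subtract[of S T] by (simp add: fun_diff_def)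

lemma band_dominated_slow:
  assumes "A \<in> band_dominated p" shows "slow A"
proof (rule slow_limit)
  show A: "bop A" using assms by (simp add: band_dominated_def lp_op_iff)
  fix \<epsilon> :: real assume e: "\<epsilon> > 0"
  obtain B where B: "B \<in> band_op p" "op_norm p (A - B) < \<epsilon>"
    using assms e unfolding band_dominated_def by blast
  have "bop B" using B(1) by (simp add: band_op_def lp_op_iff)
  then have "opb (A - B) (op_norm p (A - B))" by (intro opb_op_norm bop_fun_diff A)
  then have "opb (A - B) \<epsilon>" by (rule opb_mono) (use B in simp)
  then have "opb (\<lambda>x. A x - B x) \<epsilon>" by (simp add: fun_diff_def)
  then show "\<exists>S. slow S \<and> opb (\<lambda>x. A x - S x) \<epsilon>" using band_slow[OF B(1)] by blast
qed

section \<open>Tails of finite-rank operators\<close>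

lemma lp_norm_disjoint:
  fixes x y :: "int \<Rightarrow> 'a"
  assumes x: "x \<in> E" and y: "y \<in> E" and disj: "\<And>k. x k = 0 \<or> y k = 0"
  shows "lp_norm p (x + y) powr p = lp_norm p x powr p + lp_norm p y powr p"
proof -
  have "norm ((x + y) k) powr p = norm (x k) powr p + norm (y k) powr p" for k
    using disj[of k] p by (auto simp: plus_fun_apply)
  then show ?thesis
    unfolding lp_norm_powr[OF p] using x y by (simp add: lp_def infsum_add)
qed

text \<open>A functional that stays away from zero on unit vectors supported arbitrarily far out takes
  a value proportional to \<open>n\<close> on a sum of \<open>n\<close> disjointly supported ones, whose norm is only
  \<open>n powr (1 / p)\<close>.\<close>

lemma functional_tail:
  fixes f :: "(int \<Rightarrow> 'a) \<Rightarrow> complex"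
  assumes f: "linear_on E f" and C: "\<And>x. x \<in> E \<Longrightarrow> cmod (f x) \<le> C * lp_norm p x" and e: "\<epsilon> > 0"
  shows "\<exists>m. \<forall>x\<in>E. cmod (f (x - trunc m x)) \<le> \<epsilon> * lp_norm p x"
proof (rule ccontr)
  assume "\<not> ?thesis"
  then have far: "\<exists>x\<in>E. cmod (f (x - trunc m x)) > \<epsilon> * lp_norm p x" for m by (meson not_le)
  have hump: "\<exists>y\<in>E. \<exists>M\<ge>m. (\<forall>k. y k \<noteq> 0 \<longrightarrow> int m < \<bar>k\<bar> \<and> \<bar>k\<bar> \<le> int M) \<and>
      lp_norm p y \<le> 1 \<and> \<epsilon> / 2 \<le> Re (f y)" for m
  proof -
    obtain x where x: "x \<in> E" "cmod (f (x - trunc m x)) > \<epsilon> * lp_norm p x" using far by blast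
    let ?y = "x - trunc m x"
    have y: "?y = cutoff (- {- int m..int m}) x" by (simp add: cutoff_compl trunc_cutoff)
    have yE: "?y \<in> E" unfolding y by (rule cutoff_in[OF x(1)])
    have Ny: "lp_norm p ?y \<le> lp_norm p x" unfolding y using opbD[OF opb_cutoff x(1)] by simp
    have pos: "lp_norm p x > 0"
    proof (rule ccontr)
      assume "\<not> ?thesis"
      then have "lp_norm p x = 0" using lp_norm_nonneg[of p x] by simp
      then have "lp_norm p ?y = 0" using Ny lp_norm_nonneg[of p ?y] by simp
      then have "cmod (f ?y) \<le> 0" using C[OF yE] by simp
      then show False using x(2) \<open>lp_norm p x = 0\<close> by simp
    qed
    define r where "r = cmod (f ?y)"
    have r: "r > \<epsilon> * lp_norm p x" "r > 0" using x(2) mult_pos_pos[OF e pos] unfolding r_def by linarith+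
    \<comment> \<open>Rotate and scale so that the value becomes real and positive and the norm at most one.\<close>
    define c where "c = cnj (f ?y) / complex_of_real (r * lp_norm p x)"
    have c: "cmod c = 1 / lp_norm p x" using r pos by (simp add: c_def norm_divide norm_mult r_def[symmetric])
    define z where "z = c *\<^sub>C ?y"
    have zE: "z \<in> E" unfolding z_def by (rule V_scale[OF yE])
    have "f z = c * f ?y" using f yE unfolding z_def linear_on_def by (simp add: scaleC_complex_def)
    also have "\<dots> = complex_of_real (r / lp_norm p x)"
    proof -
      have "cnj (f ?y) * f ?y = complex_of_real (r * r)"
        using complex_norm_square[of "f ?y"] by (simp add: r_def power2_eq_square mult.commute)
      then show ?thesis using r pos by (simp add: c_def)
    qed
    finally have fz: "f z = complex_of_real (r / lp_norm p x)" .
    have big: "\<epsilon> \<le> Re (f z)" using r pos unfolding fz by (simp add: le_divide_eq)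
    have Nz: "lp_norm p z \<le> 1" using N_scale[OF yE, of c] c Ny pos by (simp add: z_def divide_le_eq)
    define b where "b = \<epsilon> / (2 * (\<bar>C\<bar> + 1))"
    have b: "b > 0" "\<bar>C\<bar> * b \<le> \<epsilon> / 2" using e by (auto simp: b_def field_simps add_pos_nonneg)
    obtain n0 where n0: "\<And>n. n \<ge> n0 \<Longrightarrow> lp_norm p (z - trunc n z) < b" using trunc_lim[OF zE b(1)] by blast
    define M where "M = max n0 m"
    have tE: "trunc M z \<in> E" by (rule trunc_in[OF zE])
    have "cmod (f (z - trunc M z)) \<le> C * lp_norm p (z - trunc M z)" by (rule C[OF V_diff[OF zE tE]])
    also have "\<dots> \<le> \<bar>C\<bar> * b" using n0[of M] lp_norm_nonneg[of p "z - trunc M z"]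
      by (intro mult_mono) (auto simp: M_def)
    finally have "cmod (f z - f (trunc M z)) \<le> \<epsilon> / 2"
      using b(2) linear_on_diff[OF f V zE tE] by simp
    then have "Re (f z) - Re (f (trunc M z)) \<le> \<epsilon> / 2"
      using complex_Re_le_cmod[of "f z - f (trunc M z)"] by simp
    then have "\<epsilon> / 2 \<le> Re (f (trunc M z))" using big by simp
    moreover have "lp_norm p (trunc M z) \<le> 1" using opbD[OF opb_trunc zE, of M] Nz by simp
    moreover have "int m < \<bar>k\<bar> \<and> \<bar>k\<bar> \<le> int M" if "trunc M z k \<noteq> 0" for k
      using that by (auto simp: z_def trunc_def scaleC_fun_def minus_apply complex_vector.scale_zero_right split: if_splits)
    ultimately show ?thesis using tE by (intro bexI[of _ "trunc M z"] exI[of _ M]) (auto simp: M_def)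
  qed
  have sums: "\<exists>y\<in>E. \<exists>M\<ge>m. (\<forall>k. y k \<noteq> 0 \<longrightarrow> int m < \<bar>k\<bar> \<and> \<bar>k\<bar> \<le> int M) \<and>
      lp_norm p y powr p \<le> real n \<and> n * (\<epsilon> / 2) \<le> Re (f y)" for n m
  proof (induction n arbitrary: m)
    case 0
    have "lp_norm p (0 :: int \<Rightarrow> 'a) powr p \<le> real 0" using N_0 by simp
    moreover have "f 0 = 0" by (rule linear_on_zero[OF f V])
    moreover have "int m < \<bar>k\<bar> \<and> \<bar>k\<bar> \<le> int m" if "(0 :: int \<Rightarrow> 'a) k \<noteq> 0" for k
      using that unfolding zero_fun_apply by blast
    ultimately show ?case
      by (intro bexI[of _ 0] exI[of _ m] conjI allI impI V_0) simp_all
  next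
    case (Suc n)
    obtain y M where y: "y \<in> E" "M \<ge> m" "\<And>k. y k \<noteq> 0 \<Longrightarrow> int m < \<bar>k\<bar> \<and> \<bar>k\<bar> \<le> int M"
        "lp_norm p y \<le> 1" "\<epsilon> / 2 \<le> Re (f y)" using hump by blast
    obtain z L where z: "z \<in> E" "L \<ge> M" "\<And>k. z k \<noteq> 0 \<Longrightarrow> int M < \<bar>k\<bar> \<and> \<bar>k\<bar> \<le> int L"
        "lp_norm p z powr p \<le> real n" "n * (\<epsilon> / 2) \<le> Re (f z)" using Suc.IH by blast
    have "y k = 0 \<or> z k = 0" for k using y(3)[of k] z(3)[of k] by force
    then have "lp_norm p (y + z) powr p = lp_norm p y powr p + lp_norm p z powr p"
      by (rule lp_norm_disjoint[OF y(1) z(1)])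
    moreover have "lp_norm p y powr p \<le> 1"
      using powr_mono2[of p "lp_norm p y" 1] y(4) p lp_norm_nonneg[of p y] by simp
    ultimately have 1: "lp_norm p (y + z) powr p \<le> real (Suc n)" using z(4) by simp
    have "f (y + z) = f y + f z" using f y(1) z(1) unfolding linear_on_def by blast
    then have 2: "real (Suc n) * (\<epsilon> / 2) \<le> Re (f (y + z))" using y(5) z(5) by (simp add: distrib_right)
    have 3: "int m < \<bar>k\<bar> \<and> \<bar>k\<bar> \<le> int L" if "(y + z) k \<noteq> 0" for k
    proof -
      have "y k \<noteq> 0 \<or> z k \<noteq> 0" using that by (auto simp: plus_fun_apply)
      then show ?thesis using y(2) y(3)[of k] z(2) z(3)[of k] by linarith
    qed
    show ?case using 1 2 3 V_add[OF y(1) z(1)] y(2) z(2) by (intro bexI[of _ "y + z"] exI[of _ L]) auto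
  qed
  have bound: "n * (\<epsilon> / 2) \<le> (\<bar>C\<bar> + 1) * real n powr (1 / p)" for n :: nat
  proof -
    obtain y where y: "y \<in> E" "lp_norm p y powr p \<le> real n" "n * (\<epsilon> / 2) \<le> Re (f y)" using sums[of 0 n] by blast
    have "lp_norm p y = (lp_norm p y powr p) powr (1 / p)" using p lp_norm_nonneg[of p y] by (simp add: powr_powr)
    also have "\<dots> \<le> real n powr (1 / p)" using y(2) p by (intro powr_mono2) auto
    finally have Ny: "lp_norm p y \<le> real n powr (1 / p)" .
    have "n * (\<epsilon> / 2) \<le> cmod (f y)" using y(3) complex_Re_le_cmod[of "f y"] by linarith
    also have "\<dots> \<le> C * lp_norm p y" by (rule C[OF y(1)])
    also have "\<dots> \<le> (\<bar>C\<bar> + 1) * real n powr (1 / p)" using Ny lp_norm_nonneg[of p y] by (intro mult_mono) auto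
    finally show ?thesis .
  qed
  \<comment> \<open>The bound says that \<open>n powr (1 - 1 / p)\<close> stays bounded, which is false since \<open>p > 1\<close>.\<close>
  define q where "q = 1 - 1 / p"
  have q: "q > 0" using p by (simp add: q_def)
  define a where "a = 2 * (\<bar>C\<bar> + 1) / \<epsilon>"
  have a: "a > 0" using e by (simp add: a_def add_nonneg_pos)
  obtain n :: nat where n: "real n > (a + 1) powr (1 / q)" using reals_Archimedean2 by blast
  then have n0: "real n > 0" using powr_ge_zero[of "a + 1" "1 / q"] by linarith
  have "a + 1 = ((a + 1) powr (1 / q)) powr q" using q a by (simp add: powr_powr)
  also have "\<dots> < real n powr q" using n q by (intro powr_less_mono2) auto
  finally have "a < real n powr q" by simp
  moreover have "real n powr q * real n powr (1 / p) = real n" using n0 by (simp add: q_def powr_add[symmetric])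
  ultimately have "a * real n powr (1 / p) < real n"
    using n0 mult_strict_right_mono[of a "real n powr q" "real n powr (1 / p)"] by simp
  then have "(\<bar>C\<bar> + 1) * real n powr (1 / p) < n * (\<epsilon> / 2)" using e by (simp add: a_def field_simps)
  then show False using bound[of n] by simp
qed

text \<open>By \<open>coordinate_bound\<close>, the coordinates with respect to a basis of the range are bounded functionals.\<close>

lemma finrank_coordinates:
  assumes F: "bop F" "finrank F"
  obtains B f c where "finite B" "B \<subseteq> E" "\<And>b. b \<in> B \<Longrightarrow> linear_on E (f b)"
    "\<And>b x. b \<in> B \<Longrightarrow> x \<in> E \<Longrightarrow> cmod (f b x :: complex) \<le> c * lp_norm p x"
    "\<And>x. x \<in> E \<Longrightarrow> F x = (\<Sum>b\<in>B. f b x *\<^sub>C b)" "c > 0"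
proof -
  have U: "csubspace (F ` E)" "F ` E \<subseteq> E"
    using range_subspace[OF V bop_endo[OF F(1)]] bop_in[OF F(1)] by auto
  obtain B where B: "finite B" "complex_vector.independent B" "B \<subseteq> F ` E" "F ` E = cspan B"
    by (rule finite_basis_of_subspace[OF U F(2)[unfolded finrank_def]])
  have BE: "B \<subseteq> E" using B(3) U(2) by blast
  obtain C where C: "C > 0" "\<And>u b. b \<in> B \<Longrightarrow> cmod (u b) \<le> C * lp_norm p (\<Sum>b\<in>B. u b *\<^sub>C b)"
    using coordinate_bound[OF B(1,2) BE] by blast
  obtain M where M: "M > 0" "opb F M" by (rule bop_bound[OF F(1)])
  let ?r = "complex_vector.representation B"
  have sp: "F x \<in> cspan B" if "x \<in> E" for x using that B(4) by blast
  have rep: "F x = (\<Sum>b\<in>B. ?r (F x) b *\<^sub>C b)" if "x \<in> E" for x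
    using complex_vector.sum_representation_eq[OF B(2) sp[OF that] B(1)] by simp
  have lin: "linear_on E (\<lambda>x. ?r (F x) b)" for b
    unfolding linear_on_def
  proof (intro conjI ballI allI)
    fix x assume x: "x \<in> E"
    show "?r (F (x + y)) b = ?r (F x) b + ?r (F y) b" if y: "y \<in> E" for y
      using bop_add[OF F(1) x y] complex_vector.representation_add[OF B(2) sp[OF y] sp[OF x]] by simp
    show "?r (F (c *\<^sub>C x)) b = c *\<^sub>C ?r (F x) b" for c
      using bop_scale[OF F(1) x] complex_vector.representation_scale[OF B(2) sp[OF x]]
      by (simp add: scaleC_complex_def)
  qed
  have bd: "cmod (?r (F x) b) \<le> C * M * lp_norm p x" if "b \<in> B" "x \<in> E" for b x
  proof -
    have "cmod (?r (F x) b) \<le> C * lp_norm p (F x)" using C(2)[OF that(1), of "?r (F x)"] rep[OF that(2)] by simp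
    also have "\<dots> \<le> C * (M * lp_norm p x)" using C(1) opbD[OF M(2) that(2)] by (intro mult_left_mono) auto
    finally show ?thesis by (simp add: mult.assoc)
  qed
  show ?thesis
    by (rule that[of B "\<lambda>b x. ?r (F x) b" "C * M"]) (use B BE lin bd rep C(1) M(1) in auto)
qed

text \<open>This reduces to functionals, where \<open>p > 1\<close> enters.\<close>

lemma finrank_tail_right:
  assumes F: "bop F" "finrank F" and e: "\<epsilon> > 0"
  shows "\<exists>m. opb (\<lambda>x. F (x - trunc m x)) \<epsilon>"
proof -
  obtain B and f :: "(int \<Rightarrow> 'a) \<Rightarrow> (int \<Rightarrow> 'a) \<Rightarrow> complex" and c where
    B: "finite B" "B \<subseteq> E" and f: "\<And>b. b \<in> B \<Longrightarrow> linear_on E (f b)"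
    and c: "\<And>b x. b \<in> B \<Longrightarrow> x \<in> E \<Longrightarrow> cmod (f b x) \<le> c * lp_norm p x"
    and Feq: "\<And>x. x \<in> E \<Longrightarrow> F x = (\<Sum>b\<in>B. f b x *\<^sub>C b)" and c0: "c > 0"
    by (rule finrank_coordinates[OF F]) blast
  define s where "s = (\<Sum>b\<in>B. lp_norm p b) + 1"
  have s: "s > 0" unfolding s_def by (intro add_nonneg_pos sum_nonneg lp_norm_nonneg) simp
  have es: "\<epsilon> / s > 0" using e s by simp
  have "\<forall>b\<in>B. \<exists>m. \<forall>x\<in>E. cmod (f b (x - trunc m x)) \<le> \<epsilon> / s * lp_norm p x"
    using functional_tail[OF f c es] by simp
  then obtain m0 where m0: "\<And>b x. b \<in> B \<Longrightarrow> x \<in> E \<Longrightarrow> cmod (f b (x - trunc (m0 b) x)) \<le> \<epsilon> / s * lp_norm p x"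
    by metis
  define m where "m = (\<Sum>b\<in>B. m0 b)"
  have "opb (\<lambda>x. F (x - trunc m x)) \<epsilon>"
    unfolding opb_def
  proof
    fix x assume x: "x \<in> E"
    let ?y = "x - trunc m x"
    have y: "?y = cutoff (- {- int m..int m}) x" by (simp add: cutoff_compl trunc_cutoff)
    have yE: "?y \<in> E" unfolding y by (rule cutoff_in[OF x])
    have Ny: "lp_norm p ?y \<le> lp_norm p x" unfolding y using opbD[OF opb_cutoff x] by simp
    have fb: "cmod (f b ?y) \<le> \<epsilon> / s * lp_norm p x" if b: "b \<in> B" for b
    proof -
      have "m0 b \<le> m" unfolding m_def using member_le_sum[of b B m0] B b by simp
      then have "{- int (m0 b)..int (m0 b)} \<inter> - {- int m..int m} = {}" by auto
      then have "trunc (m0 b) ?y = 0" unfolding y by (simp add: trunc_cutoff cutoff_cutoff cutoff_empty)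
      then have "cmod (f b ?y) \<le> \<epsilon> / s * lp_norm p ?y" using m0[OF b yE] by simp
      also have "\<dots> \<le> \<epsilon> / s * lp_norm p x" using Ny es by (intro mult_left_mono) auto
      finally show ?thesis .
    qed
    have "lp_norm p (F ?y) \<le> (\<Sum>b\<in>B. lp_norm p (f b ?y *\<^sub>C b))"
      unfolding Feq[OF yE] by (rule N_sum) (use B V_scale in blast)
    also have "\<dots> \<le> (\<Sum>b\<in>B. \<epsilon> / s * lp_norm p x * lp_norm p b)"
    proof (rule sum_mono)
      fix b assume b: "b \<in> B"
      then have "lp_norm p (f b ?y *\<^sub>C b) = cmod (f b ?y) * lp_norm p b" using B by (intro N_scale) auto
      also have "\<dots> \<le> \<epsilon> / s * lp_norm p x * lp_norm p b" using fb[OF b] lp_norm_nonneg by (intro mult_right_mono) auto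
      finally show "lp_norm p (f b ?y *\<^sub>C b) \<le> \<epsilon> / s * lp_norm p x * lp_norm p b" .
    qed
    also have "\<dots> = \<epsilon> / s * lp_norm p x * (\<Sum>b\<in>B. lp_norm p b)" by (simp add: sum_distrib_left)
    also have "\<dots> \<le> \<epsilon> / s * lp_norm p x * s" using es lp_norm_nonneg[of p x]
      by (intro mult_left_mono mult_nonneg_nonneg) (auto simp: s_def)
    also have "\<dots> = \<epsilon> * lp_norm p x" using s by simp
    finally show "lp_norm p (F ?y) \<le> \<epsilon> * lp_norm p x" .
  qed
  then show ?thesis by blast
qed

lemma finrank_tail_left:
  assumes F: "bop F" "finrank F" and e: "\<epsilon> > 0"
  shows "\<exists>m. opb (\<lambda>x. F x - trunc m (F x)) \<epsilon>"
proof -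
  obtain B and f :: "(int \<Rightarrow> 'a) \<Rightarrow> (int \<Rightarrow> 'a) \<Rightarrow> complex" and c where
    B: "finite B" "B \<subseteq> E" and f: "\<And>b. b \<in> B \<Longrightarrow> linear_on E (f b)"
    and c: "\<And>b x. b \<in> B \<Longrightarrow> x \<in> E \<Longrightarrow> cmod (f b x) \<le> c * lp_norm p x"
    and Feq: "\<And>x. x \<in> E \<Longrightarrow> F x = (\<Sum>b\<in>B. f b x *\<^sub>C b)" and c0: "c > 0"
    by (rule finrank_coordinates[OF F]) blast
  define d where "d = \<epsilon> / (c * (real (card B) + 1))"
  have d: "d > 0" using e c0 by (simp add: d_def)
  have "\<forall>b\<in>B. \<exists>n0. \<forall>n\<ge>n0. lp_norm p (b - trunc n b) < d" using trunc_lim d B(2) by blast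
  then obtain m0 where m0: "\<And>b n. b \<in> B \<Longrightarrow> n \<ge> m0 b \<Longrightarrow> lp_norm p (b - trunc n b) < d" by metis
  define m where "m = (\<Sum>b\<in>B. m0 b)"
  have m: "lp_norm p (b - trunc m b) \<le> d" if "b \<in> B" for b
    using m0[OF that, of m] member_le_sum[of b B m0] B that by (simp add: m_def)
  have "opb (\<lambda>x. F x - trunc m (F x)) \<epsilon>"
    unfolding opb_def
  proof
    fix x assume x: "x \<in> E"
    have bE: "b \<in> E" "b - trunc m b \<in> E" if "b \<in> B" for b using B that V_diff trunc_in by blast+
    have "trunc m (F x) = (\<Sum>b\<in>B. trunc m (f b x *\<^sub>C b))"
      unfolding Feq[OF x] by (rule bop_sum_apply[OF bop_trunc]) (use bE V_scale in blast)
    also have "\<dots> = (\<Sum>b\<in>B. f b x *\<^sub>C trunc m b)"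
      by (rule sum.cong[OF refl]) (use bop_scale[OF bop_trunc] bE in blast)
    finally have eq: "F x - trunc m (F x) = (\<Sum>b\<in>B. f b x *\<^sub>C (b - trunc m b))"
      unfolding Feq[OF x] by (simp add: complex_vector.scale_right_diff_distrib sum_subtractf)
    have "lp_norm p (F x - trunc m (F x)) \<le> (\<Sum>b\<in>B. lp_norm p (f b x *\<^sub>C (b - trunc m b)))"
      unfolding eq by (rule N_sum) (use bE V_scale in blast)
    also have "\<dots> \<le> (\<Sum>b\<in>B. c * lp_norm p x * d)"
    proof (rule sum_mono)
      fix b assume b: "b \<in> B"
      have "lp_norm p (f b x *\<^sub>C (b - trunc m b)) = cmod (f b x) * lp_norm p (b - trunc m b)"
        by (rule N_scale[OF bE(2)[OF b]])
      also have "\<dots> \<le> c * lp_norm p x * d"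
        using c[OF b x] m[OF b] c0 lp_norm_nonneg[of p] by (intro mult_mono mult_nonneg_nonneg) auto
      finally show "lp_norm p (f b x *\<^sub>C (b - trunc m b)) \<le> c * lp_norm p x * d" .
    qed
    also have "\<dots> = real (card B) * (c * d) * lp_norm p x" by simp
    also have "\<dots> \<le> (real (card B) + 1) * (c * d) * lp_norm p x"
      using c0 d lp_norm_nonneg[of p x] by (intro mult_right_mono) auto
    also have "(real (card B) + 1) * (c * d) = \<epsilon>" using c0 by (simp add: d_def)
    finally show "lp_norm p (F x - trunc m (F x)) \<le> \<epsilon> * lp_norm p x" .
  qed
  then show ?thesis by blast
qed

text \<open>A slowly varying function is nearly constant on a fixed window, and constants commute with
everything.\<close>

lemma slow_truncated:
  assumes F: "bop F" shows "slow (\<lambda>x. trunc m (F (trunc n x)))"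
  unfolding uslow_def
proof (intro conjI allI impI)
  let ?G = "\<lambda>x. trunc m (F (trunc n x))"
  show G: "bop ?G" by (rule bop_comp[OF bop_trunc bop_comp[OF F bop_trunc]])
  obtain C where C: "C > 0" "opb F C" by (rule bop_bound[OF F])
  obtain C' where "opb ?G C'" by (rule bop_bound[OF G])
  then show "\<exists>C. \<forall>k::nat. opb ?G C" by blast
  fix \<epsilon> :: real assume e: "\<epsilon> > 0"
  define M where "M = real (max m n) + 1"
  have M: "M > 0" by (simp add: M_def add_nonneg_pos)
  define \<delta> where "\<delta> = \<epsilon> / (2 * M * C)"
  have \<delta>: "\<delta> > 0" "\<delta> * M * C = \<epsilon> / 2" using e M C(1) by (simp_all add: \<delta>_def)
  have "opb (comm ?G \<theta>) \<epsilon>" if g: "gentle \<delta> \<theta>" for \<theta>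
  proof -
    define \<eta> where "\<eta> l k = (if \<bar>k\<bar> \<le> int l then \<theta> k - \<theta> 0 else 0)" for l :: nat and k :: int
    let ?c = "complex_of_real (\<theta> 0)"
    have dec: "trunc l (mul \<theta> x) = ?c *\<^sub>C trunc l x + mul (\<eta> l) x" "mul \<theta> (trunc l x) = ?c *\<^sub>C trunc l x + mul (\<eta> l) x"
      for l and x :: "int \<Rightarrow> 'a"
      by (auto simp: trunc_def mul_def \<eta>_def fun_eq_iff plus_fun_apply scaleC_fun_def scaleR_scaleC[symmetric] scaleR_diff_left)
    have \<eta>: "\<bar>\<eta> l k\<bar> \<le> \<delta> * M" if "l \<le> max m n" for l k
    proof (cases "\<bar>k\<bar> \<le> int l")
      case True
      have "\<bar>\<theta> k - \<theta> 0\<bar> \<le> \<delta> * real_of_int \<bar>k - 0\<bar>" using g unfolding gentle_def by blast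
      also have "\<dots> \<le> \<delta> * M" using True that \<delta>(1) by (intro mult_left_mono) (auto simp: M_def)
      finally show ?thesis using True by (simp add: \<eta>_def)
    next
      case False
      then show ?thesis using \<delta>(1) M by (simp add: \<eta>_def)
    qed
    note b\<eta> = bop_mul[of "\<eta> n", OF \<eta>] bop_mul[of "\<eta> m", OF \<eta>] and o\<eta> = opb_mul[of "\<eta> n", OF \<eta>] opb_mul[of "\<eta> m", OF \<eta>]
    have "opb (\<lambda>x. F (mul (\<eta> n) x)) (C * (\<delta> * M))" using C(1) by (intro opb_comp[OF C(2) o\<eta>(1) b\<eta>(1)]) auto
    then have "opb (\<lambda>x. trunc m (F (mul (\<eta> n) x))) (1 * (C * (\<delta> * M)))"
      by (intro opb_comp[OF opb_trunc _ bop_comp[OF F b\<eta>(1)]]) auto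
    moreover have "1 * (C * (\<delta> * M)) = \<delta> * M * C" by (simp only: mult_ac mult_1)
    ultimately have o1: "opb (\<lambda>x. trunc m (F (mul (\<eta> n) x))) (\<epsilon> / 2)" using \<delta>(2) by (simp only:)
    have "opb (\<lambda>x. F (trunc n x)) (C * 1)" using C(1) by (intro opb_comp[OF C(2) opb_trunc bop_trunc]) auto
    then have "opb (\<lambda>x. mul (\<eta> m) (F (trunc n x))) (\<delta> * M * (C * 1))"
      using \<delta>(1) M by (intro opb_comp[OF o\<eta>(2) _ bop_comp[OF F bop_trunc]]) auto
    then have o2: "opb (\<lambda>x. mul (\<eta> m) (F (trunc n x))) (\<epsilon> / 2)" using \<delta>(2) by simp
    have "opb (\<lambda>x. trunc m (F (mul (\<eta> n) x)) - mul (\<eta> m) (F (trunc n x))) (\<epsilon> / 2 + \<epsilon> / 2)"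
    proof (rule opb_diff[OF o1 o2])
      show "bop (\<lambda>x. trunc m (F (mul (\<eta> n) x)))"
        by (rule bop_comp[OF bop_trunc bop_comp[OF F]]) (rule b\<eta>(1), simp)
      show "bop (\<lambda>x. mul (\<eta> m) (F (trunc n x)))"
        by (rule bop_comp[OF _ bop_comp[OF F bop_trunc]]) (rule b\<eta>(2), simp)
    qed
    then have "opb (\<lambda>x. trunc m (F (mul (\<eta> n) x)) - mul (\<eta> m) (F (trunc n x))) \<epsilon>" by simp
    then show ?thesis
    proof (rule opb_cong)
      fix x assume x: "x \<in> E"
      have mE: "mul (\<eta> n) x \<in> E" by (rule bop_in[OF _ x]) (rule b\<eta>(1), simp)
      have tE: "trunc n x \<in> E" "?c *\<^sub>C trunc n x \<in> E" using trunc_in[OF x] V_scale by auto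
      have 1: "F (trunc n (mul \<theta> x)) = ?c *\<^sub>C F (trunc n x) + F (mul (\<eta> n) x)"
        unfolding dec(1) bop_add[OF F tE(2) mE] bop_scale[OF F tE(1)] ..
      have FE: "F (trunc n x) \<in> E" "F (mul (\<eta> n) x) \<in> E" using bop_in[OF F] tE mE by auto
      have 2: "trunc m (F (trunc n (mul \<theta> x))) = ?c *\<^sub>C trunc m (F (trunc n x)) + trunc m (F (mul (\<eta> n) x))"
        unfolding 1 bop_add[OF bop_trunc V_scale[OF FE(1)] FE(2)] bop_scale[OF bop_trunc FE(1)] ..
      show "trunc m (F (mul (\<eta> n) x)) - mul (\<eta> m) (F (trunc n x)) = comm ?G \<theta> x"
        unfolding comm_def 2 dec(2) by simp
    qed
  qed
  then show "\<exists>\<delta>>0. \<forall>\<theta>. gentle \<delta> \<theta> \<longrightarrow> (\<forall>k::nat. opb (comm ?G \<theta>) \<epsilon>)" using \<delta>(1) by blast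
qed

lemma finrank_slow:
  assumes F: "bop F" "finrank F" shows "slow F"
proof (rule slow_limit[OF F(1)])
  fix \<epsilon> :: real assume "\<epsilon> > 0"
  then have e: "\<epsilon> / 2 > 0" by simp
  obtain m where m: "opb (\<lambda>x. F x - trunc m (F x)) (\<epsilon> / 2)" using finrank_tail_left[OF F e] by blast
  obtain n where n: "opb (\<lambda>x. F (x - trunc n x)) (\<epsilon> / 2)" using finrank_tail_right[OF F e] by blast
  have b1: "bop (\<lambda>x. F (x - trunc n x))" by (rule bop_comp[OF F(1) bop_subtract[OF bop_ident bop_trunc]])
  have b2: "bop (\<lambda>x. F x - trunc m (F x))" by (rule bop_subtract[OF F(1) bop_comp[OF bop_trunc F(1)]])
  have "opb (\<lambda>x. trunc m (F (x - trunc n x))) (1 * (\<epsilon> / 2))" by (rule opb_comp[OF opb_trunc n b1]) simp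
  from opb_add[OF m this b2 bop_comp[OF bop_trunc b1]]
  have "opb (\<lambda>x. (F x - trunc m (F x)) + trunc m (F (x - trunc n x))) \<epsilon>" by simp
  then have "opb (\<lambda>x. F x - trunc m (F (trunc n x))) \<epsilon>"
  proof (rule opb_cong)
    fix x assume x: "x \<in> E"
    have tE: "trunc n x \<in> E" by (rule trunc_in[OF x])
    show "(F x - trunc m (F x)) + trunc m (F (x - trunc n x)) = F x - trunc m (F (trunc n x))"
      unfolding bop_diff[OF F(1) x tE] bop_diff[OF bop_trunc bop_in[OF F(1) x] bop_in[OF F(1) tE]] by simp
  qed
  then show "\<exists>S. slow S \<and> opb (\<lambda>x. F x - S x) \<epsilon>" using slow_truncated[OF F(1)] by blast
qed

section \<open>Cutting at a point\<close>

text \<open>For an operator with compact matrix entries this says that any finite number of rows or columns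
forms a compact operator.\<close>

definition locally_approximable :: "'a seq_op \<Rightarrow> bool" where
  "locally_approximable K \<longleftrightarrow>
    (\<forall>m. approximable (\<lambda>x. trunc m (K x)) \<and> approximable (\<lambda>x. K (trunc m x)))"

lemma single_sum: "single i (\<Sum>j\<in>J. f j) = (\<Sum>j\<in>J. single i (f j :: 'a))"
proof (induction J rule: infinite_finite_induct)
  case (insert j J)
  then show ?case by (simp add: single_linear)
qed (simp_all add: single_def fun_eq_iff zero_fun_apply)

text \<open>By slowness a finite number of rows is, up to a small error, a finite block of entries.\<close>

lemma locally_approximable_compact_entries:
  assumes K: "slow K" and cpt: "\<And>i j. compact_operator (mat_entry K i j)"
  shows "locally_approximable K"
proof -
  note bK = slow_bop[OF K]
  have block: "approximable (\<lambda>x. trunc m (K (trunc n x)))" for m n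
  proof -
    have "approximable (\<lambda>x. \<Sum>i\<in>{- int m..int m}. \<Sum>j\<in>{- int n..int n}. single i (mat_entry K i j (x j)))"
      by (intro approximable_sum coordinate_op_approximable cpt)
    then show ?thesis
    proof (rule approximable_cong)
      fix x assume "x \<in> E"
      show "(\<Sum>i\<in>{- int m..int m}. \<Sum>j\<in>{- int n..int n}. single i (mat_entry K i j (x j))) = trunc m (K (trunc n x))"
        unfolding trunc_as_sum[of m] apply_trunc_at[OF bK] single_sum ..
    qed
  qed
  have pl: "\<exists>M>0. opb (comm K (plateau m M)) \<epsilon> \<and> gentle 1 (plateau m M)" if e: "\<epsilon> > 0" for \<epsilon> m
  proof -
    obtain \<delta> where \<delta>: "\<delta> > 0" "\<And>\<theta>. gentle \<delta> \<theta> \<Longrightarrow> opb (comm K \<theta>) \<epsilon>" by (rule uslowD[OF K e]) blast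
    obtain M0 where M0: "1 / real (Suc M0) < \<delta>" using reals_Archimedean[OF \<delta>(1)] by (auto simp: inverse_eq_divide)
    have g: "gentle (1 / real (Suc M0)) (plateau m (Suc M0))" by (rule plateau_gentle) simp
    have "gentle \<delta> (plateau m (Suc M0))" by (rule gentle_mono[OF g]) (use M0 in simp)
    moreover have "gentle 1 (plateau m (Suc M0))" by (rule gentle_mono[OF g]) simp
    ultimately show ?thesis using \<delta>(2) by blast
  qed
  have pt: "mul (plateau m M) (trunc m x) = trunc m x" for m M and x :: "int \<Rightarrow> 'a"
    using trunc_mul_plateau[of m M x] unfolding trunc_cutoff cutoff_mul by simp
  have 1: "approximable (\<lambda>x. trunc m (K x))" for m
  proof (rule approximable_limit)
    show "bop (\<lambda>x. trunc m (K x))" by (rule bop_comp[OF bop_trunc bK])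
    fix \<epsilon> :: real assume "\<epsilon> > 0"
    then obtain M where M: "M > 0" "opb (comm K (plateau m M)) \<epsilon>" "gentle 1 (plateau m M)" using pl by blast
    let ?\<theta> = "plateau m M"
    note bm = bop_mul_gentle[OF M(3)]
    have tm: "trunc (m + M) (mul ?\<theta> x) = mul ?\<theta> x" for x :: "int \<Rightarrow> 'a"
      using mul_plateau_trunc[OF M(1), of m x] unfolding trunc_cutoff cutoff_mul .
    have "approximable (\<lambda>x. trunc m (K (trunc (m + M) (mul ?\<theta> x))))" by (rule approximable_comp_right[OF block bm])
    then have ap: "approximable (\<lambda>x. trunc m (K (mul ?\<theta> x)))"
      unfolding tm .
    have "opb (\<lambda>x. trunc m (comm K ?\<theta> x)) (1 * \<epsilon>)" by (rule opb_comp[OF opb_trunc M(2) bop_comm[OF bK M(3)]]) simp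
    from opb_uminus[OF this bop_comp[OF bop_trunc bop_comm[OF bK M(3)]]]
    have "opb (\<lambda>x. - trunc m (comm K ?\<theta> x)) \<epsilon>" by simp
    then have "opb (\<lambda>x. trunc m (K x) - trunc m (K (mul ?\<theta> x))) \<epsilon>"
    proof (rule opb_cong)
      fix x assume x: "x \<in> E"
      show "- trunc m (comm K ?\<theta> x) = trunc m (K x) - trunc m (K (mul ?\<theta> x))"
        unfolding comm_def bop_diff[OF bop_trunc bop_in[OF bK bop_in[OF bm x]] bop_in[OF bm bop_in[OF bK x]]]
          trunc_mul_plateau by simp
    qed
    then show "\<exists>L. approximable L \<and> opb (\<lambda>x. trunc m (K x) - L x) \<epsilon>" using ap by blast
  qed
  have 2: "approximable (\<lambda>x. K (trunc m x))" for m
  proof (rule approximable_limit)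
    show "bop (\<lambda>x. K (trunc m x))" by (rule bop_comp[OF bK bop_trunc])
    fix \<epsilon> :: real assume e: "\<epsilon> > 0"
    then obtain M where M: "M > 0" "opb (comm K (plateau m M)) \<epsilon>" "gentle 1 (plateau m M)" using pl by blast
    let ?\<theta> = "plateau m M"
    have "approximable (\<lambda>x. mul ?\<theta> (trunc (m + M) (K (trunc m x))))"
      by (rule approximable_comp_left[OF block bop_mul_gentle[OF M(3)]])
    then have ap: "approximable (\<lambda>x. mul ?\<theta> (K (trunc m x)))" by (simp add: mul_plateau_trunc[OF M(1)])
    have "opb (\<lambda>x. comm K ?\<theta> (trunc m x)) (\<epsilon> * 1)" using e by (intro opb_comp[OF M(2) opb_trunc bop_trunc]) simp
    then have "opb (\<lambda>x. K (trunc m x) - mul ?\<theta> (K (trunc m x))) \<epsilon>" by (simp add: comm_def pt)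
    then show "\<exists>L. approximable L \<and> opb (\<lambda>x. K (trunc m x) - L x) \<epsilon>" using ap by blast
  qed
  show ?thesis unfolding locally_approximable_def using 1 2 by blast
qed

text \<open>By \<open>corner_left\<close> only finitely many rows count. The identity does not contribute to the corner.\<close>

lemma corner_approximable:
  assumes C: "slow C" and L: "locally_approximable (\<lambda>x. C x - x)" and S: "halfline S"
  shows "approximable (\<lambda>x. cutoff S (C (cutoff (- S) x)))"
proof (rule approximable_limit)
  note bC = slow_bop[OF C]
  show "bop (\<lambda>x. cutoff S (C (cutoff (- S) x)))" by (rule bop_comp[OF bop_cutoff bop_comp[OF bC bop_cutoff]])
  fix \<epsilon> :: real assume e: "\<epsilon> > 0"
  obtain M where M: "\<And>n::nat. opb (\<lambda>x. cutoff S (C (cutoff (- S) x)) - cutoff S (trunc M (C (cutoff (- S) x)))) \<epsilon>"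
    using corner_left[OF C S e] by blast
  have "approximable (\<lambda>x. trunc M (C x - x))" using L unfolding locally_approximable_def by blast
  from approximable_comp_left[OF approximable_comp_right[OF this bop_cutoff] bop_cutoff]
  have "approximable (\<lambda>x. cutoff S (trunc M (C (cutoff (- S) x) - cutoff (- S) x)))" .
  then have "approximable (\<lambda>x. cutoff S (trunc M (C (cutoff (- S) x))))"
  proof (rule approximable_cong)
    fix x assume x: "x \<in> E"
    have "cutoff S (trunc M (cutoff (- S) x)) = 0"
      unfolding trunc_cutoff cutoff_commute[of "{- int M..int M}"] cutoff_compl_self ..
    then show "cutoff S (trunc M (C (cutoff (- S) x) - cutoff (- S) x)) = cutoff S (trunc M (C (cutoff (- S) x)))"
      unfolding bop_diff[OF bop_trunc bop_in[OF bC cutoff_in[OF x]] cutoff_in[OF x]] cutoff_linear by simp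
  qed
  then show "\<exists>L. approximable L \<and> opb (\<lambda>x. cutoff S (C (cutoff (- S) x)) - L x) \<epsilon>" using M by blast
qed

text \<open>For \<open>S = {0..}\<close> and \<open>S = {..<0}\<close> these are the operators whose indices are the indices at
\<open>\<plusminus>\<infinity>\<close>.\<close>

definition half :: "int set \<Rightarrow> 'a seq_op \<Rightarrow> 'a seq_op" where
  "half S C x = cutoff S (C (cutoff S x)) + cutoff (- S) x"

lemma bop_half: "bop C \<Longrightarrow> bop (half S C)"
  unfolding half_def by (intro bop_plus bop_cutoff bop_comp[OF bop_cutoff bop_comp[OF _ bop_cutoff]])

lemma half_comp:
  assumes "bop B" "bop C" "x \<in> E"
  shows "half S B (half (- S) C x) = cutoff S (B (cutoff S x)) + cutoff (- S) (C (cutoff (- S) x))"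
  unfolding half_def cutoff_linear double_complement cutoff_idem cutoff_compl_self by simp

text \<open>The product of the two halves, in either order, is \<open>C\<close> without its two corners, which are norm
limits of finite-rank operators.\<close>

lemma fredholm_half:
  assumes C: "slow C" and L: "locally_approximable (\<lambda>x. C x - x)" and S: "halfline S"
    and fred: "alg_fredholm E C"
  shows "alg_fredholm E (half S C)" "alg_fredholm E (half (- S) C)"
    "index E C = index E (half S C) + index E (half (- S) C)"
proof -
  note bC = slow_bop[OF C]
  have a1: "approximable (\<lambda>x. cutoff S (C (cutoff (- S) x)))" by (rule corner_approximable[OF C L S])
  have a2: "approximable (\<lambda>x. cutoff (- S) (C (cutoff S x)))"
    using corner_approximable[OF C L halfline_compl[OF S]] by simp
  note K = approximable_uminus[OF approximable_plus[OF a1 a2]]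
  note D = fredholm_perturb[OF bC fred K]
  have eq1: "(half S C \<circ> half (- S) C) x = C x + - (cutoff S (C (cutoff (- S) x)) + cutoff (- S) (C (cutoff S x)))"
    if x: "x \<in> E" for x
  proof -
    have "C x = C (cutoff S x) + C (cutoff (- S) x)"
      using bop_add[OF bC cutoff_in[OF x, of S] cutoff_in[OF x, of "- S"]] by (simp add: cutoff_split)
    then have "C x = cutoff S (C (cutoff S x) + C (cutoff (- S) x)) + cutoff (- S) (C (cutoff S x) + C (cutoff (- S) x))"
      by (simp only: cutoff_split)
    then have "C x = (cutoff S (C (cutoff S x)) + cutoff S (C (cutoff (- S) x))) + (cutoff (- S) (C (cutoff S x)) + cutoff (- S) (C (cutoff (- S) x)))"
      unfolding cutoff_linear .
    then show ?thesis using half_comp[OF bC bC x, of S] by (simp add: algebra_simps)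
  qed
  have eq2: "(half (- S) C \<circ> half S C) x = (half S C \<circ> half (- S) C) x" if x: "x \<in> E" for x
    using half_comp[OF bC bC x, of S] half_comp[OF bC bC x, of "- S"] by (simp add: add.commute)
  have c1: "alg_fredholm E (half S C \<circ> half (- S) C)" "index E (half S C \<circ> half (- S) C) = index E C"
    using D alg_fredholm_cong[of E "half S C \<circ> half (- S) C", OF V eq1] by simp_all
  have c2: "alg_fredholm E (half (- S) C \<circ> half S C)"
    using c1(1) alg_fredholm_cong(1)[of E "half (- S) C \<circ> half S C", OF V eq2] by (simp only:)
  note e = bop_endo[OF bop_half[OF bC]]
  show f1: "alg_fredholm E (half S C)" by (rule alg_fredholm_factor[OF V e e e c2 c1(1)])
  show f2: "alg_fredholm E (half (- S) C)" by (rule alg_fredholm_factor[OF V e e e c1(1) c2])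
  show "index E C = index E (half S C) + index E (half (- S) C)"
    using alg_fredholm_comp(2)[OF V f1 f2] c1(2) by simp
qed

end

section \<open>Conjugation with shifts\<close>

context lp_space
begin

lemma uslow_cong:
  assumes T: "uslow T" and eq: "\<And>n x. x \<in> E \<Longrightarrow> T n x = T' n x"
  shows "uslow T'"
  unfolding uslow_def
proof (intro conjI allI impI)
  show "bop (T' n)" for n by (rule bop_cong[OF uslow_bop[OF T] eq])
  obtain C where C: "\<And>n. opb (T n) C" by (rule uslow_bound[OF T]) blast
  show "\<exists>C. \<forall>n. opb (T' n) C" using opb_cong[OF C eq] by blast
  fix \<epsilon> :: real assume e: "\<epsilon> > 0"
  obtain \<delta> where \<delta>: "\<delta> > 0" "\<And>\<theta> n. gentle \<delta> \<theta> \<Longrightarrow> opb (comm (T n) \<theta>) \<epsilon>" by (rule uslowD[OF T e]) blast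
  have "opb (comm (T' n) \<theta>) \<epsilon>" if g: "gentle \<delta> \<theta>" for \<theta> n
  proof (rule opb_cong[OF \<delta>(2)[OF g]])
    show "comm (T n) \<theta> x = comm (T' n) \<theta> x" if "x \<in> E" for x
      unfolding comm_def eq[OF that] eq[OF bop_in[OF bop_mul_gentle[OF g] that]] ..
  qed
  then show "\<exists>\<delta>>0. \<forall>\<theta>. gentle \<delta> \<theta> \<longrightarrow> (\<forall>n. opb (comm (T' n) \<theta>) \<epsilon>)" using \<delta>(1) by blast
qed

lemma slow_const_0: "slow (\<lambda>x. 0)"
  using uslow_diff[OF slow_ident slow_ident] by simp

lemma norm_le_of_trunc:
  assumes y: "y \<in> E" and le: "\<And>k. lp_norm p (trunc k y) \<le> c"
  shows "lp_norm p y \<le> c"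
proof (rule field_le_epsilon)
  fix e :: real assume "e > 0"
  then obtain k where k: "lp_norm p (y - trunc k y) < e" using trunc_lim[OF y] by blast
  show "lp_norm p y \<le> c + e" using N_le_diff[OF y trunc_in[OF y], of k] le[of k] k by linarith
qed

lemma fredholm_shift: "alg_fredholm E (shift l)" "index E (shift l) = 0"
proof -
  have 1: "inj_on (shift l) E" by (rule inj_on_inverseI[of _ "shift (- l)"]) (simp add: shift_shift shift_0)
  have 2: "shift l ` E = E"
  proof
    show "shift l ` E \<subseteq> E" using shift_bound(1) by blast
    show "E \<subseteq> shift l ` E"
    proof
      fix x assume "x \<in> E"
      then show "x \<in> shift l ` E"
        by (intro image_eqI[of _ _ "shift (- l) x"]) (simp_all add: shift_shift shift_0 shift_bound)
    qed
  qed
  show "alg_fredholm E (shift l)" "index E (shift l) = 0" using index_bij[OF V bop_endo[OF bop_shift] 1 2] by auto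
qed

definition conj_shift :: "int \<Rightarrow> 'a seq_op \<Rightarrow> 'a seq_op" where
  "conj_shift h A x = shift (- h) (A (shift h x))"

lemma bop_conj_shift: "bop A \<Longrightarrow> bop (conj_shift h A)"
  using bop_shifted[of A h] by (simp add: conj_shift_def[abs_def])

lemma opb_conj_shift: "bop A \<Longrightarrow> opb A C \<Longrightarrow> opb (conj_shift h A) C"
  using opb_shifted[of A C h] by (simp add: conj_shift_def[abs_def])

lemma uslow_conj_shift: "slow A \<Longrightarrow> uslow (\<lambda>n. conj_shift (h n) A)"
  using uslow_shifted[of A h] by (simp add: conj_shift_def[abs_def])

lemma conj_shift_comp: "conj_shift h A (conj_shift h B x) = conj_shift h (\<lambda>x. A (B x)) x"
  by (simp add: conj_shift_def shift_shift shift_0)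

text \<open>The translates \<open>W + h n\<close> eventually leave every bounded window. This applies to finite \<open>W\<close> and to
the half line towards whose end \<open>h\<close> tends.\<close>

definition escaping :: "(nat \<Rightarrow> int) \<Rightarrow> int set \<Rightarrow> bool" where
  "escaping h W \<longleftrightarrow> (\<forall>m. \<forall>\<^sub>F n in sequentially. \<forall>k\<in>W. int m < \<bar>k + h n\<bar>)"

text \<open>Far out, a finite-rank operator is negligible by \<open>finrank_tail_right\<close>.\<close>

lemma null_finrank_escaping_right:
  assumes K: "bop K" "finrank K" and W: "escaping h W"
  shows "null (\<lambda>n x. conj_shift (h n) K (cutoff W x))"
  unfolding null_def
proof (intro allI impI)
  fix \<epsilon> :: real assume e: "\<epsilon> > 0"
  obtain m where m: "opb (\<lambda>x. K (x - trunc m x)) \<epsilon>" using finrank_tail_right[OF K e] by blast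
  have "\<forall>\<^sub>F n in sequentially. \<forall>k\<in>W. int m < \<bar>k + h n\<bar>" using W unfolding escaping_def by blast
  then show "\<forall>\<^sub>F n in sequentially. opb (\<lambda>x. conj_shift (h n) K (cutoff W x)) \<epsilon>"
  proof eventually_elim
    case (elim n)
    show ?case
      unfolding opb_def
    proof
      fix x assume x: "x \<in> E"
      let ?y = "shift (h n) (cutoff W x)"
      have yE: "?y \<in> E" by (intro shift_bound cutoff_in x)
      have "(\<lambda>k. k - h n) ` {- int m..int m} \<inter> W = {}"
      proof -
        have False if j: "j \<in> {- int m..int m}" "j - h n \<in> W" for j
        proof -
          have "int m < \<bar>(j - h n) + h n\<bar>" using elim j(2) by blast
          then show False using j(1) by auto
        qed
        then show ?thesis by blast
      qed
      then have "trunc m ?y = 0" unfolding trunc_cutoff cutoff_shift cutoff_cutoff by (simp add: cutoff_empty bop_zero[OF bop_shift])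
      then have "lp_norm p (K ?y) \<le> \<epsilon> * lp_norm p ?y" using opbD[OF m yE] by simp
      also have "lp_norm p ?y = lp_norm p (cutoff W x)" by (rule shift_norm[OF cutoff_in[OF x]])
      also have "\<epsilon> * lp_norm p (cutoff W x) \<le> \<epsilon> * (1 * lp_norm p x)"
        using opbD[OF opb_cutoff x] e by (intro mult_left_mono) auto
      finally show "lp_norm p (conj_shift (h n) K (cutoff W x)) \<le> \<epsilon> * lp_norm p x"
        unfolding conj_shift_def shift_norm[OF bop_in[OF K(1) yE]] by simp
    qed
  qed
qed

lemma null_finrank_escaping_left:
  assumes K: "bop K" "finrank K" and W: "escaping h W"
  shows "null (\<lambda>n x. cutoff W (conj_shift (h n) K x))"
  unfolding null_def
proof (intro allI impI)
  fix \<epsilon> :: real assume e: "\<epsilon> > 0"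
  obtain m where m: "opb (\<lambda>x. K x - trunc m (K x)) \<epsilon>" using finrank_tail_left[OF K e] by blast
  have "\<forall>\<^sub>F n in sequentially. \<forall>k\<in>W. int m < \<bar>k + h n\<bar>" using W unfolding escaping_def by blast
  then show "\<forall>\<^sub>F n in sequentially. opb (\<lambda>x. cutoff W (conj_shift (h n) K x)) \<epsilon>"
  proof eventually_elim
    case (elim n)
    show ?case
      unfolding opb_def
    proof
      fix x assume x: "x \<in> E"
      let ?y = "K (shift (h n) x)"
      have sE: "shift (h n) x \<in> E" by (rule shift_bound(1)[OF x])
      have yE: "?y \<in> E" by (rule bop_in[OF K(1) sE])
      have dE: "?y - trunc m ?y \<in> E" by (rule V_diff[OF yE trunc_in[OF yE]])
      have "(\<lambda>k. k - - h n) ` W \<inter> {- int m..int m} = {}"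
      proof -
        have False if j: "j \<in> W" "j - - h n \<in> {- int m..int m}" for j
        proof -
          have "int m < \<bar>j + h n\<bar>" using elim j(1) by blast
          then show False using j(2) by auto
        qed
        then show ?thesis by blast
      qed
      then have "cutoff W (shift (- h n) (trunc m ?y)) = 0"
        unfolding trunc_cutoff cutoff_shift cutoff_cutoff by (simp add: cutoff_empty bop_zero[OF bop_shift])
      then have eq: "cutoff W (shift (- h n) ?y) = cutoff W (shift (- h n) (?y - trunc m ?y))"
        by (simp add: shift_linear cutoff_linear)
      have "lp_norm p (cutoff W (shift (- h n) ?y)) \<le> 1 * lp_norm p (shift (- h n) (?y - trunc m ?y))"
        unfolding eq by (rule opbD[OF opb_cutoff shift_bound(1)[OF dE]])
      also have "\<dots> = lp_norm p (?y - trunc m ?y)" unfolding shift_norm[OF dE] by (rule mult_1)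
      also have "\<dots> \<le> \<epsilon> * lp_norm p (shift (h n) x)" by (rule opbD[OF m sE])
      also have "\<dots> = \<epsilon> * lp_norm p x" unfolding shift_norm[OF x] ..
      finally show "lp_norm p (cutoff W (conj_shift (h n) K x)) \<le> \<epsilon> * lp_norm p x"
        unfolding conj_shift_def .
    qed
  qed
qed

end

section \<open>A Fredholm operator and one of its limit operators\<close>

text \<open>\<open>B\<close> is the limit operator of \<open>A\<close> along \<open>h\<close>, and \<open>S\<close> is the half line towards whose end \<open>h\<close> tends.\<close>

locale limit_setting = lp_space p ty for p :: real and ty :: "'a::complex_banach itself" +
  fixes A B :: "'a seq_op" and h :: "nat \<Rightarrow> int" and S :: "int set"
  assumes slow_A: "slow A" and LA_A: "locally_approximable (\<lambda>x. A x - x)"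
    and fred_A: "alg_fredholm E A"
    and S: "halfline S" and esc_S: "escaping h S"
    and bop_B: "bop B"
    and conv_left: "null (\<lambda>n x. trunc k (conj_shift (h n) A x - B x))"
    and conv_right: "null (\<lambda>n x. conj_shift (h n) A (trunc k x) - B (trunc k x))"
begin

abbreviation "T n \<equiv> conj_shift (h n) A"

definition R :: "'a seq_op" where
  "R = (SOME R. bop R \<and> finrank (\<lambda>x. x - R (A x)) \<and> finrank (\<lambda>x. x - A (R x)))"

abbreviation "K1 \<equiv> (\<lambda>x. x - R (A x))"
abbreviation "K2 \<equiv> (\<lambda>x. x - A (R x))"
abbreviation "Rn n \<equiv> conj_shift (h n) R"

lemma bop_A: "bop A" by (rule slow_bop[OF slow_A])

lemma R_props: "bop R \<and> finrank K1 \<and> finrank K2"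
  unfolding R_def by (rule someI_ex[OF regularizer_exists[OF bop_A fred_A]])

lemma bop_R: "bop R" and finrank_K1: "finrank K1" and finrank_K2: "finrank K2"
  using R_props by auto

lemma bop_K1: "bop K1" and bop_K2: "bop K2"
  by (rule bop_subtract[OF bop_ident bop_comp[OF bop_R bop_A]],
      rule bop_subtract[OF bop_ident bop_comp[OF bop_A bop_R]])

lemma slow_R: "slow R"
  by (rule slow_regularizer[OF slow_A bop_R finrank_slow[OF bop_K1 finrank_K1]
        finrank_slow[OF bop_K2 finrank_K2]
        finrank_slow[OF bop_comp[OF bop_R bop_K2] finrank_comp_left[OF bop_K2 finrank_K2 bop_R]]])

lemma uslow_T: "uslow T" by (rule uslow_conj_shift[OF slow_A])
lemma uslow_Rn: "uslow Rn" by (rule uslow_conj_shift[OF slow_R])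
lemma bop_T: "bop (T n)" by (rule bop_conj_shift[OF bop_A])
lemma bop_Rn: "bop (Rn n)" by (rule bop_conj_shift[OF bop_R])

lemma T_Rn: "T n (Rn n x) = x - conj_shift (h n) K2 x"
  unfolding conj_shift_comp by (simp add: conj_shift_def shift_linear shift_shift shift_0)

lemma Rn_T: "Rn n (T n x) = x - conj_shift (h n) K1 x"
  unfolding conj_shift_comp by (simp add: conj_shift_def shift_linear shift_shift shift_0)

lemma escaping_trunc: "escaping h {- int k..int k}"
  unfolding escaping_def
proof
  fix m
  have "\<forall>\<^sub>F n in sequentially. \<forall>j\<in>S. int (m + k + 1) < \<bar>j + h n\<bar>" using esc_S unfolding escaping_def by blast
  then show "\<forall>\<^sub>F n in sequentially. \<forall>j\<in>{- int k..int k}. int m < \<bar>j + h n\<bar>"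
  proof eventually_elim
    case (elim n)
    \<comment> \<open>A point of \<open>S\<close> next to the origin shows that \<open>h\<close> itself tends to infinity in absolute value.\<close>
    have "0 \<in> S \<or> - 1 \<in> S" using S unfolding halfline_def by auto
    then have "int (m + k + 1) < \<bar>0 + h n\<bar> \<or> int (m + k + 1) < \<bar>- 1 + h n\<bar>" using elim by blast
    then show ?case by auto
  qed
qed

text \<open>On each bounded window, the commutator of \<open>B\<close> is the limit of the commutators of \<open>T n\<close>.\<close>

lemma slow_B: "slow B"
  unfolding uslow_def
proof (intro conjI allI impI)
  show "bop B" by (rule bop_B)
  obtain C where "opb B C" by (rule bop_bound[OF bop_B])
  then show "\<exists>C. \<forall>n::nat. opb B C" by blast
  fix \<epsilon> :: real assume e: "\<epsilon> > 0"
  obtain \<delta> where \<delta>: "\<delta> > 0" "\<And>\<theta> n. gentle \<delta> \<theta> \<Longrightarrow> opb (comm (T n) \<theta>) \<epsilon>" by (rule uslowD[OF uslow_T e]) blast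
  have "opb (comm B \<theta>) \<epsilon>" if g: "gentle \<delta> \<theta>" for \<theta>
    unfolding opb_def
  proof
    fix x assume x: "x \<in> E"
    note bm = bop_mul_gentle[OF g] and om = opb_mul_gentle[OF g]
    have mx: "mul \<theta> x \<in> E" by (rule bop_in[OF bm x])
    have Nm: "lp_norm p (mul \<theta> x) \<le> lp_norm p x" using opbD[OF om x] by simp
    show "lp_norm p (comm B \<theta> x) \<le> \<epsilon> * lp_norm p x"
    proof (rule norm_le_of_trunc[OF bop_in[OF bop_comm[OF bop_B g] x]])
      fix k
      show "lp_norm p (trunc k (comm B \<theta> x)) \<le> \<epsilon> * lp_norm p x"
      proof (rule field_le_epsilon)
        fix e' :: real assume e': "e' > 0"
        define c where "c = lp_norm p x + 1"
        define d where "d = e' / (2 * c)"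
        have Nx: "c > 0" "lp_norm p x \<le> c" using lp_norm_nonneg[of p x] unfolding c_def by linarith+
        have d: "d > 0" using e' Nx by (simp add: d_def)
        have "2 * d * lp_norm p x \<le> 2 * d * c" using d Nx by (intro mult_left_mono) auto
        also have "\<dots> = e'" using Nx by (simp add: d_def)
        finally have d2: "2 * d * lp_norm p x \<le> e'" .
        have "\<forall>\<^sub>F n in sequentially. opb (\<lambda>x. trunc k (T n x - B x)) d" using conv_left d unfolding null_def by blast
        then obtain n where n: "opb (\<lambda>x. trunc k (T n x - B x)) d" by (auto simp: eventually_sequentially)
        let ?a = "trunc k (comm (T n) \<theta> x)" and ?b = "trunc k (T n (mul \<theta> x) - B (mul \<theta> x))"
          and ?c = "mul \<theta> (trunc k (T n x - B x))"
        have i: "?a \<in> E" "?b \<in> E" "?c \<in> E"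
          using bop_in[OF bop_comm[OF bop_T g] x] bop_in[OF bop_T mx] bop_in[OF bop_B mx] bop_in[OF bop_T x]
            bop_in[OF bop_B x] by (auto intro!: trunc_in bop_in[OF bm] V_diff)
        have tm: "trunc k (mul \<theta> y) = mul \<theta> (trunc k y)" for y :: "int \<Rightarrow> 'a" by (simp add: trunc_cutoff cutoff_mul)
        have tl: "trunc k (y - z) = trunc k y - trunc k z" for y z :: "int \<Rightarrow> 'a" by (simp add: trunc_cutoff cutoff_linear)
        have "trunc k (comm B \<theta> x) = (?a - ?b) + ?c" unfolding comm_def tl tm mul_linear by simp
        then have "lp_norm p (trunc k (comm B \<theta> x)) \<le> lp_norm p (?a - ?b) + lp_norm p ?c"
          using N_add[OF V_diff[OF i(1,2)] i(3)] by simp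
        also have "\<dots> \<le> lp_norm p ?a + lp_norm p ?b + lp_norm p ?c" using N_diff[OF i(1,2)] by simp
        also have "lp_norm p ?a \<le> \<epsilon> * lp_norm p x"
          using opbD[OF opb_trunc bop_in[OF bop_comm[OF bop_T g] x], of k n] opbD[OF \<delta>(2)[OF g] x, of n] by simp
        also have "lp_norm p ?b \<le> d * lp_norm p x"
          using opbD[OF n mx] mult_left_mono[OF Nm, of d] d by linarith
        also have "lp_norm p ?c \<le> d * lp_norm p x"
          using opbD[OF om, of "trunc k (T n x - B x)"] opbD[OF n x]
            trunc_in[OF V_diff[OF bop_in[OF bop_T x] bop_in[OF bop_B x]]] by simp
        finally show "lp_norm p (trunc k (comm B \<theta> x)) \<le> \<epsilon> * lp_norm p x + e'" using d2 by simp
      qed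
    qed
  qed
  then show "\<exists>\<delta>>0. \<forall>\<theta>. gentle \<delta> \<theta> \<longrightarrow> (\<forall>n::nat. opb (comm B \<theta>) \<epsilon>)" using \<delta>(1) by blast
qed

text \<open>A shift merely moves windows, and each translate of a window is contained in a larger window.\<close>

lemma LA_conj_shift: "locally_approximable (\<lambda>x. conj_shift l A x - x)"
proof -
  let ?K = "\<lambda>x. A x - x"
  have bK: "bop ?K" by (rule bop_subtract[OF bop_A bop_ident])
  have eq: "conj_shift l A x - x = conj_shift l ?K x" for x
    by (simp add: conj_shift_def shift_linear shift_shift shift_0)
  have "approximable (\<lambda>x. trunc m (conj_shift l ?K x)) \<and> approximable (\<lambda>x. conj_shift l ?K (trunc m x))" for m
  proof -
    define L where "L = m + nat \<bar>l\<bar>"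
    have sub: "(\<lambda>k. k - - l) ` {- int m..int m} \<inter> {- int L..int L} = (\<lambda>k. k - - l) ` {- int m..int m}"
      by (auto simp: L_def)
    have 1: "trunc m (conj_shift l ?K x) = shift (- l) (cutoff ((\<lambda>k. k - - l) ` {- int m..int m}) (trunc L (?K (shift l x))))" for x
      unfolding conj_shift_def trunc_cutoff cutoff_shift cutoff_cutoff sub ..
    have sub2: "{- int L..int L} \<inter> (\<lambda>k. k + l) ` {- int m..int m} = (\<lambda>k. k + l) ` {- int m..int m}"
      by (auto simp: L_def)
    have 2: "conj_shift l ?K (trunc m x) = shift (- l) (?K (trunc L (shift l (trunc m x))))" for x
    proof -
      have "(\<lambda>k. k - l) ` {- int L..int L} \<inter> {- int m..int m} = {- int m..int m}"
        by (auto simp: L_def image_iff intro!: bexI[of _ "_ + l"])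
      then have "trunc L (shift l (trunc m x)) = shift l (trunc m x)"
        unfolding trunc_cutoff cutoff_shift cutoff_cutoff by simp
      then show ?thesis unfolding conj_shift_def by simp
    qed
    have a: "approximable (\<lambda>x. trunc L (?K x))" "approximable (\<lambda>x. ?K (trunc L x))"
      using LA_A unfolding locally_approximable_def by blast+
    have "approximable (\<lambda>x. shift (- l) (cutoff ((\<lambda>k. k - - l) ` {- int m..int m}) (trunc L (?K (shift l x)))))"
      by (rule approximable_comp_left[OF approximable_comp_left[OF approximable_comp_right[OF a(1) bop_shift] bop_cutoff] bop_shift])
    moreover have "approximable (\<lambda>x. shift (- l) (?K (trunc L (shift l (trunc m x)))))"
      by (rule approximable_comp_left[OF approximable_comp_right[OF approximable_comp_right[OF a(2) bop_shift] bop_trunc] bop_shift])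
    ultimately show ?thesis unfolding 1 2 by blast
  qed
  then show ?thesis unfolding locally_approximable_def eq by blast
qed

lemma LA_B: "locally_approximable (\<lambda>x. B x - x)"
  unfolding locally_approximable_def
proof (intro allI conjI)
  fix m
  note LT = LA_conj_shift[unfolded locally_approximable_def]
  have tl: "trunc m (y - z) = trunc m y - trunc m z" for y z :: "int \<Rightarrow> 'a" by (simp add: trunc_cutoff cutoff_linear)
  show "approximable (\<lambda>x. trunc m (B x - x))"
  proof (rule approximable_limit)
    show "bop (\<lambda>x. trunc m (B x - x))" by (rule bop_comp[OF bop_trunc bop_subtract[OF bop_B bop_ident]])
    fix e :: real assume "e > 0"
    then have "\<forall>\<^sub>F n in sequentially. opb (\<lambda>x. trunc m (T n x - B x)) e" using conv_left unfolding null_def by blast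
    then obtain n where n: "opb (\<lambda>x. trunc m (T n x - B x)) e" by (auto simp: eventually_sequentially)
    from opb_uminus[OF n bop_comp[OF bop_trunc bop_subtract[OF bop_T bop_B]]]
    have "opb (\<lambda>x. trunc m (B x - x) - trunc m (T n x - x)) e" by (rule opb_cong) (simp add: tl)
    moreover have "approximable (\<lambda>x. trunc m (T n x - x))" using LT by blast
    ultimately show "\<exists>L. approximable L \<and> opb (\<lambda>x. trunc m (B x - x) - L x) e" by blast
  qed
  show "approximable (\<lambda>x. B (trunc m x) - trunc m x)"
  proof (rule approximable_limit)
    show "bop (\<lambda>x. B (trunc m x) - trunc m x)" by (rule bop_subtract[OF bop_comp[OF bop_B bop_trunc] bop_trunc])
    fix e :: real assume "e > 0"
    then have "\<forall>\<^sub>F n in sequentially. opb (\<lambda>x. T n (trunc m x) - B (trunc m x)) e" using conv_right unfolding null_def by blast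
    then obtain n where n: "opb (\<lambda>x. T n (trunc m x) - B (trunc m x)) e" by (auto simp: eventually_sequentially)
    from opb_uminus[OF n bop_subtract[OF bop_comp[OF bop_T bop_trunc] bop_comp[OF bop_B bop_trunc]]]
    have "opb (\<lambda>x. (B (trunc m x) - trunc m x) - (T n (trunc m x) - trunc m x)) e" by (rule opb_cong) simp
    moreover have "approximable (\<lambda>x. T n (trunc m x) - trunc m x)" using LT by blast
    ultimately show "\<exists>L. approximable L \<and> opb (\<lambda>x. (B (trunc m x) - trunc m x) - L x) e" by blast
  qed
qed

section \<open>Invertibility of the limit operator\<close>

text \<open>On vectors supported in a fixed window \<open>Rn n\<close> is nearly a left inverse of \<open>T n\<close>, with norm bounded
by that of \<open>R\<close>, and \<open>T n\<close> is close to \<open>B\<close>. Such vectors are dense.\<close>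

lemma B_bounded_below: "\<exists>c>0. \<forall>x\<in>E. c * lp_norm p x \<le> lp_norm p (B x)"
proof -
  obtain M where M: "M > 0" "opb R M" by (rule bop_bound[OF bop_R])
  have oRn: "opb (Rn n) M" for n by (rule opb_conj_shift[OF bop_R M(2)])
  obtain C where C: "C > 0" "opb B C" by (rule bop_bound[OF bop_B])
  have fin: "lp_norm p (trunc k x) \<le> M * lp_norm p (B (trunc k x))" if x: "x \<in> E" for x k
  proof (rule field_le_epsilon)
    fix e :: real assume e: "e > 0"
    let ?y = "trunc k x"
    have y: "?y \<in> E" by (rule trunc_in[OF x])
    define b c where "b = M + 1" and "c = lp_norm p x + 1"
    define d where "d = e / (b * c)"
    have bc: "b > 0" "c > 0" "lp_norm p x \<le> c" using lp_norm_nonneg[of p x] M(1) unfolding b_def c_def by linarith+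
    have d: "d > 0" using e bc by (simp add: d_def)
    have "b * d * lp_norm p x \<le> b * d * c" using d bc by (intro mult_left_mono) auto
    also have "\<dots> = e" using bc by (simp add: d_def)
    finally have d2: "(M + 1) * d * lp_norm p x \<le> e" unfolding b_def .
    have "\<forall>\<^sub>F n in sequentially. opb (\<lambda>x. T n (trunc k x) - B (trunc k x)) d" using conv_right d unfolding null_def by blast
    moreover have "\<forall>\<^sub>F n in sequentially. opb (\<lambda>x. conj_shift (h n) K1 (trunc k x)) d"
      using null_finrank_escaping_right[OF bop_K1 finrank_K1 escaping_trunc, of k] d unfolding null_def trunc_cutoff by blast
    ultimately have "\<forall>\<^sub>F n in sequentially. opb (\<lambda>x. T n (trunc k x) - B (trunc k x)) d \<and>
        opb (\<lambda>x. conj_shift (h n) K1 (trunc k x)) d" by (rule eventually_conj)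
    then obtain n where n: "opb (\<lambda>x. T n (trunc k x) - B (trunc k x)) d" "opb (\<lambda>x. conj_shift (h n) K1 (trunc k x)) d"
      by (auto simp: eventually_sequentially)
    have TE: "T n ?y \<in> E" and BE: "B ?y \<in> E" by (rule bop_in[OF bop_T y], rule bop_in[OF bop_B y])
    have dec: "Rn n (T n ?y) + conj_shift (h n) K1 ?y = ?y" unfolding Rn_T by simp
    have "lp_norm p ?y \<le> lp_norm p (Rn n (T n ?y)) + lp_norm p (conj_shift (h n) K1 ?y)"
      using N_add[OF bop_in[OF bop_Rn TE] bop_in[OF bop_conj_shift[OF bop_K1] y], of n "h n"] unfolding dec .
    also have "lp_norm p (conj_shift (h n) K1 ?y) \<le> d * lp_norm p x" by (rule opbD[OF n(2) x])
    also have "lp_norm p (Rn n (T n ?y)) \<le> M * lp_norm p (T n ?y)" by (rule opbD[OF oRn TE])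
    also have "lp_norm p (T n ?y) \<le> lp_norm p (B ?y) + d * lp_norm p x"
      using N_le_diff[OF TE BE] opbD[OF n(1) x] by linarith
    finally have "lp_norm p ?y \<le> M * (lp_norm p (B ?y) + d * lp_norm p x) + d * lp_norm p x" using M(1) by simp
    also have "\<dots> = M * lp_norm p (B ?y) + (M + 1) * d * lp_norm p x" by (simp add: algebra_simps)
    finally show "lp_norm p ?y \<le> M * lp_norm p (B ?y) + e" using d2 by linarith
  qed
  have "lp_norm p x \<le> M * lp_norm p (B x)" if x: "x \<in> E" for x
  proof (rule field_le_epsilon)
    fix e :: real assume e: "e > 0"
    define b where "b = M * C + 1"
    define d where "d = e / b"
    have MC: "b > 0" using mult_pos_pos[OF M(1) C(1)] unfolding b_def by linarith
    have d: "d > 0" using e MC by (simp add: d_def)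
    have "b * d = e" using MC by (simp add: d_def)
    then have d2: "(M * C + 1) * d = e" unfolding b_def .
    obtain k where k: "lp_norm p (x - trunc k x) < d" using trunc_lim[OF x d] by blast
    let ?y = "trunc k x"
    have y: "?y \<in> E" by (rule trunc_in[OF x])
    have BE: "B x \<in> E" "B ?y \<in> E" using bop_in[OF bop_B] x y by auto
    have "lp_norm p (B ?y) \<le> lp_norm p (B x) + lp_norm p (B ?y - B x)" by (rule N_le_diff[OF BE(2,1)])
    also have "lp_norm p (B ?y - B x) = lp_norm p (B (x - ?y))"
      using bop_diff[OF bop_B x y] N_minus_commute[OF BE] by simp
    also have "\<dots> \<le> C * lp_norm p (x - ?y)" by (rule opbD[OF C(2) V_diff[OF x y]])
    also have "\<dots> \<le> C * d" using k C(1) by (intro mult_left_mono) auto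
    finally have "M * lp_norm p (B ?y) \<le> M * (lp_norm p (B x) + C * d)" using M(1) by (intro mult_left_mono) auto
    then have "lp_norm p x \<le> M * (lp_norm p (B x) + C * d) + d"
      using N_le_diff[OF x y] fin[OF x, of k] k by linarith
    also have "\<dots> = M * lp_norm p (B x) + (M * C + 1) * d" by (simp add: algebra_simps)
    finally show "lp_norm p x \<le> M * lp_norm p (B x) + e" using d2 by simp
  qed
  then have "1 / M * lp_norm p x \<le> lp_norm p (B x)" if "x \<in> E" for x using that M(1) by (simp add: field_simps)
  then show ?thesis using M(1) by (intro exI[of _ "1 / M"]) auto
qed

text \<open>For \<open>y\<close> supported in a window, \<open>T n (Rn n y)\<close> is close to \<open>y\<close>, but \<open>Rn n y\<close> may spread out over the
whole line, where \<open>T n\<close> is not close to \<open>B\<close>. Multiplying it by a wide plateau \<open>\<theta>\<close> confines it to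
a bounded window at the cost of a small commutator.\<close>

lemma B_dense_range:
  assumes y: "y \<in> E" and e: "e > 0" shows "\<exists>u\<in>E. lp_norm p (B u - y) < e"
proof -
  obtain M where M: "M > 0" "opb R M" by (rule bop_bound[OF bop_R])
  have oRn: "opb (Rn n) M" for n by (rule opb_conj_shift[OF bop_R M(2)])
  have "e / 2 > 0" using e by simp
  then obtain m where m: "lp_norm p (y - trunc m y) < e / 2" using trunc_lim[OF y] by blast
  let ?y = "trunc m y"
  have yE: "?y \<in> E" by (rule trunc_in[OF y])
  have Ny: "lp_norm p ?y \<le> lp_norm p y" using opbD[OF opb_trunc y] by simp
  define c where "c = (2 * M + 1) * (lp_norm p y + 1)"
  have c0: "c > 0" using M(1) lp_norm_nonneg[of p y] unfolding c_def by (intro mult_pos_pos) linarith+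
  define d where "d = e / (2 * c)"
  have d: "d > 0" using e c0 by (simp add: d_def)
  have "(2 * M + 1) * d * lp_norm p y \<le> d * c"
    using d M(1) lp_norm_nonneg[of p y] by (simp add: c_def algebra_simps)
  also have "d * c = e / 2" using c0 by (simp add: d_def)
  finally have d2: "(2 * M + 1) * d * lp_norm p y \<le> e / 2" .
  obtain \<delta> where \<delta>: "\<delta> > 0" "\<And>\<theta> n. gentle \<delta> \<theta> \<Longrightarrow> opb (comm (T n) \<theta>) d" by (rule uslowD[OF uslow_T d]) blast
  obtain L0 where L0: "1 / real (Suc L0) < \<delta>" using reals_Archimedean[OF \<delta>(1)] by (auto simp: inverse_eq_divide)
  \<comment> \<open>The slope of the plateau is \<open>1 / L\<close>, small enough for the commutator estimate.\<close>
  define L where "L = Suc L0"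
  have L: "L > 0" by (simp add: L_def)
  let ?\<theta> = "plateau m L"
  have g: "gentle \<delta> ?\<theta>" using gentle_mono[OF plateau_gentle[OF L]] L0 by (simp add: L_def)
  note bm = bop_mul_gentle[OF g] and om = opb_mul_gentle[OF g]
  have "\<forall>\<^sub>F n in sequentially. opb (\<lambda>x. T n (trunc (m + L) x) - B (trunc (m + L) x)) d"
    using conv_right d unfolding null_def by blast
  moreover have "\<forall>\<^sub>F n in sequentially. opb (\<lambda>x. conj_shift (h n) K2 (trunc m x)) d"
    using null_finrank_escaping_right[OF bop_K2 finrank_K2 escaping_trunc, of m] d unfolding null_def trunc_cutoff by blast
  ultimately have "\<forall>\<^sub>F n in sequentially. opb (\<lambda>x. T n (trunc (m + L) x) - B (trunc (m + L) x)) d \<and>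
      opb (\<lambda>x. conj_shift (h n) K2 (trunc m x)) d" by (rule eventually_conj)
  then obtain n where n: "opb (\<lambda>x. T n (trunc (m + L) x) - B (trunc (m + L) x)) d"
      "opb (\<lambda>x. conj_shift (h n) K2 (trunc m x)) d" by (auto simp: eventually_sequentially)
  define v where "v = Rn n ?y"
  have vE: "v \<in> E" unfolding v_def by (rule bop_in[OF bop_Rn yE])
  have "lp_norm p v \<le> M * lp_norm p ?y" unfolding v_def by (rule opbD[OF oRn yE])
  also have "\<dots> \<le> M * lp_norm p y" using Ny M(1) by (intro mult_left_mono) auto
  finally have Nv: "lp_norm p v \<le> M * lp_norm p y" .
  define u where "u = mul ?\<theta> v"
  have uE: "u \<in> E" unfolding u_def by (rule bop_in[OF bm vE])
  have Nu: "lp_norm p u \<le> M * lp_norm p y" using opbD[OF om vE] Nv by (simp add: u_def)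
  have tu: "trunc (m + L) u = u"
    using mul_plateau_trunc[OF L, of m v] unfolding u_def trunc_cutoff cutoff_mul .
  have py: "mul ?\<theta> ?y = ?y" using trunc_mul_plateau[of m L y] unfolding trunc_cutoff cutoff_mul .
  let ?a = "T n (trunc (m + L) u) - B (trunc (m + L) u)" and ?b = "comm (T n) ?\<theta> v"
    and ?c = "mul ?\<theta> (conj_shift (h n) K2 ?y)"
  have KE: "conj_shift (h n) K2 ?y \<in> E" by (rule bop_in[OF bop_conj_shift[OF bop_K2] yE])
  have i: "?a \<in> E" "?b \<in> E" "?c \<in> E"
    using V_diff[OF bop_in[OF bop_T uE] bop_in[OF bop_B uE]] tu bop_in[OF bop_comm[OF bop_T g] vE] bop_in[OF bm KE]
    by auto
  have Tu: "T n u = ?b + mul ?\<theta> (T n v)" unfolding comm_def u_def by simp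
  have Tv: "T n v = ?y - conj_shift (h n) K2 ?y" unfolding v_def T_Rn ..
  have "T n u = ?b + (?y - ?c)" unfolding Tu unfolding Tv mul_linear py ..
  then have eq: "B u - ?y = (?b - ?a) - ?c" unfolding tu by (simp add: algebra_simps)
  have "lp_norm p (B u - ?y) \<le> lp_norm p ?b + lp_norm p ?a + lp_norm p ?c"
    unfolding eq using N_diff[OF V_diff[OF i(2,1)] i(3)] N_diff[OF i(2,1)] by linarith
  also have "lp_norm p ?b \<le> d * lp_norm p v" by (rule opbD[OF \<delta>(2)[OF g] vE])
  also have "d * lp_norm p v \<le> d * (M * lp_norm p y)" using Nv d by (intro mult_left_mono) auto
  also have "lp_norm p ?a \<le> d * lp_norm p u" by (rule opbD[OF n(1) uE])
  also have "d * lp_norm p u \<le> d * (M * lp_norm p y)" using Nu d by (intro mult_left_mono) auto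
  also have "lp_norm p ?c \<le> d * lp_norm p y" using opbD[OF om KE] opbD[OF n(2) y] by simp
  finally have "lp_norm p (B u - ?y) \<le> (2 * M + 1) * d * lp_norm p y" by (simp add: algebra_simps)
  then have 1: "lp_norm p (B u - ?y) \<le> e / 2" using d2 by linarith
  have "lp_norm p (B u - y) \<le> lp_norm p (B u - ?y) + lp_norm p (?y - y)"
    by (rule N_diff_triangle[OF bop_in[OF bop_B uE] yE y])
  then have "lp_norm p (B u - y) < e" using 1 m N_minus_commute[OF yE y] by linarith
  then show ?thesis using uE by blast
qed

lemma B_bij: "inj_on B E" "B ` E = E"
proof -
  obtain c where c: "c > 0" "\<And>x. x \<in> E \<Longrightarrow> c * lp_norm p x \<le> lp_norm p (B x)" using B_bounded_below by blast
  show "inj_on B E" by (rule inj_of_bounded_below[OF bop_B c])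
  show "B ` E = E" by (rule surj_of_dense_range[OF bop_B c B_dense_range])
qed

definition Binv :: "'a seq_op" where "Binv = inv_into E B"

lemma Binv_in: "y \<in> E \<Longrightarrow> Binv y \<in> E" and B_Binv: "y \<in> E \<Longrightarrow> B (Binv y) = y"
  using B_bij(2) by (auto simp: Binv_def inv_into_into f_inv_into_f)

lemma Binv_B: "x \<in> E \<Longrightarrow> Binv (B x) = x"
  using B_bij(1) by (simp add: Binv_def)

lemma bop_Binv: "bop Binv"
proof -
  obtain c where c: "c > 0" "\<And>x. x \<in> E \<Longrightarrow> c * lp_norm p x \<le> lp_norm p (B x)" using B_bounded_below by blast
  have "opb Binv (1 / c)"
    unfolding opb_def
  proof
    fix y assume y: "y \<in> E"
    have "c * lp_norm p (Binv y) \<le> lp_norm p y" using c(2)[OF Binv_in[OF y]] B_Binv[OF y] by simp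
    then show "lp_norm p (Binv y) \<le> 1 / c * lp_norm p y" using c(1) by (simp add: field_simps)
  qed
  moreover have "endo E Binv"
  proof (rule endoI)
    show "Binv x \<in> E" if "x \<in> E" for x by (rule Binv_in[OF that])
    show "Binv (x + y) = Binv x + Binv y" if xy: "x \<in> E" "y \<in> E" for x y
    proof -
      have "B (Binv x + Binv y) = x + y"
        using bop_add[OF bop_B Binv_in[OF xy(1)] Binv_in[OF xy(2)]] B_Binv xy by simp
      then show ?thesis using Binv_B[OF V_add[OF Binv_in[OF xy(1)] Binv_in[OF xy(2)]]] by simp
    qed
    show "Binv (c *\<^sub>C x) = c *\<^sub>C Binv x" if x: "x \<in> E" for c x
    proof -
      have "B (c *\<^sub>C Binv x) = c *\<^sub>C x" using bop_scale[OF bop_B Binv_in[OF x]] B_Binv[OF x] by simp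
      then show ?thesis using Binv_B[OF V_scale[OF Binv_in[OF x]], of c] by simp
    qed
  qed
  ultimately show ?thesis unfolding bop_def by blast
qed

text \<open>An inverse is a regularizer without defects.\<close>

lemma slow_Binv: "slow Binv"
proof (rule slow_regularizer[OF slow_B bop_Binv])
  show "slow (\<lambda>x. x - Binv (B x))" by (rule uslow_cong[OF slow_const_0]) (simp add: Binv_B)
  show "slow (\<lambda>x. x - B (Binv x))" by (rule uslow_cong[OF slow_const_0]) (simp add: B_Binv)
  show "slow (\<lambda>x. Binv (x - B (Binv x)))"
    by (rule uslow_cong[OF slow_const_0]) (simp add: B_Binv bop_zero[OF bop_Binv])
qed

section \<open>Gluing the limit operator to the shifted operator\<close>

text \<open>With \<open>Y = B\<inverse> Q + R\<^sub>n P\<close> and \<open>D = T\<^sub>n - B\<close>, the identities \<open>P Q = 0\<close>, \<open>B B\<inverse> = I\<close> and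
\<open>T\<^sub>n R\<^sub>n = I - K\<close> give \<open>Z Y = I + P D B\<inverse> Q - Q D R\<^sub>n P - K P\<close>. The first two error terms are corners of
slow operators converging to zero on windows, the last one is finite-rank and escapes.\<close>

lemma glued_surjective:
  "\<forall>\<^sub>F n in sequentially. (\<lambda>x. cutoff (- S) (B x) + cutoff S (T n x)) ` E = E"
proof -
  let ?D = "\<lambda>n x. T n x - B x"
  have sD: "uslow ?D" by (rule uslow_diff[OF uslow_T slow_B])
  note bD = uslow_bop[OF sD]
  let ?U1 = "\<lambda>n x. ?D n (Binv x)" and ?U2 = "\<lambda>n x. ?D n (Rn n x)"
  have s1: "uslow ?U1" by (rule uslow_comp[OF sD slow_Binv])
  have s2: "uslow ?U2" by (rule uslow_comp[OF sD uslow_Rn])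
  note b1 = uslow_bop[OF s1] and b2 = uslow_bop[OF s2]
  obtain c1 where c1: "\<And>n::nat. opb Binv c1" by (rule uslow_bound[OF slow_Binv]) blast
  obtain c2 where c2: "\<And>n. opb (Rn n) c2" by (rule uslow_bound[OF uslow_Rn]) blast
  have n1: "null (\<lambda>n x. cutoff S (?U1 n (cutoff (- S) x)))"
    by (rule null_corner_left[OF s1 S null_comp_right[OF conv_left c1 bop_Binv]])
  have n2: "null (\<lambda>n x. cutoff (- S) (?U2 n (cutoff S x)))"
    using null_corner_left[OF s2 halfline_compl[OF S] null_comp_right[OF conv_left c2 bop_Rn]] by simp
  have n3: "null (\<lambda>n x. conj_shift (h n) K2 (cutoff S x))"
    by (rule null_finrank_escaping_right[OF bop_K2 finrank_K2 esc_S])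
  have bb1: "bop (\<lambda>x. cutoff S (?U1 n (cutoff (- S) x)))" for n by (rule bop_comp[OF bop_cutoff bop_comp[OF b1 bop_cutoff]])
  have bb2: "bop (\<lambda>x. cutoff (- S) (?U2 n (cutoff S x)))" for n by (rule bop_comp[OF bop_cutoff bop_comp[OF b2 bop_cutoff]])
  have bb3: "bop (\<lambda>x. conj_shift (h n) K2 (cutoff S x))" for n by (rule bop_comp[OF bop_conj_shift[OF bop_K2] bop_cutoff])
  let ?Err = "\<lambda>n x. (cutoff (- S) (?U2 n (cutoff S x)) + conj_shift (h n) K2 (cutoff S x)) + - cutoff S (?U1 n (cutoff (- S) x))"
  have bE: "bop (?Err n)" for n by (rule bop_plus[OF bop_plus[OF bb2 bb3] bop_uminus[OF bb1]])
  have "null ?Err"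
    by (rule null_add[OF null_add[OF n2 n3 bb2 bb3] null_uminus[OF n1 bb1] bop_plus[OF bb2 bb3] bop_uminus[OF bb1]])
  then have "\<forall>\<^sub>F n in sequentially. opb (?Err n) (1 / 2)" unfolding null_def by simp
  then show ?thesis
  proof eventually_elim
    case (elim n)
    let ?Z = "\<lambda>x. cutoff (- S) (B x) + cutoff S (T n x)"
    let ?Y = "\<lambda>x. Binv (cutoff (- S) x) + Rn n (cutoff S x)"
    have bZ: "bop ?Z" by (rule bop_plus[OF bop_comp[OF bop_cutoff bop_B] bop_comp[OF bop_cutoff bop_T]])
    have bY: "bop ?Y" by (rule bop_plus[OF bop_comp[OF bop_Binv bop_cutoff] bop_comp[OF bop_Rn bop_cutoff]])
    have "?Z (?Y x) = x - ?Err n x" if x: "x \<in> E" for x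
    proof -
      let ?P = "cutoff S x" and ?Q = "cutoff (- S) x"
      have PE: "?P \<in> E" and QE: "?Q \<in> E" by (rule cutoff_in[OF x])+
      have iE: "Binv ?Q \<in> E" "Rn n ?P \<in> E" by (rule Binv_in[OF QE], rule bop_in[OF bop_Rn PE])
      have B1: "B (?Y x) = ?Q + B (Rn n ?P)" using bop_add[OF bop_B iE] B_Binv[OF QE] by simp
      have T1: "T n (?Y x) = T n (Binv ?Q) + (?P - conj_shift (h n) K2 ?P)"
        using bop_add[OF bop_T iE] by (simp add: T_Rn)
      have U1: "?U1 n ?Q = T n (Binv ?Q) - ?Q" using B_Binv[OF QE] by simp
      have U2: "?U2 n ?P = (?P - conj_shift (h n) K2 ?P) - B (Rn n ?P)" by (simp add: T_Rn)
      let ?K = "conj_shift (h n) K2 ?P"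
      have Ksplit: "?K = cutoff S ?K + cutoff (- S) ?K" by (simp add: cutoff_split)
      have "?Z (?Y x) = cutoff (- S) ?Q + cutoff (- S) (B (Rn n ?P)) + (cutoff S (T n (Binv ?Q)) + (cutoff S ?P - cutoff S ?K))"
        unfolding B1 T1 cutoff_linear ..
      also have "\<dots> = ?Q + cutoff (- S) (B (Rn n ?P)) + (cutoff S (T n (Binv ?Q)) + (?P - cutoff S ?K))"
        by (simp add: cutoff_idem)
      also have "\<dots> = x - ?Err n x"
      proof -
        have e1: "cutoff S (?U1 n ?Q) = cutoff S (T n (Binv ?Q))" unfolding U1 cutoff_linear cutoff_compl_self by simp
        have e2: "cutoff (- S) (?U2 n ?P) = - cutoff (- S) ?K - cutoff (- S) (B (Rn n ?P))"
          unfolding U2 cutoff_linear cutoff_compl_self by simp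
        have "x = ?P + ?Q" by (simp add: cutoff_split)
        moreover have "?Err n x = (- cutoff (- S) ?K - cutoff (- S) (B (Rn n ?P)) + (cutoff S ?K + cutoff (- S) ?K)) + - cutoff S (T n (Binv ?Q))"
          unfolding e1 e2 using Ksplit by simp
        ultimately show ?thesis by (simp add: algebra_simps)
      qed
      finally show ?thesis .
    qed
    then have "(\<lambda>x. x - ?Err n x) ` E = (\<lambda>x. ?Z (?Y x)) ` E" by (intro image_cong) simp_all
    moreover have "(\<lambda>x. x - ?Err n x) ` E = E" by (rule ident_minus_small_bij(2)[OF bE elim]) simp_all
    ultimately have "E = (\<lambda>x. ?Z (?Y x)) ` E" by simp
    also have "\<dots> \<subseteq> ?Z ` E" using bop_in[OF bY] by blast
    finally show "?Z ` E = E" using bop_in[OF bZ] by blast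
  qed
qed

text \<open>Symmetric to \<open>glued_surjective\<close>: the operators are glued by columns instead of rows, and
\<open>Q B\<inverse> + P R\<^sub>n\<close> is nearly a left inverse.\<close>

lemma glued_injective:
  "\<forall>\<^sub>F n in sequentially. kern E (\<lambda>x. B (cutoff (- S) x) + T n (cutoff S x)) = {0}"
proof -
  let ?D = "\<lambda>n x. T n x - B x"
  have sD: "uslow ?D" by (rule uslow_diff[OF uslow_T slow_B])
  note bD = uslow_bop[OF sD]
  let ?W1 = "\<lambda>n x. Binv (?D n x)" and ?W2 = "\<lambda>n x. Rn n (?D n x)"
  have s1: "uslow ?W1" by (rule uslow_comp[OF slow_Binv sD])
  have s2: "uslow ?W2" by (rule uslow_comp[OF uslow_Rn sD])
  note b1 = uslow_bop[OF s1] and b2 = uslow_bop[OF s2]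
  obtain c1 where c1: "\<And>n::nat. opb Binv c1" by (rule uslow_bound[OF slow_Binv]) blast
  obtain c2 where c2: "\<And>n. opb (Rn n) c2" by (rule uslow_bound[OF uslow_Rn]) blast
  have bDt: "bop (\<lambda>x. ?D n (trunc k x))" for n k by (rule bop_comp[OF bD bop_trunc])
  have n1: "null (\<lambda>n x. cutoff (- S) (?W1 n (cutoff S x)))"
    by (rule null_corner_right[OF s1 S null_comp_left[OF conv_right bDt c1]])
  have n2: "null (\<lambda>n x. cutoff S (?W2 n (cutoff (- S) x)))"
    using null_corner_right[OF s2 halfline_compl[OF S] null_comp_left[OF conv_right bDt c2]] by simp
  have n3: "null (\<lambda>n x. cutoff S (conj_shift (h n) K1 x))"
    by (rule null_finrank_escaping_left[OF bop_K1 finrank_K1 esc_S])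
  have bb1: "bop (\<lambda>x. cutoff (- S) (?W1 n (cutoff S x)))" for n by (rule bop_comp[OF bop_cutoff bop_comp[OF b1 bop_cutoff]])
  have bb2: "bop (\<lambda>x. cutoff S (?W2 n (cutoff (- S) x)))" for n by (rule bop_comp[OF bop_cutoff bop_comp[OF b2 bop_cutoff]])
  have bb3: "bop (\<lambda>x. cutoff S (conj_shift (h n) K1 x))" for n by (rule bop_comp[OF bop_cutoff bop_conj_shift[OF bop_K1]])
  let ?Err = "\<lambda>n x. (cutoff S (?W2 n (cutoff (- S) x)) + cutoff S (conj_shift (h n) K1 x)) + - cutoff (- S) (?W1 n (cutoff S x))"
  have bE: "bop (?Err n)" for n by (rule bop_plus[OF bop_plus[OF bb2 bb3] bop_uminus[OF bb1]])
  have "null ?Err"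
    by (rule null_add[OF null_add[OF n2 n3 bb2 bb3] null_uminus[OF n1 bb1] bop_plus[OF bb2 bb3] bop_uminus[OF bb1]])
  then have "\<forall>\<^sub>F n in sequentially. opb (?Err n) (1 / 2)" unfolding null_def by simp
  then show ?thesis
  proof eventually_elim
    case (elim n)
    let ?Z = "\<lambda>x. B (cutoff (- S) x) + T n (cutoff S x)"
    let ?Y = "\<lambda>x. cutoff (- S) (Binv x) + cutoff S (Rn n x)"
    have bZ: "bop ?Z" by (rule bop_plus[OF bop_comp[OF bop_B bop_cutoff] bop_comp[OF bop_T bop_cutoff]])
    have bY: "bop ?Y" by (rule bop_plus[OF bop_comp[OF bop_cutoff bop_Binv] bop_comp[OF bop_cutoff bop_Rn]])
    have YZ: "?Y (?Z x) = x - ?Err n x" if x: "x \<in> E" for x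
    proof -
      let ?P = "cutoff S x" and ?Q = "cutoff (- S) x" and ?K = "conj_shift (h n) K1"
      have PE: "?P \<in> E" and QE: "?Q \<in> E" by (rule cutoff_in[OF x])+
      have iE: "B ?Q \<in> E" "T n ?P \<in> E" "B ?P \<in> E" "T n ?Q \<in> E"
        using bop_in[OF bop_B] bop_in[OF bop_T] PE QE by auto
      have B1: "Binv (?Z x) = ?Q + Binv (T n ?P)" using bop_add[OF bop_Binv iE(1,2)] Binv_B[OF QE] by simp
      have R1: "Rn n (?Z x) = Rn n (B ?Q) + (?P - ?K ?P)"
        using bop_add[OF bop_Rn iE(1,2)] by (simp add: Rn_T)
      have W1: "?W1 n ?P = Binv (T n ?P) - ?P" using bop_diff[OF bop_Binv iE(2,3)] Binv_B[OF PE] by simp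
      have W2: "?W2 n ?Q = (?Q - ?K ?Q) - Rn n (B ?Q)" using bop_diff[OF bop_Rn iE(4,1)] by (simp add: Rn_T)
      have K: "?K x = ?K ?P + ?K ?Q"
        using bop_add[OF bop_conj_shift[OF bop_K1] PE QE] by (simp add: cutoff_split)
      have "?Y (?Z x) = (cutoff (- S) ?Q + cutoff (- S) (Binv (T n ?P))) + (cutoff S (Rn n (B ?Q)) + (cutoff S ?P - cutoff S (?K ?P)))"
        unfolding B1 R1 cutoff_linear ..
      also have "\<dots> = (?Q + cutoff (- S) (Binv (T n ?P))) + (cutoff S (Rn n (B ?Q)) + (?P - cutoff S (?K ?P)))"
        by (simp add: cutoff_idem)
      also have "\<dots> = x - ?Err n x"
      proof -
        have e1: "cutoff (- S) (?W1 n ?P) = cutoff (- S) (Binv (T n ?P))" unfolding W1 cutoff_linear cutoff_compl_self by simp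
        have e2: "cutoff S (?W2 n ?Q) = - cutoff S (?K ?Q) - cutoff S (Rn n (B ?Q))"
          unfolding W2 cutoff_linear cutoff_compl_self by simp
        have "x = ?P + ?Q" by (simp add: cutoff_split)
        moreover have "?Err n x = (- cutoff S (?K ?Q) - cutoff S (Rn n (B ?Q)) + (cutoff S (?K ?P) + cutoff S (?K ?Q))) + - cutoff (- S) (Binv (T n ?P))"
          unfolding e1 e2 K cutoff_linear ..
        ultimately show ?thesis by (simp add: algebra_simps)
      qed
      finally show ?thesis .
    qed
    have inj: "inj_on (\<lambda>x. x - ?Err n x) E" by (rule ident_minus_small_bij(1)[OF bE elim]) simp_all
    show "kern E ?Z = {0}"
    proof (rule subset_antisym)
      show "kern E ?Z \<subseteq> {0}"
      proof
        fix x assume "x \<in> kern E ?Z"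
        then have x: "x \<in> E" "?Z x = 0" by (simp_all add: kern_def)
        have "x - ?Err n x = ?Y 0" using YZ[OF x(1)] unfolding x(2) by simp
        also have "\<dots> = 0 - ?Err n 0" unfolding bop_zero[OF bY] bop_zero[OF bE] by simp
        finally have "x = 0" using inj_onD[OF inj _ x(1) V_0] by blast
        then show "x \<in> {0}" by simp
      qed
      show "{0} \<subseteq> kern E ?Z" using V_0 bop_zero[OF bZ] by (simp add: kern_def)
    qed
  qed
qed

section \<open>The index at infinity\<close>

lemma fredholm_B: "alg_fredholm E B" "index E B = 0"
  using index_bij[OF V bop_endo[OF bop_B] B_bij] by auto

lemma fredholm_T: "alg_fredholm E (T n)"
proof -
  have "alg_fredholm E (shift (- h n) \<circ> (A \<circ> shift (h n)))"
    by (rule alg_fredholm_comp(1)[OF V fredholm_shift(1) alg_fredholm_comp(1)[OF V fred_A fredholm_shift(1)]])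
  moreover have "shift (- h n) \<circ> (A \<circ> shift (h n)) = T n" by (simp add: conj_shift_def fun_eq_iff)
  ultimately show ?thesis by simp
qed

lemma halves_T:
  "alg_fredholm E (half S (T n))" "alg_fredholm E (half (- S) (T n))"
  using fredholm_half[OF _ LA_conj_shift S fredholm_T, of n] uslow_subseq[OF uslow_T, of "\<lambda>_. n"] by auto

lemma halves_B:
  "alg_fredholm E (half S B)" "alg_fredholm E (half (- S) B)" "index E (half S B) + index E (half (- S) B) = 0"
  using fredholm_half[OF slow_B LA_B S fredholm_B(1)] fredholm_B(2) by auto

text \<open>The two ways of gluing differ from the product \<open>G\<close> of the halves only by corners. So both have the
index of \<open>G\<close>, which is nonnegative by surjectivity of the one and nonpositive by injectivity of
the other.\<close>

lemma index_glued:
  shows "\<forall>\<^sub>F n in sequentially. index E (half S (T n)) + index E (half (- S) B) = 0"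
  using eventually_conj[OF glued_surjective glued_injective]
proof eventually_elim
  case (elim n)
  let ?G = "half S (T n) \<circ> half (- S) B"
  let ?Z = "\<lambda>x. cutoff (- S) (B x) + cutoff S (T n x)" and ?Z' = "\<lambda>x. B (cutoff (- S) x) + T n (cutoff S x)"
  have fG: "alg_fredholm E ?G" "index E ?G = index E (half S (T n)) + index E (half (- S) B)"
    by (rule alg_fredholm_comp[OF V halves_T(1) halves_B(2)])+
  have bG: "bop ?G" unfolding comp_def by (rule bop_comp[OF bop_half[OF bop_T] bop_half[OF bop_B]])
  have sT: "slow (T n)" by (rule uslow_subseq[OF uslow_T])
  note aT = corner_approximable[OF sT LA_conj_shift S]
    and aB = corner_approximable[OF slow_B LA_B halfline_compl[OF S], unfolded double_complement]
    and aT' = corner_approximable[OF sT LA_conj_shift halfline_compl[OF S], unfolded double_complement]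
    and aB' = corner_approximable[OF slow_B LA_B S]
  note G = half_comp[OF bop_T bop_B, of _ S n]
  have decB: "B x = B (cutoff S x) + B (cutoff (- S) x)" and decT: "T n x = T n (cutoff S x) + T n (cutoff (- S) x)" if x: "x \<in> E" for x
    using bop_add[OF bop_B cutoff_in[OF x] cutoff_in[OF x], of S "- S"] bop_add[OF bop_T cutoff_in[OF x] cutoff_in[OF x], of n S "- S"]
    by (simp_all add: cutoff_split)
  have 1: "?G x + (cutoff S (T n (cutoff (- S) x)) + cutoff (- S) (B (cutoff S x))) = ?Z x" if x: "x \<in> E" for x
  proof -
    have "?Z x = (cutoff (- S) (B (cutoff S x)) + cutoff (- S) (B (cutoff (- S) x))) + (cutoff S (T n (cutoff S x)) + cutoff S (T n (cutoff (- S) x)))"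
      unfolding decB[OF x] decT[OF x] cutoff_linear ..
    then show ?thesis unfolding comp_def G[OF x] by (simp add: algebra_simps)
  qed
  have 2: "?G x + (cutoff (- S) (T n (cutoff S x)) + cutoff S (B (cutoff (- S) x))) = ?Z' x" if x: "x \<in> E" for x
  proof -
    have "?Z' x = (cutoff S (B (cutoff (- S) x)) + cutoff (- S) (B (cutoff (- S) x))) + (cutoff S (T n (cutoff S x)) + cutoff (- S) (T n (cutoff S x)))"
      unfolding cutoff_split ..
    then show ?thesis unfolding comp_def G[OF x] by (simp add: algebra_simps)
  qed
  have iZ: "index E ?Z = index E ?G"
    using fredholm_perturb(2)[OF bG fG(1) approximable_plus[OF aT aB]]
      alg_fredholm_cong(2)[of E "\<lambda>x. ?G x + (cutoff S (T n (cutoff (- S) x)) + cutoff (- S) (B (cutoff S x)))" ?Z, OF V 1]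
    by (simp only:)
  have iZ': "index E ?Z' = index E ?G"
    using fredholm_perturb(2)[OF bG fG(1) approximable_plus[OF aT' aB']]
      alg_fredholm_cong(2)[of E "\<lambda>x. ?G x + (cutoff (- S) (T n (cutoff S x)) + cutoff S (B (cutoff (- S) x)))" ?Z', OF V 2]
    by (simp only:)
  have "index E ?Z \<ge> 0" unfolding index_def conjunct1[OF elim] by (simp add: quotient_dim_self[OF V])
  moreover have "index E ?Z' \<le> 0"
    unfolding index_def conjunct2[OF elim] by (simp add: quotient_dim_self[OF complex_vector.subspace_single_0])
  ultimately show ?case using iZ iZ' fG(2) by linarith
qed

text \<open>Undoing the shift replaces the half line \<open>S\<close> by a translate \<open>S'\<close>. The projections onto the two
differ by multiplication with a function \<open>d\<close> supported in a bounded window.\<close>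

lemma index_half_T: "index E (half S (T n)) = index E (half S A)"
proof -
  let ?l = "h n"
  let ?S' = "(\<lambda>k. k - - ?l) ` S"
  have fA: "alg_fredholm E (half S A)" using fredholm_half(1)[OF slow_A LA_A S fred_A] .
  let ?K = "\<lambda>x. A x - x"
  have bK: "bop ?K" by (rule bop_subtract[OF bop_A bop_ident])
  define L where "L = nat \<bar>?l\<bar>"
  have half_eq: "half W A x = x + cutoff W (?K (cutoff W x))" if "x \<in> E" for W x
    unfolding half_def cutoff_linear cutoff_idem cutoff_compl by simp
  define d where "d x = cutoff ?S' x - cutoff S x" for x :: "int \<Rightarrow> 'a"
  have bd: "bop d" unfolding d_def by (rule bop_subtract[OF bop_cutoff bop_cutoff])
  have td: "trunc L (d x) = d x" "d (trunc L x) = d x" for x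
  proof -
    have *: "k \<in> ?S' \<longleftrightarrow> k \<in> S" if "\<not> \<bar>k\<bar> \<le> int L" for k
    proof -
      have "k \<in> ?S' \<longleftrightarrow> k - ?l \<in> S" by (auto simp: image_iff intro: bexI[of _ "k - ?l"])
      then show ?thesis using S that unfolding halfline_def L_def by auto
    qed
    show "trunc L (d x) = d x"
    proof
      fix k show "trunc L (d x) k = d x k"
        using *[of k] by (auto simp: d_def trunc_def cutoff_def mul_def minus_apply)
    qed
    show "d (trunc L x) = d x"
    proof
      fix k show "d (trunc L x) k = d x k"
        using *[of k] by (auto simp: d_def trunc_def cutoff_def mul_def minus_apply)
    qed
  qed
  have aK: "approximable (\<lambda>x. trunc L (?K x))" "approximable (\<lambda>x. ?K (trunc L x))"
    using LA_A unfolding locally_approximable_def by blast+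
  have "approximable (\<lambda>x. cutoff ?S' (?K (trunc L (d x))))"
    by (rule approximable_comp_left[OF approximable_comp_right[OF aK(2) bd] bop_cutoff])
  moreover have "approximable (\<lambda>x. d (trunc L (?K (cutoff S x))))"
    by (rule approximable_comp_left[OF approximable_comp_right[OF aK(1) bop_cutoff] bd])
  ultimately have ap: "approximable (\<lambda>x. cutoff ?S' (?K (d x)) + d (?K (cutoff S x)))"
    using approximable_plus[of "\<lambda>x. cutoff ?S' (?K (trunc L (d x)))" "\<lambda>x. d (trunc L (?K (cutoff S x)))"]
    unfolding td by blast
  have eq: "half S A x + (cutoff ?S' (?K (d x)) + d (?K (cutoff S x))) = half ?S' A x" if x: "x \<in> E" for x
  proof -
    have "?K (d x) = ?K (cutoff ?S' x) - ?K (cutoff S x)"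
      using bop_diff[OF bK cutoff_in[OF x] cutoff_in[OF x], of ?S' S] unfolding d_def .
    then have "cutoff ?S' (?K (d x)) = cutoff ?S' (?K (cutoff ?S' x)) - cutoff ?S' (?K (cutoff S x))" by (simp only: cutoff_linear)
    then show ?thesis unfolding half_eq[OF x] d_def[of "?K (cutoff S x)"] by simp
  qed
  have fp: "alg_fredholm E (half ?S' A)" "index E (half ?S' A) = index E (half S A)"
    using fredholm_perturb[OF bop_half[OF bop_A] fA ap]
      alg_fredholm_cong[of E "\<lambda>x. half S A x + (cutoff ?S' (?K (d x)) + d (?K (cutoff S x)))" "half ?S' A", OF V eq]
    by (simp_all only:)
  have "half S (T n) = shift (- ?l) \<circ> (half ?S' A \<circ> shift ?l)"
  proof
    fix x
    have im: "(\<lambda>k. k - ?l) ` ?S' = S" by (auto simp: image_image)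
    have imc: "(\<lambda>k. k - ?l) ` (- ?S') = - S"
    proof -
      have "bij (\<lambda>k::int. k - ?l)" by (rule bij_betwI[of _ _ _ "\<lambda>k. k + ?l"]) auto
      then show ?thesis using bij_image_Compl_eq[of "\<lambda>k. k - ?l" ?S'] im by simp
    qed
    show "half S (T n) x = (shift (- ?l) \<circ> (half ?S' A \<circ> shift ?l)) x"
      unfolding half_def comp_def conj_shift_def cutoff_shift im imc shift_linear
      by (simp add: shift_shift shift_0)
  qed
  then show ?thesis
    using alg_fredholm_comp[OF V fredholm_shift(1) alg_fredholm_comp(1)[OF V fp(1) fredholm_shift(1)], of "- ?l" ?l]
      alg_fredholm_comp(2)[OF V fp(1) fredholm_shift(1), of ?l] fredholm_shift(2) fp(2) by simp
qed

text \<open>The other half of \<open>B\<close> has the opposite index of both the \<open>S\<close>-half of \<open>B\<close> and the \<open>S\<close>-half of \<open>T n\<close>.\<close>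

lemma index_half_limit:
  "alg_fredholm E (half S B) \<and> index E (half S B) = index E (half S A)"
proof -
  obtain n where "index E (half S (T n)) + index E (half (- S) B) = 0"
    using index_glued by (auto simp: eventually_sequentially)
  then show ?thesis using halves_B index_half_T[of n] by simp
qed

end

section \<open>The index formula\<close>

context lp_space
begin

lemma proj_eq_cutoff: "proj_P = (cutoff {0..} :: 'a seq_op)" "proj_Q = (cutoff {..<0} :: 'a seq_op)"
  by (auto simp: proj_P_def proj_Q_def cutoff_def mul_def fun_eq_iff minus_apply)

lemma half_plus_eq: "half_plus A = half {0..} A" and half_minus_eq: "half_minus A = half {..<0} A"
proof -
  have c: "- {0..} = {..<0::int}" "- {..<0} = {0::int..}" by auto
  show "half_plus A = half {0..} A"
    by (rule ext) (simp only: half_plus_def half_def proj_eq_cutoff c plus_fun_apply[of _ _ "_ :: int \<Rightarrow> 'a"] comp_def)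
  show "half_minus A = half {..<0} A"
    by (rule ext) (simp only: half_minus_def half_def proj_eq_cutoff c plus_fun_apply[of _ _ "_ :: int \<Rightarrow> 'a"] comp_def add.commute)
qed

lemma limit_operator_null:
  assumes A: "bop A" and lim: "limit_operator p A h B"
  shows "bop B" "null (\<lambda>n x. trunc k (conj_shift (h n) A x - B x))"
    "null (\<lambda>n x. conj_shift (h n) A (trunc k x) - B (trunc k x))"
proof -
  show B: "bop B" using lim by (simp add: limit_operator_def lp_op_iff)
  have small: "null X" if b: "\<And>n. bop (X n)" and l: "(\<lambda>n. op_norm p (X n)) \<longlonglongrightarrow> 0" for X
    unfolding null_def
  proof (intro allI impI)
    fix e :: real assume "e > 0"
    then have "\<forall>\<^sub>F n in sequentially. op_norm p (X n) < e" using order_tendstoD(2)[OF l] by blast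
    then show "\<forall>\<^sub>F n in sequentially. opb (X n) e"
      by eventually_elim (rule opb_mono[OF opb_op_norm[OF b]], simp)
  qed
  have eq: "shift (- h n) \<circ> A \<circ> shift (h n) = conj_shift (h n) A" for n by (simp add: conj_shift_def fun_eq_iff)
  have e1: "trunc k \<circ> (conj_shift (h n) A - B) = (\<lambda>x. trunc k (conj_shift (h n) A x - B x))" for n
    by (rule ext) (simp only: comp_def fun_diff_def)
  have e2: "(conj_shift (h n) A - B) \<circ> trunc k = (\<lambda>x. conj_shift (h n) A (trunc k x) - B (trunc k x))" for n
    by (rule ext) (simp only: comp_def fun_diff_def)
  have l1: "(\<lambda>n. op_norm p (\<lambda>x. trunc k (conj_shift (h n) A x - B x))) \<longlonglongrightarrow> 0"
    using lim unfolding limit_operator_def eq e1[symmetric] by blast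
  have l2: "(\<lambda>n. op_norm p (\<lambda>x. conj_shift (h n) A (trunc k x) - B (trunc k x))) \<longlonglongrightarrow> 0"
    using lim unfolding limit_operator_def eq e2[symmetric] by blast
  show "null (\<lambda>n x. trunc k (conj_shift (h n) A x - B x))"
    by (rule small[OF _ l1]) (rule bop_comp[OF bop_trunc bop_subtract[OF bop_conj_shift[OF A] B]])
  show "null (\<lambda>n x. conj_shift (h n) A (trunc k x) - B (trunc k x))"
    by (rule small[OF _ l2])
      (rule bop_subtract[OF bop_comp[OF bop_conj_shift[OF A] bop_trunc] bop_comp[OF B bop_trunc]])
qed

lemma index_formula:
  assumes A: "A \<in> {id + K | K. K \<in> rich_band_dominated_compact p}" and fred: "fredholm p A"
    and Bp: "B\<^sub>p \<in> sigma_plus p A" and Bm: "B\<^sub>m \<in> sigma_minus p A"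
  shows "(fredholm p (half_plus A) \<and> fredholm p (half_plus B\<^sub>p) \<and> ind_plus p B\<^sub>p = ind_plus p A) \<and>
    (fredholm p (half_minus A) \<and> fredholm p (half_minus B\<^sub>m) \<and> ind_minus p B\<^sub>m = ind_minus p (A :: 'a seq_op)) \<and>
    ind p A = ind_plus p B\<^sub>p + ind_minus p B\<^sub>m"
proof -
  obtain K where K: "A = id + K" "K \<in> rich_band_dominated_compact p" using A by blast
  have Kb: "K \<in> band_dominated p" "\<And>i j. compact_operator (mat_entry K i j)"
    using K(2) unfolding rich_band_dominated_compact_def band_dominated_compact_def by auto
  have sK: "slow K" by (rule band_dominated_slow[OF Kb(1)])
  have Ax: "A x = x + K x" for x unfolding K(1) plus_fun_apply[of id K x] by simp
  have "slow (\<lambda>x. x - (0 - K x))" by (rule uslow_diff[OF slow_ident uslow_diff[OF slow_const_0 sK]])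
  then have sA: "slow A" by (rule uslow_cong) (simp add: Ax)
  have "(\<lambda>x. A x - x) = K" by (rule ext) (simp add: Ax)
  then have LA: "locally_approximable (\<lambda>x. A x - x)"
    using locally_approximable_compact_entries[OF sK Kb(2)] by simp
  have bA: "bop A" and fA: "alg_fredholm E A" using fred by (simp_all add: fredholm_iff)
  obtain hp where hp: "filterlim hp at_top sequentially" "limit_operator p A hp B\<^sub>p" using Bp unfolding sigma_plus_def by blast
  obtain hm where hm: "filterlim hm at_bot sequentially" "limit_operator p A hm B\<^sub>m" using Bm unfolding sigma_minus_def by blast
  have ep: "escaping hp {0..}"
    unfolding escaping_def
  proof
    fix m
    have "\<forall>\<^sub>F n in sequentially. int m + 1 \<le> hp n" using hp(1) unfolding filterlim_at_top by blast
    then show "\<forall>\<^sub>F n in sequentially. \<forall>k\<in>{0..}. int m < \<bar>k + hp n\<bar>" by eventually_elim auto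
  qed
  have em: "escaping hm {..<0}"
    unfolding escaping_def
  proof
    fix m
    have "\<forall>\<^sub>F n in sequentially. hm n \<le> - int m - 1" using hm(1) unfolding filterlim_at_bot by blast
    then show "\<forall>\<^sub>F n in sequentially. \<forall>k\<in>{..<0}. int m < \<bar>k + hm n\<bar>" by eventually_elim auto
  qed
  have Sp: "halfline {0..}" and Sm: "halfline {..<0}" by (simp_all add: halfline_def)
  interpret plus: limit_setting p ty A "B\<^sub>p" hp "{0..}"
    by unfold_locales (fact sA LA fA Sp ep limit_operator_null[OF bA hp(2)])+
  interpret minus: limit_setting p ty A "B\<^sub>m" hm "{..<0}"
    by unfold_locales (fact sA LA fA Sm em limit_operator_null[OF bA hm(2)])+
  have c: "- {0..} = {..<0::int}" by auto
  note hA = fredholm_half[OF sA LA Sp fA, unfolded c]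
  have f: "fredholm p (half_plus A)" "fredholm p (half_minus A)" "fredholm p (half_plus B\<^sub>p)" "fredholm p (half_minus B\<^sub>m)"
    unfolding fredholm_iff half_plus_eq half_minus_eq
    using hA plus.index_half_limit minus.index_half_limit bop_half[OF bA] bop_half[OF plus.bop_B] bop_half[OF minus.bop_B]
    by auto
  have "ind_plus p B\<^sub>p = ind_plus p A"
    unfolding ind_plus_def ind_eq_index[OF f(1)] ind_eq_index[OF f(3)] unfolding half_plus_eq using plus.index_half_limit by blast
  moreover have "ind_minus p B\<^sub>m = ind_minus p A"
    unfolding ind_minus_def ind_eq_index[OF f(2)] ind_eq_index[OF f(4)] unfolding half_minus_eq using minus.index_half_limit by blast
  moreover have "ind p A = ind_plus p A + ind_minus p A"
    unfolding ind_plus_def ind_minus_def ind_eq_index[OF fred] ind_eq_index[OF f(1)] ind_eq_index[OF f(2)]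
    unfolding half_plus_eq half_minus_eq by (rule hA(3))
  ultimately show ?thesis using f by simp
qed

end

theorem theorem10:
  fixes p :: real and A B\<^sub>p B\<^sub>m :: "'a::complex_banach seq_op"
  assumes "1 < p"
    and "symmetric_approximation_property TYPE('a)"
    and "A \<in> {id + K | K. K \<in> rich_band_dominated_compact p}"
    and "fredholm p A"
    and "B\<^sub>p \<in> sigma_plus p A"
    and "B\<^sub>m \<in> sigma_minus p A"
  shows "(fredholm p (half_plus A) \<and> fredholm p (half_plus B\<^sub>p) \<and>
            ind_plus p B\<^sub>p = ind_plus p A) \<and>
         (fredholm p (half_minus A) \<and> fredholm p (half_minus B\<^sub>m) \<and>
            ind_minus p B\<^sub>m = ind_minus p A) \<and>
         ind p A = ind_plus p B\<^sub>p + ind_minus p B\<^sub>m"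
proof -
  interpret lp_space p "TYPE('a)" by unfold_locales (fact assms(1,2))+
  show ?thesis by (rule index_formula[OF assms(3-6)])
qed

end
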